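(* Let $\omega$ and $p$ satisfy the standing assumptions in the context, let $R>0$, let $\rho_0$ be a radial non-rotating solution supported on $\overline{B_R}$ as in the context, and assume $M'(\rho_0(0))\neq0$, where $s\mapsto M(s)$ is the total mass as a function of the central density. Suppose moreover that the angular velocity profile $\omega(r)$ is constant. Let $\rho_\kappa$ be the rotating solutions constructed from $\zeta_\kappa$ as in the context. Then for $\kappa$ sufficiently small, the support of $\rho_\kappa$ is larger at the equator than at the poles, i.e. the boundary of $\operatorname{supp}\rho_\kappa$, which is $g_{\zeta_\kappa}(\partial B_R)$, satisfies $|g_{\zeta_\kappa}(x_e)|>|g_{\zeta_\kappa}(x_p)|$ whenever $x_e\in\partial B_R$ lies in the plane $\{x_3=0\}$ and $x_p=(0,0,\pm R)$.
   Context: $B_R=\{x\in\mathbb{R}^3:|x|<R\}$. Standing assumptions: $\omega$ is a function on $[0,\infty)$ with $\omega^2\in C^{1,\beta}_{loc}[0,\infty)$ for some $\beta\in(0,1)$. The pressure $p$ satisfies $p\in C^3(0,\infty)$, $p'>0$; there is $\gamma\in(1,2)$ with $\lim_{s\to0^+}s^{3-\gamma}p'''(s)=-c_0<0$; there is $\gamma^*\in(\frac65,2)$ with $\lim_{s\to\infty}s^{1-\gamma^*}p'(s)=c_1>0$. The specific enthalpy is $h(\rho)=\int_0^\rho\frac{p'(\alpha)}{\alpha}\,d\alpha$, an increasing bijection of $[0,\infty)$ with inverse $h^{-1}$. Radial solution: fix $\rho_0$ radial, positive in $B_R$, zero in $\mathbb{R}^3\setminus B_R$, in $C^2(B_R)\cap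 C^{1,\alpha}(\mathbb{R}^3)$ with $\alpha=\min(\frac{2-\gamma}{\gamma-1},1)$, satisfying $\nabla\left(\int_{\mathbb{R}^3}\frac{\rho_0(x')}{|x-x'|}dx'-h(\rho_0(x))\right)=0$ in $B_R$ (such $\rho_0$ is known to exist). Mass function: for $a>0$ let $v(r;a)$ solve $v''+\frac2rv'+4\pi h^{-1}(v)=0$, $v(0)=a$, $v'(0)=0$. For $s$ close to $\rho_0(0)$ and $a=h(s)$, $v(\cdot;a)$ has a first zero $R(a)$ near $R$, and $M(s)=\int_0^{R(a)}4\pi h^{-1}(v(r;a))r^2\,dr$. Construction: let $X$ be the space of $\zeta\in C^1(\overline{B_R})$ that are axisymmetric about the $x_3$-axis, even in $x_3$, with $\zeta(0)=0$ and finite norm $\|\zeta\|_X=\sup_{0<|x|\le R}|\nabla\zeta(x)|/|x|$. Put $g_\zeta(x)=x\left(1+\frac{\zeta(x)}{|x|^2}\right)$ with $g_\zeta(0)=0$ (a homeomorphism onto its image for small $\zeta$), $\mathcal{M}(\zeta)=\frac{\int_{B_R}\rho_0\,dx}{\int_{B_R}\rho_0\det Dg_\zeta\,dx}$, $r(x)=\sqrt{x_1^2+x_2^2}$, and $$\mathcal{F}(\zeta,\kappa)(x)=\mathcal{M}(\zeta)\int_{g_\zeta(B_R)}\rho_0(g_\zeta^{-1}(y))\left(\frac1{|g_\zeta(x)-y|}-\frac1{|y|}\right)dy+\kappa\int_0^{r(g_\zeta(x))}\omega^2(s)s\,ds-h(\mathcal{M}(\zeta)\rho_0(x))+h(\mathcal{M}(\zeta)\rho_0(0)).$$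 Under the hypotheses, the implicit function theorem gives, for $|\kappa|$ small, a locally unique $C^1$ curve $\kappa\mapsto\zeta_\kappa\in X$ with $\zeta_0=0$ and $\mathcal{F}(\zeta_\kappa,\kappa)=0$. The rotating solutions are $\rho_\kappa(x)=\mathcal{M}(\zeta_\kappa)\rho_0(g_{\zeta_\kappa}^{-1}(x))$ on $g_{\zeta_\kappa}(\overline{B_R})$, and zero elsewhere.
   Formalization: The constant angular velocity ω is taken to be nonzero and "κ sufficiently small" means 0 < κ < δ: for ω = 0 or κ = 0 the solution is the radial one and equality holds, and for small κ < 0 the inequality reverses. *)

theory Defs
  imports "HOL-Analysis.Analysis"
begin

section \<open>Regularity classes\<close>

text \<open>The derivative is taken within \<open>S\<close>, so that on a closed ball \<open>C1_on\<close> is the class of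
  functions that are $C^1$ up to the boundary, and no value outside the ball matters.\<close>

definition grad_on :: "(real^3) set \<Rightarrow> (real^3 \<Rightarrow> real) \<Rightarrow> real^3 \<Rightarrow> real^3" where
  "grad_on S f x = (\<chi> i. frechet_derivative f (at x within S) (axis i 1))"

definition C1_on :: "(real^3) set \<Rightarrow> (real^3 \<Rightarrow> real) \<Rightarrow> bool" where
  "C1_on S f \<longleftrightarrow> f differentiable_on S \<and> continuous_on S (grad_on S f)"

definition C2_on :: "(real^3) set \<Rightarrow> (real^3 \<Rightarrow> real) \<Rightarrow> bool" where
  "C2_on S f \<longleftrightarrow> C1_on S f \<and> (\<forall>i. C1_on S (\<lambda>x. grad_on S f x $ i))"

definition C1_holder :: "real \<Rightarrow> (real^3 \<Rightarrow> real) \<Rightarrow> bool" where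
  "C1_holder \<alpha> f \<longleftrightarrow> C1_on UNIV f \<and>
     (\<exists>C. \<forall>x y. norm (grad_on UNIV f x - grad_on UNIV f y) \<le> C * norm (x - y) powr \<alpha>)"

definition C1_holder_loc_halfline :: "real \<Rightarrow> (real \<Rightarrow> real) \<Rightarrow> bool" where
  "C1_holder_loc_halfline \<beta> f \<longleftrightarrow>
     (\<exists>f'. (\<forall>s\<ge>0. (f has_real_derivative f' s) (at s within {0..})) \<and>
           (\<forall>K. \<exists>C. \<forall>s\<in>{0..K}. \<forall>t\<in>{0..K}. \<bar>f' s - f' t\<bar> \<le> C * \<bar>s - t\<bar> powr \<beta>))"


section \<open>Pressure and enthalpy\<close>

definition enthalpy :: "(real \<Rightarrow> real) \<Rightarrow> real \<Rightarrow> real" where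
  "enthalpy p \<rho> = (LINT \<alpha>:{0..\<rho>}|lborel. deriv p \<alpha> / \<alpha>)"

text \<open>The last conjunct says that the integral defining the enthalpy converges, i.e. that the
  enthalpy is well defined. This excludes $p'(0+) > 0$, which the other conditions allow.
  Together with them it makes the enthalpy an increasing bijection of $[0,\infty)$.\<close>

definition admissible_pressure :: "(real \<Rightarrow> real) \<Rightarrow> real \<Rightarrow> real \<Rightarrow> bool" where
  "admissible_pressure p \<gamma> \<gamma>s \<longleftrightarrow>
     (\<forall>n<3. (deriv ^^ n) p C1_differentiable_on {0<..}) \<and>
     (\<forall>s>0. deriv p s > 0) \<and>
     \<gamma> \<in> {1<..<2} \<and>
     (\<exists>c0>0. ((\<lambda>s. s powr (3 - \<gamma>) * (deriv ^^ 3) p s) \<longlongrightarrow> - c0) (at_right 0)) \<and>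
     \<gamma>s \<in> {6/5<..<2} \<and>
     (\<exists>c1>0. ((\<lambda>s. s powr (1 - \<gamma>s) * deriv p s) \<longlongrightarrow> c1) at_top) \<and>
     (\<forall>\<rho>>0. set_integrable lborel {0..\<rho>} (\<lambda>\<alpha>. deriv p \<alpha> / \<alpha>))"

definition enthalpy_inv :: "(real \<Rightarrow> real) \<Rightarrow> real \<Rightarrow> real" where
  "enthalpy_inv p = inv_into {0..} (enthalpy p)"


section \<open>The radial non-rotating solution and the mass function\<close>

definition radial_solution :: "(real \<Rightarrow> real) \<Rightarrow> real \<Rightarrow> real \<Rightarrow> (real^3 \<Rightarrow> real) \<Rightarrow> bool" where
  "radial_solution p \<gamma> R \<rho>0 \<longleftrightarrow>
     (\<forall>x y. norm x = norm y \<longrightarrow> \<rho>0 x = \<rho>0 y) \<and>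
     (\<forall>x\<in>ball 0 R. \<rho>0 x > 0) \<and>
     (\<forall>x. x \<notin> ball 0 R \<longrightarrow> \<rho>0 x = 0) \<and>
     C2_on (ball 0 R) \<rho>0 \<and>
     C1_holder (min ((2 - \<gamma>) / (\<gamma> - 1)) 1) \<rho>0 \<and>
     (\<forall>x\<in>ball 0 R.
        GDERIV (\<lambda>x. (LINT y|lborel. \<rho>0 y / norm (x - y)) - enthalpy p (\<rho>0 x)) x :> 0)"

text \<open>\<open>v\<close> solves the radial initial value problem with $v(0) = a$ up to its first zero \<open>Z\<close>.\<close>

definition solves_to_first_zero ::
    "(real \<Rightarrow> real) \<Rightarrow> real \<Rightarrow> (real \<Rightarrow> real) \<Rightarrow> real \<Rightarrow> bool" where
  "solves_to_first_zero p a v Z \<longleftrightarrow>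
     Z > 0 \<and> v 0 = a \<and> v Z = 0 \<and> (\<forall>r\<in>{0..<Z}. v r > 0) \<and>
     (\<exists>v'. v' 0 = 0 \<and>
        (\<forall>r\<in>{0..Z}. (v has_real_derivative v' r) (at r within {0..Z})) \<and>
        (\<forall>r\<in>{0<..Z}. (v' has_real_derivative
           - (2 / r) * v' r - 4 * pi * enthalpy_inv p (v r)) (at r within {0..Z})))"

text \<open>The description is proper wherever such a solution exists, because the initial value
  problem has at most one solution.\<close>

definition total_mass :: "(real \<Rightarrow> real) \<Rightarrow> real \<Rightarrow> real" where
  "total_mass p s = (THE m. \<exists>v Z. solves_to_first_zero p (enthalpy p s) v Z \<and>
     m = (LINT r:{0..Z}|lborel. 4 * pi * enthalpy_inv p (v r) * r\<^sup>2))"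


section \<open>The space \<open>X\<close>\<close>

definition cyl_radius :: "real^3 \<Rightarrow> real" where
  "cyl_radius x = sqrt ((x$1)\<^sup>2 + (x$2)\<^sup>2)"

definition X_norm :: "real \<Rightarrow> (real^3 \<Rightarrow> real) \<Rightarrow> real" where
  "X_norm R \<zeta> = (SUP x\<in>cball 0 R - {0}. norm (grad_on (cball 0 R) \<zeta> x) / norm x)"

text \<open>Elements of \<open>X\<close> are represented by functions on the whole space, of which only the values
  on the closed ball are ever used.\<close>

definition X_space :: "real \<Rightarrow> (real^3 \<Rightarrow> real) set" where
  "X_space R = {\<zeta>. C1_on (cball 0 R) \<zeta> \<and>
     (\<forall>x\<in>cball 0 R. \<forall>y\<in>cball 0 R. cyl_radius x = cyl_radius y \<and> x$3 = y$3 \<longrightarrow> \<zeta> x = \<zeta> y) \<and>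
     (\<forall>x\<in>cball 0 R. \<zeta> (vector [x$1, x$2, - x$3]) = \<zeta> x) \<and>
     \<zeta> 0 = 0 \<and>
     bdd_above ((\<lambda>x. norm (grad_on (cball 0 R) \<zeta> x) / norm x) ` (cball 0 R - {0}))}"

text \<open>$C^1$ curves $(-\epsilon,\epsilon) \to X$ with respect to the norm of \<open>X\<close>; \<open>\<zeta>'\<close> is the
  derivative of the curve.\<close>

definition X_C1_curve :: "real \<Rightarrow> real \<Rightarrow> (real \<Rightarrow> real^3 \<Rightarrow> real) \<Rightarrow> bool" where
  "X_C1_curve R \<epsilon> \<zeta> \<longleftrightarrow>
     (\<forall>\<kappa>\<in>{-\<epsilon><..<\<epsilon>}. \<zeta> \<kappa> \<in> X_space R) \<and>
     (\<exists>\<zeta>'. \<forall>\<kappa>\<in>{-\<epsilon><..<\<epsilon>}. \<zeta>' \<kappa> \<in> X_space R \<and>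
        ((\<lambda>t. X_norm R (\<lambda>x. (\<zeta> (\<kappa> + t) x - \<zeta> \<kappa> x) / t - \<zeta>' \<kappa> x)) \<longlongrightarrow> 0) (at 0) \<and>
        ((\<lambda>\<mu>. X_norm R (\<lambda>x. \<zeta>' \<mu> x - \<zeta>' \<kappa> x)) \<longlongrightarrow> 0) (at \<kappa>))"


section \<open>Deformations and rotating solutions\<close>

definition deform :: "(real^3 \<Rightarrow> real) \<Rightarrow> real^3 \<Rightarrow> real^3" where
  "deform \<zeta> x = (1 + \<zeta> x / (norm x)\<^sup>2) *\<^sub>R x"

definition deform_inv :: "real \<Rightarrow> (real^3 \<Rightarrow> real) \<Rightarrow> real^3 \<Rightarrow> real^3" where
  "deform_inv R \<zeta> = inv_into (cball 0 R) (deform \<zeta>)"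

definition mass_factor :: "real \<Rightarrow> (real^3 \<Rightarrow> real) \<Rightarrow> (real^3 \<Rightarrow> real) \<Rightarrow> real" where
  "mass_factor R \<rho>0 \<zeta> =
     (LINT x:ball 0 R|lborel. \<rho>0 x) /
     (LINT x:ball 0 R|lborel. \<rho>0 x * det (jacobian (deform \<zeta>) (at x)))"

definition F_op :: "(real \<Rightarrow> real) \<Rightarrow> (real \<Rightarrow> real) \<Rightarrow> real \<Rightarrow> (real^3 \<Rightarrow> real) \<Rightarrow>
    (real^3 \<Rightarrow> real) \<Rightarrow> real \<Rightarrow> real^3 \<Rightarrow> real" where
  "F_op p \<omega> R \<rho>0 \<zeta> \<kappa> x =
     mass_factor R \<rho>0 \<zeta> *
       (LINT y:deform \<zeta> ` ball 0 R|lborel.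
          \<rho>0 (deform_inv R \<zeta> y) * (1 / norm (deform \<zeta> x - y) - 1 / norm y))
     + \<kappa> * (LINT s:{0..cyl_radius (deform \<zeta> x)}|lborel. (\<omega> s)\<^sup>2 * s)
     - enthalpy p (mass_factor R \<rho>0 \<zeta> * \<rho>0 x)
     + enthalpy p (mass_factor R \<rho>0 \<zeta> * \<rho>0 0)"

definition solution_curve :: "(real \<Rightarrow> real) \<Rightarrow> (real \<Rightarrow> real) \<Rightarrow> real \<Rightarrow> (real^3 \<Rightarrow> real) \<Rightarrow>
    real \<Rightarrow> (real \<Rightarrow> real^3 \<Rightarrow> real) \<Rightarrow> bool" where
  "solution_curve p \<omega> R \<rho>0 \<epsilon> \<zeta> \<longleftrightarrow>
     X_C1_curve R \<epsilon> \<zeta> \<and> (\<forall>x\<in>cball 0 R. \<zeta> 0 x = 0) \<and>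
     (\<forall>\<kappa>\<in>{-\<epsilon><..<\<epsilon>}. \<forall>x\<in>cball 0 R. F_op p \<omega> R \<rho>0 (\<zeta> \<kappa>) \<kappa> x = 0)"

definition rotating_density :: "real \<Rightarrow> (real^3 \<Rightarrow> real) \<Rightarrow> (real^3 \<Rightarrow> real) \<Rightarrow> real^3 \<Rightarrow> real" where
  "rotating_density R \<rho>0 \<zeta> x =
     (if x \<in> deform \<zeta> ` cball 0 R then mass_factor R \<rho>0 \<zeta> * \<rho>0 (deform_inv R \<zeta> x) else 0)"

definition supp :: "(real^3 \<Rightarrow> real) \<Rightarrow> (real^3) set" where
  "supp \<rho> = closure {x. \<rho> x \<noteq> 0}"

end

theory Submission
  imports Defs
begin

text \<open>Let \<open>\<eta>\<close> be the derivative of the curve at \<open>\<kappa> = 0\<close>, and let \<open>- a x\<close> and \<open>- b y\<close> be the gradients of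
  the potential of \<open>\<rho>0\<close> and of \<open>\<rho>0\<close> itself. With \<open>\<sigma>\<close> the exchange of the first and third
  coordinates, \<open>D = \<eta> - \<eta> \<circ> \<sigma>\<close> satisfies
  \<open>a D = T (b D) + (w\<^sup>2 / 2) (x1\<^sup>2 - x3\<^sup>2)\<close>, where \<open>T\<close> is the Newtonian potential; the enthalpy and
  all radial contributions cancel. As \<open>D\<close> is also odd under
  \<open>\<tau> (x1, x2, x3) = (- x3, x2, - x1)\<close>, the operator \<open>T\<close> acts on it by the Green-type kernel of the
  wedge \<open>x1 > \<bar>x3\<bar>\<close>, which is positive there, and the inhomogeneity is positive there too.
  Translation invariance gives \<open>a (x1 - x3) = T (b (y1 - y3))\<close>, so \<open>x1 - x3\<close> is a strict positive
  supersolution for the wedge kernel. Pairing it with the negative part of \<open>D\<close> on the wedge shows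
  that \<open>b D \<ge> 0\<close> there, hence \<open>D > 0\<close> at the equator, that is, \<open>\<eta>\<close> is larger at the equator than at
  the pole. The signs \<open>a \<ge> 0\<close> and \<open>b \<ge> 0\<close> come from the minimum principle for the potential and
  from \<open>h (\<rho>0) = T \<rho>0 + const\<close>.\<close>


section \<open>Newtonian potentials of bounded densities\<close>

text \<open>The coefficients \<open>a\<close> and \<open>b\<close> may vanish, and \<open>b\<close>
  is controlled only like 1/|y| near the origin, so the linearized equation is never divided by them
  or inverted. Positivity is instead read off from two integrals. Averaging 1/|x - y| over the group
  generated by the two reflections gives a kernel G for densities odd under both, and a kernel H for
  densities odd under \<sigma> and even under \<tau>; |G| < |H| off the plane x1 = x3. With w = b
  |x1 - x3| and e the negative part of b D relative to the sign of x1^2 - x3^2, the two equations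
  yield int e (|H| w) <= int w (|G| e). As G is symmetric, the right side is int e (|G| w), which is
  smaller than the left side unless e = 0 almost everywhere. Signs and absolute values replace the
  wedge as a domain of integration. Comparing points of equal norm also avoids differentiating the
  mass factor: the enthalpies and constants cancel before the limit, and the factor survives only in
  front of the centrifugal term, where convergence to 1 is enough. The limits are taken along
  sequences of parameters, so that dominated convergence applies.\<close>

lemmas lint_diff = Bochner_Integration.integral_diff
  and lint_add = Bochner_Integration.integral_add
  and lint_sum = Bochner_Integration.integral_sum
  and lint_cong = Bochner_Integration.integral_cong
  and lintegrable_diff = Bochner_Integration.integrable_diff
  and lintegrable_add = Bochner_Integration.integrable_add
  and lintegrable_sum = Bochner_Integration.integrable_sum
  and lintegrable_bound = Bochner_Integration.integrable_bound

lemma ball_borel [measurable]: "ball z r \<in> sets borel"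
  by (rule borel_open) simp

lemma cball_borel [measurable]: "cball (z :: 'a::metric_space) r \<in> sets borel"
  by (rule borel_closed) simp

lemma dyadic_bracket:
  fixes t :: real assumes "0 < t" "t < 1"
  obtains n :: nat where "(1/2)^(Suc n) \<le> t" "t < (1/2)^n"
proof -
  obtain m where m: "(1/2::real)^m < t" using real_arch_pow_inv[of t "1/2"] assms by auto
  define k where "k = (LEAST m. (1/2::real)^m \<le> t)"
  have k: "(1/2::real)^k \<le> t" unfolding k_def by (rule LeastI[of _ m]) (use m in auto)
  then have "k \<noteq> 0" using assms by (cases k) auto
  then obtain n where n: "k = Suc n" by (cases k) auto
  have "\<not> (1/2::real)^n \<le> t" using not_less_Least[of n "\<lambda>m. (1/2::real)^m \<le> t"] n k_def by auto
  then show ?thesis using that[of n] k n by auto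
qed

text \<open>On the dyadic shell with |z| between 2^-(n+1) and 2^-n the integrand is at most 4^(n+1),
  while the ball containing the shell has volume proportional to 8^-n, so the bounds form a
  geometric series. Whole balls replace the shells because only an upper bound is wanted.\<close>

lemma nn_integral_inverse_square_ball:
  "(\<integral>\<^sup>+z. ennreal (1 / (norm z)\<^sup>2) * indicator (ball 0 1) z \<partial>(lborel :: (real^3) measure)) < \<infinity>"
proof -
  let ?g = "\<lambda>n z. ennreal (4 ^ Suc n) * indicator (ball 0 ((1/2)^n)) (z :: real^3)"
  have pt: "ennreal (1 / (norm z)\<^sup>2) * indicator (ball 0 1) z \<le> (\<Sum>n. ?g n z)" for z :: "real^3"
  proof (cases "z = 0 \<or> z \<notin> ball 0 1")
    case False
    then obtain n where n: "(1/2)^(Suc n) \<le> norm z" "norm z < (1/2)^n"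
      using dyadic_bracket[of "norm z"] by auto
    have "((1/2)^(Suc n))\<^sup>2 \<le> (norm z)\<^sup>2" by (rule power_mono) (use n in auto)
    moreover have "((1/2::real)^(Suc n))\<^sup>2 = 1 / 4^Suc n"
      by (simp add: power2_eq_square power_one_over flip: power_mult_distrib)
    ultimately have "1 / (norm z)\<^sup>2 \<le> 4 ^ Suc n"
      using False by (simp add: field_simps)
    then have "ennreal (1 / (norm z)\<^sup>2) * indicator (ball 0 1) z \<le> ?g n z"
      using n by (auto simp: indicator_def intro: ennreal_leI simp del: power_Suc)
    also have "\<dots> \<le> (\<Sum>n. ?g n z)"
    proof -
      have "sum (\<lambda>n. ?g n z) {n} \<le> (\<Sum>n. ?g n z)" by (rule sum_le_suminf) auto
      then show ?thesis by (simp only: sum.insert sum.empty finite.emptyI empty_iff not_False_eq_True add_0_right)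
    qed
    finally show ?thesis .
  qed auto
  have vol: "(\<integral>\<^sup>+z. ?g n z \<partial>lborel) = ennreal (4 * unit_ball_vol 3 * (1/2)^n)" for n
  proof -
    have "(\<integral>\<^sup>+z. ?g n z \<partial>lborel) = ennreal (4 ^ Suc n) * emeasure lborel (ball (0::real^3) ((1/2)^n))"
      by (rule nn_integral_cmult_indicator) auto
    also have "emeasure lborel (ball (0::real^3) ((1/2)^n)) = ennreal (unit_ball_vol 3 * ((1/2)^n)^3)"
      by (subst emeasure_ball) auto
    also have "ennreal (4 ^ Suc n) * ennreal (unit_ball_vol 3 * ((1/2)^n)^3) = ennreal (4 ^ Suc n * (unit_ball_vol 3 * ((1/2)^n)^3))"
      by (simp add: ennreal_mult)
    also have "4 ^ Suc n * (unit_ball_vol 3 * ((1/2)^n)^3) = 4 * unit_ball_vol 3 * ((4::real) ^ n * ((1/2)^n)^3)"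
      by simp
    also have "(4::real) ^ n * ((1/2)^n)^3 = (4 * (1/2)^3)^n"
      by (simp only: power_mult_distrib power_mult[symmetric] mult.commute)
    also have "4 * (1/2::real)^3 = 1/2" by (simp add: power3_eq_cube)
    finally show ?thesis .
  qed
  have "(\<integral>\<^sup>+z. ennreal (1 / (norm z)\<^sup>2) * indicator (ball 0 1) z \<partial>(lborel :: (real^3) measure))
      \<le> (\<integral>\<^sup>+z. (\<Sum>n. ?g n z) \<partial>lborel)"
    by (intro nn_integral_mono pt)
  also have "\<dots> = (\<Sum>n. \<integral>\<^sup>+z. ?g n z \<partial>lborel)"
    by (intro nn_integral_suminf) measurable
  also have "\<dots> = (\<Sum>n. ennreal (4 * unit_ball_vol 3 * (1/2)^n))"
    using vol by simp
  also have "\<dots> = ennreal (\<Sum>n. 4 * unit_ball_vol 3 * (1/2)^n)"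
    by (intro suminf_ennreal2 summable_mult summable_geometric) auto
  also have "\<dots> < \<infinity>" by simp
  finally show ?thesis .
qed

lemma nn_integral_lborel_translate:
  fixes f :: "'a::euclidean_space \<Rightarrow> ennreal"
  assumes "f \<in> borel_measurable borel"
  shows "(\<integral>\<^sup>+y. f (y - z) \<partial>lborel) = (\<integral>\<^sup>+y. f y \<partial>lborel)"
proof -
  have "(\<integral>\<^sup>+y. f y \<partial>lborel) = (\<integral>\<^sup>+y. f y \<partial>distr lborel borel ((+) (- z)))"
    by (simp add: lborel_distr_plus)
  also have "\<dots> = (\<integral>\<^sup>+y. f (- z + y) \<partial>lborel)"
    using assms by (subst nn_integral_distr) auto
  finally show ?thesis by (simp add: add.commute)
qed

text \<open>Uniformity in \<open>z\<close> comes from a split: the part with |y - z| < 1 is at most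
  a translate of the unit-ball integral, and elsewhere the kernel is at most 1, which costs only the
  volume of \<open>cball 0 r\<close>.\<close>

lemma inverse_square_kernel_bound:
  "\<exists>C\<ge>0. \<forall>z :: real^3. (\<integral>\<^sup>+y. ennreal (1 / (norm (z - y))\<^sup>2) * indicator (cball 0 r) y \<partial>lborel) \<le> ennreal C"
proof -
  let ?I = "(\<integral>\<^sup>+z. ennreal (1 / (norm z)\<^sup>2) * indicator (ball 0 1) z \<partial>(lborel :: (real^3) measure))"
  let ?V = "emeasure lborel (cball (0::real^3) r)"
  have V: "?V < \<infinity>" by (rule emeasure_bounded_finite) simp
  have fin: "?I + ?V < \<infinity>" using nn_integral_inverse_square_ball V by simp
  define C where "C = enn2real (?I + ?V)"
  have "(\<integral>\<^sup>+y. ennreal (1 / (norm (z - y))\<^sup>2) * indicator (cball 0 r) y \<partial>lborel) \<le> ennreal C" for z :: "real^3"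
  proof -
    have pt: "ennreal (1 / (norm (z - y))\<^sup>2) * indicator (cball 0 r) y
       \<le> ennreal (1 / (norm (y - z))\<^sup>2) * indicator (ball 0 1) (y - z) + indicator (cball 0 r) y" for y
    proof (cases "norm (y - z) < 1")
      case True
      then show ?thesis by (auto simp: indicator_def norm_minus_commute)
    next
      case False
      then have "1 \<le> (norm (z - y))\<^sup>2" by (simp add: norm_minus_commute)
      then have "1 / (norm (z - y))\<^sup>2 \<le> 1" by (simp add: divide_le_eq_1)
      then have "ennreal (1 / (norm (z - y))\<^sup>2) \<le> 1" by (simp add: ennreal_le_1)
      then show ?thesis by (auto simp: indicator_def intro: add_increasing)
    qed
    have "(\<integral>\<^sup>+y. ennreal (1 / (norm (z - y))\<^sup>2) * indicator (cball 0 r) y \<partial>lborel)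
      \<le> (\<integral>\<^sup>+y. (ennreal (1 / (norm (y - z))\<^sup>2) * indicator (ball 0 1) (y - z) + indicator (cball 0 r) y) \<partial>lborel)"
      by (intro nn_integral_mono pt)
    also have "\<dots> = (\<integral>\<^sup>+y. ennreal (1 / (norm (y - z))\<^sup>2) * indicator (ball 0 1) (y - z) \<partial>lborel) + ?V"
    proof (subst nn_integral_add)
      show "(\<lambda>y. ennreal (1 / (norm (y - z))\<^sup>2) * indicator (ball 0 1) (y - z)) \<in> borel_measurable lborel"
        by measurable
      show "indicator (cball 0 r) \<in> borel_measurable (lborel :: (real^3) measure)"
        by (rule borel_measurable_indicator) (simp add: borel_closed)
    qed (simp add: borel_closed)
    also have "(\<integral>\<^sup>+y. ennreal (1 / (norm (y - z))\<^sup>2) * indicator (ball 0 1) (y - z) \<partial>lborel) = ?I"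
      by (rule nn_integral_lborel_translate[of "\<lambda>y. ennreal (1 / (norm y)\<^sup>2) * indicator (ball 0 1) y" z]) measurable
    finally show ?thesis using fin by (simp add: C_def)
  qed
  then show ?thesis by (intro exI[of _ C]) (auto simp: C_def)
qed

abbreviation inv_sq :: "real \<Rightarrow> real^3 \<Rightarrow> real^3 \<Rightarrow> real" where
  "inv_sq r z y \<equiv> 1 / (norm (z - y))\<^sup>2 * indicator (cball 0 r) y"

abbreviation inv_norm :: "real \<Rightarrow> real^3 \<Rightarrow> real^3 \<Rightarrow> real" where
  "inv_norm r z y \<equiv> 1 / norm (z - y) * indicator (cball 0 r) y"

text \<open>One constant serves all centres and both kernels, so that potentials of densities with
  \<open>bdd_supp r B\<close> are bounded and Lipschitz with constants linear in
  \<open>B\<close>.\<close>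

definition kernel_const :: "real \<Rightarrow> real" where
  "kernel_const r = (SOME C. C \<ge> 0 \<and> (\<forall>z :: real^3. integrable lborel (\<lambda>y. inv_sq r z y) \<and>
     (LINT y|lborel. inv_sq r z y) \<le> C \<and>
     integrable lborel (\<lambda>y. inv_norm r z y) \<and>
     (LINT y|lborel. inv_norm r z y) \<le> C))"

lemma kernel_const:
  shows kernel_const_nonneg: "kernel_const r \<ge> 0"
    and inverse_square_integrable: "integrable lborel (\<lambda>y. inv_sq r z y)"
    and inverse_square_integral_le: "(LINT y|lborel. inv_sq r z y) \<le> kernel_const r"
    and inverse_integrable: "integrable lborel (\<lambda>y. inv_norm r z y)"
    and inverse_integral_le: "(LINT y|lborel. inv_norm r z y) \<le> kernel_const r"
proof -
  obtain C where C: "C \<ge> 0" "\<And>z :: real^3. (\<integral>\<^sup>+y. ennreal (1 / (norm (z - y))\<^sup>2) * indicator (cball 0 r) y \<partial>lborel) \<le> ennreal C"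
    using inverse_square_kernel_bound by blast
  have sq: "integrable lborel (\<lambda>y. inv_sq r z y) \<and>
     (LINT y|lborel. inv_sq r z y) \<le> C" for z :: "real^3"
  proof -
    have e: "(\<integral>\<^sup>+y. ennreal (inv_sq r z y) \<partial>lborel) \<le> ennreal C"
    proof -
      have "ennreal (inv_sq r z y) = ennreal (1 / (norm (z - y))\<^sup>2) * indicator (cball 0 r) y" for y
        by (simp add: indicator_def)
      then show ?thesis using C(2)[of z] by simp
    qed
    have i: "integrable lborel (\<lambda>y. inv_sq r z y)"
    proof (rule integrableI_nonneg)
      show "(\<lambda>y. inv_sq r z y) \<in> borel_measurable lborel" by measurable
      show "(\<integral>\<^sup>+y. ennreal (inv_sq r z y) \<partial>lborel) < \<infinity>"
        using e by (rule le_less_trans) simp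
    qed simp
    then show ?thesis
      using e C(1) nn_integral_eq_integral[OF i] by (auto simp: ennreal_le_iff)
  qed
  let ?V = "measure lborel (cball (0::real^3) r)"
  have V: "integrable lborel (indicator (cball (0::real^3) r) :: _ \<Rightarrow> real)"
    using emeasure_bounded_finite[of "cball (0::real^3) r"]
    by (intro integrable_real_indicator) (simp_all add: borel_closed)
  have pt: "inv_norm r z y \<le> inv_sq r z y + indicator (cball 0 r) y" for z y :: "real^3"
  proof -
    define t where "t = 1 / norm (z - y)"
    have "t \<le> t\<^sup>2 + 1"
      using zero_le_power2[of "t - 1/2"] by (simp add: power2_eq_square algebra_simps)
    then have "1 / norm (z - y) \<le> 1 / (norm (z - y))\<^sup>2 + 1" by (simp add: t_def power_divide)
    then show ?thesis by (auto simp: indicator_def)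
  qed
  have one: "integrable lborel (\<lambda>y. inv_norm r z y) \<and>
     (LINT y|lborel. inv_norm r z y) \<le> C + ?V" for z :: "real^3"
  proof -
    have S: "integrable lborel (\<lambda>y. inv_sq r z y + indicator (cball 0 r) y)"
      using sq[of z] V by (intro lintegrable_add) auto
    have i: "integrable lborel (\<lambda>y. inv_norm r z y)"
    proof (rule lintegrable_bound[OF S])
      show "AE y in lborel. norm (inv_norm r z y)
        \<le> norm (inv_sq r z y + indicator (cball 0 r) y)"
        using pt[of z] by (intro AE_I2) (simp add: abs_of_nonneg)
    qed measurable
    have "(LINT y|lborel. inv_norm r z y)
       \<le> (LINT y|lborel. inv_sq r z y + indicator (cball 0 r) y)"
      by (intro integral_mono i S pt)
    also have "\<dots> \<le> C + ?V"
      using sq[of z] V by (subst lint_add) auto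
    finally show ?thesis using i by blast
  qed
  have "\<exists>C. C \<ge> 0 \<and> (\<forall>z :: real^3. integrable lborel (\<lambda>y. inv_sq r z y) \<and>
     (LINT y|lborel. inv_sq r z y) \<le> C \<and>
     integrable lborel (\<lambda>y. inv_norm r z y) \<and>
     (LINT y|lborel. inv_norm r z y) \<le> C)"
    using sq one C(1) by (intro exI[of _ "C + ?V"]) (auto intro: order_trans add_increasing2)
  from someI_ex[OF this, folded kernel_const_def]
  show "kernel_const r \<ge> 0"
    "integrable lborel (\<lambda>y. inv_sq r z y)"
    "(LINT y|lborel. inv_sq r z y) \<le> kernel_const r"
    "integrable lborel (\<lambda>y. inv_norm r z y)"
    "(LINT y|lborel. inv_norm r z y) \<le> kernel_const r"
    by blast+
qed

definition bdd_supp :: "real \<Rightarrow> real \<Rightarrow> (real^3 \<Rightarrow> real) \<Rightarrow> bool" where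
  "bdd_supp r B q \<longleftrightarrow> q \<in> borel_measurable borel \<and> (\<forall>y. \<bar>q y\<bar> \<le> B) \<and> (\<forall>y. y \<notin> cball 0 r \<longrightarrow> q y = 0)"

definition newton :: "(real^3 \<Rightarrow> real) \<Rightarrow> real^3 \<Rightarrow> real" where
  "newton q z = (LINT y|lborel. q y / norm (z - y))"

lemma bdd_suppD:
  assumes "bdd_supp r B q"
  shows "q \<in> borel_measurable borel" "\<bar>q y\<bar> \<le> B" "y \<notin> cball 0 r \<Longrightarrow> q y = 0" "B \<ge> 0"
    "\<bar>q y\<bar> \<le> B * indicator (cball 0 r) y"
proof -
  show "B \<ge> 0" using assms unfolding bdd_supp_def by (metis abs_ge_zero order_trans)
  show "\<bar>q y\<bar> \<le> B * indicator (cball 0 r) y"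
    using assms unfolding bdd_supp_def by (cases "y \<in> cball 0 r") auto
qed (use assms in \<open>auto simp: bdd_supp_def\<close>)

lemma newton_integrable:
  assumes "bdd_supp r B q"
  shows "integrable lborel (\<lambda>y. q y / norm (z - y))"
proof (rule lintegrable_bound[OF integrable_mult_right[OF inverse_integrable, of B]])
  note [measurable] = bdd_suppD(1)[OF assms]
  show "(\<lambda>y. q y / norm (z - y)) \<in> borel_measurable lborel" by measurable
  show "AE y in lborel. norm (q y / norm (z - y)) \<le> norm (B * (inv_norm r z y))"
  proof (rule AE_I2)
    fix y
    have "norm (q y / norm (z - y)) = \<bar>q y\<bar> / norm (z - y)" by simp
    also have "\<dots> \<le> B * indicator (cball 0 r) y / norm (z - y)"
      by (rule divide_right_mono[OF bdd_suppD(5)[OF assms]]) simp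
    also have "\<dots> = norm (B * (inv_norm r z y))"
      using bdd_suppD(4)[OF assms] by (simp add: abs_of_nonneg)
    finally show "norm (q y / norm (z - y)) \<le> norm (B * (inv_norm r z y))" .
  qed
qed

lemma newton_abs_le:
  assumes "bdd_supp r B q"
  shows "\<bar>newton q z\<bar> \<le> B * kernel_const r"
proof -
  have "\<bar>newton q z\<bar> \<le> (LINT y|lborel. \<bar>q y / norm (z - y)\<bar>)"
    unfolding newton_def by (rule integral_abs_bound)
  also have "\<dots> \<le> (LINT y|lborel. B * (inv_norm r z y))"
  proof (rule integral_mono)
    show "integrable lborel (\<lambda>y. \<bar>q y / norm (z - y)\<bar>)"
      using newton_integrable[OF assms] by (rule integrable_abs)
    show "integrable lborel (\<lambda>y. B * (inv_norm r z y))"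
      by (rule integrable_mult_right[OF inverse_integrable])
    fix y
    have "\<bar>q y\<bar> / norm (z - y) \<le> B * indicator (cball 0 r) y / norm (z - y)"
      by (rule divide_right_mono[OF bdd_suppD(5)[OF assms]]) simp
    then show "\<bar>q y / norm (z - y)\<bar> \<le> B * (inv_norm r z y)" by simp
  qed
  also have "\<dots> = B * (LINT y|lborel. inv_norm r z y)"
    by (rule integral_mult_right_zero)
  also have "\<dots> \<le> B * kernel_const r"
    by (intro mult_left_mono inverse_integral_le bdd_suppD(4)[OF assms])
  finally show ?thesis .
qed

text \<open>From 1/a - 1/b = (b - a)/(ab), the reverse triangle inequality and 1/(ab) <= 1/a^2 +
  1/b^2. The last step separates the two singularities, so that each is covered by the uniform
  inverse-square bound.\<close>

lemma kernel_diff_le: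
  fixes z z' y :: "real^3" assumes "y \<noteq> z" "y \<noteq> z'"
  shows "\<bar>1 / norm (z - y) - 1 / norm (z' - y)\<bar> \<le> norm (z - z') * (1 / (norm (z - y))\<^sup>2 + 1 / (norm (z' - y))\<^sup>2)"
proof -
  let ?a = "norm (z - y)" let ?b = "norm (z' - y)"
  have ab: "?a > 0" "?b > 0" using assms by auto
  have "1 / ?a - 1 / ?b = (?b - ?a) * (1 / ?a * (1 / ?b))" using ab by (simp add: field_simps)
  then have "\<bar>1 / ?a - 1 / ?b\<bar> = \<bar>?b - ?a\<bar> * (1 / ?a * (1 / ?b))" using ab by (simp add: abs_mult)
  also have "\<dots> \<le> norm (z - z') * (1 / ?a * (1 / ?b))"
  proof (rule mult_right_mono)
    have "\<bar>?b - ?a\<bar> \<le> norm ((z' - y) - (z - y))" by (rule norm_triangle_ineq3)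
    then show "\<bar>?b - ?a\<bar> \<le> norm (z - z')" by (simp add: norm_minus_commute)
  qed (use ab in auto)
  also have "1 / ?a * (1 / ?b) \<le> (1 / ?a)\<^sup>2 + (1 / ?b)\<^sup>2"
    using zero_le_power2[of "1 / ?a - 1 / ?b"] zero_le_power2[of "1 / ?a"] zero_le_power2[of "1 / ?b"]
      sum_squares_bound[of "1 / ?a" "1 / ?b"] by linarith
  finally show ?thesis by (simp add: power_divide mult_left_mono)
qed

text \<open>Applied later to difference quotients of densities with a common bound \<open>B\<close>:
  moving the evaluation point by o(1) then changes their potentials by o(1).\<close>

lemma newton_lipschitz:
  assumes "bdd_supp r B q"
  shows "\<bar>newton q z - newton q z'\<bar> \<le> 2 * B * kernel_const r * norm (z - z')"
proof -
  let ?s = "\<lambda>y. inv_sq r z y + inv_sq r z' y"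
  have I: "integrable lborel ?s" by (intro lintegrable_add inverse_square_integrable)
  have d: "newton q z - newton q z' = (LINT y|lborel. q y / norm (z - y) - q y / norm (z' - y))"
    unfolding newton_def using newton_integrable[OF assms] by (simp add: lint_diff)
  have "\<bar>newton q z - newton q z'\<bar> \<le> (LINT y|lborel. \<bar>q y / norm (z - y) - q y / norm (z' - y)\<bar>)"
    unfolding d by (rule integral_abs_bound)
  also have "\<dots> \<le> (LINT y|lborel. B * norm (z - z') * ?s y)"
  proof (rule integral_mono_AE)
    show "integrable lborel (\<lambda>y. \<bar>q y / norm (z - y) - q y / norm (z' - y)\<bar>)"
      by (intro integrable_abs lintegrable_diff newton_integrable[OF assms])
    show "integrable lborel (\<lambda>y. B * norm (z - z') * ?s y)" by (rule integrable_mult_right[OF I])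
    have "AE y in lborel. y \<noteq> z" "AE y in lborel. y \<noteq> z'"
      by (auto intro: AE_lborel_singleton)
    then show "AE y in lborel. \<bar>q y / norm (z - y) - q y / norm (z' - y)\<bar> \<le> B * norm (z - z') * ?s y"
    proof eventually_elim
      case (elim y)
      have "\<bar>q y / norm (z - y) - q y / norm (z' - y)\<bar> = \<bar>q y\<bar> * \<bar>1 / norm (z - y) - 1 / norm (z' - y)\<bar>"
        by (simp add: abs_mult[symmetric] right_diff_distrib)
      also have "\<dots> \<le> (B * indicator (cball 0 r) y) * (norm (z - z') * (1 / (norm (z - y))\<^sup>2 + 1 / (norm (z' - y))\<^sup>2))"
        using elim bdd_suppD(4,5)[OF assms]
        by (intro mult_mono kernel_diff_le bdd_suppD(5)[OF assms]) auto
      finally show ?case by (simp add: algebra_simps)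
    qed
  qed
  also have "\<dots> = B * norm (z - z') * (LINT y|lborel. ?s y)" by (rule integral_mult_right_zero)
  also have "\<dots> \<le> B * norm (z - z') * (2 * kernel_const r)"
    using bdd_suppD(4)[OF assms]
  proof (intro mult_left_mono)
    show "(LINT y|lborel. ?s y) \<le> 2 * kernel_const r"
    using inverse_square_integral_le[of z r] inverse_square_integral_le[of z' r]
    by (subst lint_add[OF inverse_square_integrable inverse_square_integrable]) linarith
  qed simp
  finally show ?thesis by (simp add: mult_ac)
qed

section \<open>Orthogonal invariance of potentials and the two reflections\<close>

lemma distr_lborel_orthogonal:
  fixes T :: "(real, 'n::{finite,wellorder}) vec \<Rightarrow> (real, 'n::{finite,wellorder}) vec"
  assumes T: "orthogonal_transformation T"
  shows "distr lborel borel T = lborel"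
proof (rule lborel_eqI[symmetric])
  fix l u :: "(real, 'n::{finite,wellorder}) vec" assume lu: "\<And>b. b \<in> Basis \<Longrightarrow> l \<bullet> b \<le> u \<bullet> b"
  have inv: "orthogonal_transformation (inv T)" by (rule orthogonal_transformation_inv[OF T])
  have bij: "bij T" by (rule orthogonal_transformation_bij[OF T])
  have Tm: "T \<in> borel_measurable borel"
    by (intro borel_measurable_continuous_onI linear_continuous_on
        linear_conv_bounded_linear[THEN iffD1] orthogonal_transformation_linear[OF T])
  have vim: "T -` box l u = inv T ` box l u"
    using bij by (rule bij_vimage_eq_inv_image)
  have "T -` box l u \<in> sets borel"
    using measurable_sets_borel[OF Tm, of "box l u"] by simp
  then have "emeasure (distr lborel borel T) (box l u) = emeasure lebesgue (inv T ` box l u)"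
    using Tm by (simp add: emeasure_distr vim)
  also have "\<dots> = ennreal (measure lebesgue (inv T ` box l u))"
    using measurable_orthogonal_image[OF inv lmeasurable_box, of l u]
    by (rule emeasure_eq_measure2)
  also have "\<dots> = ennreal (measure lebesgue (box l u))"
    using measure_orthogonal_image[OF inv lmeasurable_box, of l u] by simp
  also have "\<dots> = (\<Prod>b\<in>Basis. (u - l) \<bullet> b)"
    using lu by (simp add: measure_lborel_box_eq)
  finally show "emeasure (distr lborel borel T) (box l u) = (\<Prod>b\<in>Basis. (u - l) \<bullet> b)" .
qed simp

lemma orthogonal_transformation_borel [measurable_dest]:
  fixes T :: "(real, 'n::{finite,wellorder}) vec \<Rightarrow> (real, 'n::{finite,wellorder}) vec"
  assumes T: "orthogonal_transformation T"
  shows "T \<in> borel_measurable borel"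
  by (intro borel_measurable_continuous_onI linear_continuous_on
        linear_conv_bounded_linear[THEN iffD1] orthogonal_transformation_linear[OF T])

lemma integral_orthogonal:
  fixes T :: "(real, 'n::{finite,wellorder}) vec \<Rightarrow> (real, 'n::{finite,wellorder}) vec" and f :: "(real, 'n::{finite,wellorder}) vec \<Rightarrow> real"
  assumes T: "orthogonal_transformation T" and f: "f \<in> borel_measurable borel"
  shows "(LINT y|lborel. f (T y)) = (LINT y|lborel. f y)"
proof -
  have "(LINT y|lborel. f y) = (LINT y|distr lborel borel T. f y)"
    by (simp add: distr_lborel_orthogonal[OF T])
  also have "\<dots> = (LINT y|lborel. f (T y))"
    using orthogonal_transformation_borel[OF T] f by (subst integral_distr) auto
  finally show ?thesis by simp
qed

lemma orthogonal_transformation_dist: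
  assumes "orthogonal_transformation T"
  shows "norm (T x - T y) = norm (x - y)"
  using orthogonal_transformation_norm[OF assms, of "x - y"]
    linear_diff[OF orthogonal_transformation_linear[OF assms]] by metis

lemma newton_orthogonal:
  assumes T: "orthogonal_transformation T" and q: "bdd_supp r B q"
  shows "newton (\<lambda>y. q (T y)) z = newton q (T z)"
proof -
  note [measurable] = bdd_suppD(1)[OF q]
  have "newton q (T z) = (LINT y|lborel. q (T y) / norm (T z - T y))"
    unfolding newton_def by (rule integral_orthogonal[OF T, symmetric]) measurable
  then show ?thesis by (simp add: newton_def orthogonal_transformation_dist[OF T])
qed

lemma bdd_supp_orthogonal:
  assumes T: "orthogonal_transformation T" and q: "bdd_supp r B q"
  shows "bdd_supp r B (\<lambda>y. q (T y))"
  unfolding bdd_supp_def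
proof (intro conjI allI impI)
  note [measurable] = bdd_suppD(1)[OF q] orthogonal_transformation_borel[OF T]
  show "(\<lambda>y. q (T y)) \<in> borel_measurable borel" by measurable
  show "\<bar>q (T y)\<bar> \<le> B" for y by (rule bdd_suppD(2)[OF q])
  show "q (T y) = 0" if "y \<notin> cball 0 r" for y
    using that orthogonal_transformation_norm[OF T, of y] by (intro bdd_suppD(3)[OF q]) auto
qed

text \<open>\<open>swap13\<close> and \<open>antiswap13\<close> are the reflections in the
  orthogonal planes x1 = x3 and x1 = - x3. They commute, and their product is the half-turn (- x1,
  x2, - x3), which fixes every axisymmetric function that is even in x3. This is what makes
  \<open>D\<close> odd under the second reflection as well.\<close>

definition swap13 :: "real^3 \<Rightarrow> real^3" where
  "swap13 x = vector [x$3, x$2, x$1]"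

definition antiswap13 :: "real^3 \<Rightarrow> real^3" where
  "antiswap13 x = vector [- x$3, x$2, - x$1]"

lemma swap13_nth [simp]: "swap13 x $ 1 = x$3" "swap13 x $ 2 = x$2" "swap13 x $ 3 = x$1"
  by (simp_all add: swap13_def)

lemma antiswap13_nth [simp]:
  "antiswap13 x $ 1 = - x$3" "antiswap13 x $ 2 = x$2" "antiswap13 x $ 3 = - x$1"
  by (simp_all add: antiswap13_def)

lemma norm_sq_3: "(norm (x :: real^3))\<^sup>2 = (x$1)\<^sup>2 + (x$2)\<^sup>2 + (x$3)\<^sup>2"
  by (simp add: norm_vec_def L2_set_def sum_3)

lemma orthogonal_swap13: "orthogonal_transformation swap13"
  unfolding orthogonal_transformation
proof
  show "linear swap13"
    by (rule linearI) (simp_all add: vec_eq_iff forall_3)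
  show "\<forall>v. norm (swap13 v) = norm v"
    by (simp add: norm_vec_def L2_set_def sum_3 algebra_simps)
qed

lemma orthogonal_antiswap13: "orthogonal_transformation antiswap13"
  unfolding orthogonal_transformation
proof
  show "linear antiswap13"
    by (rule linearI) (simp_all add: vec_eq_iff forall_3)
  show "\<forall>v. norm (antiswap13 v) = norm v"
    by (simp add: norm_vec_def L2_set_def sum_3 algebra_simps)
qed

lemma swap13_swap13 [simp]: "swap13 (swap13 x) = x"
  and antiswap13_antiswap13 [simp]: "antiswap13 (antiswap13 x) = x"
  and swap13_antiswap13: "antiswap13 (swap13 x) = swap13 (antiswap13 x)"
  by (simp_all add: vec_eq_iff forall_3)

section \<open>Kernels in a wedge and positivity\<close>

lemma inverse_sqrt_diff:
  fixes u s :: real assumes "u > 0" "u + s > 0"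
  shows "1 / sqrt u - 1 / sqrt (u + s) = s * (1 / (sqrt u * sqrt (u + s) * (sqrt u + sqrt (u + s))))"
proof -
  define a where "a = sqrt u"
  define b where "b = sqrt (u + s)"
  have p: "a > 0" "b > 0" "a + b \<noteq> 0" using assms by (auto simp: a_def b_def add_pos_pos less_imp_neq[symmetric])
  have "s = (b - a) * (a + b)" using assms by (simp add: algebra_simps a_def b_def)
  then have "s * (1 / (a * b * (a + b))) = (b - a) / (a * b)" using p by simp
  also have "\<dots> = 1 / a - 1 / b" using p by (simp add: diff_divide_distrib)
  finally show ?thesis by (simp add: a_def b_def)
qed

text \<open>Convexity of 1/sqrt: a second difference with increments \<open>s\<close> and
  \<open>t\<close> has the sign of \<open>s * t\<close>. No derivative is taken, since a first
  difference is \<open>s\<close> times the explicit factor \<open>m\<close>, which is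
  decreasing.\<close>

lemma second_difference_inverse_sqrt:
  fixes P s t :: real
  assumes "P > 0" "P + s > 0" "P + t > 0" "P + s + t > 0"
  shows "s * t * (1 / sqrt P - 1 / sqrt (P + s) - 1 / sqrt (P + t) + 1 / sqrt (P + s + t)) \<ge> 0"
proof -
  define m where "m u = 1 / (sqrt u * sqrt (u + s) * (sqrt u + sqrt (u + s)))" for u
  have mono: "m v \<le> m u" if "0 < u" "0 < u + s" "u \<le> v" for u v
    unfolding m_def using that
    by (intro divide_left_mono mult_mono add_mono mult_pos_pos add_pos_pos) auto
  have "1 / sqrt P - 1 / sqrt (P + s) = s * m P"
    unfolding m_def using assms by (intro inverse_sqrt_diff) auto
  moreover have "1 / sqrt (P + t) - 1 / sqrt (P + t + s) = s * m (P + t)"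
    unfolding m_def using assms by (intro inverse_sqrt_diff) auto
  ultimately have "1 / sqrt P - 1 / sqrt (P + s) - 1 / sqrt (P + t) + 1 / sqrt (P + s + t) = s * (m P - m (P + t))"
    by (simp add: algebra_simps)
  then have E: "s * t * (1 / sqrt P - 1 / sqrt (P + s) - 1 / sqrt (P + t) + 1 / sqrt (P + s + t)) = s\<^sup>2 * (t * (m P - m (P + t)))"
    by (simp add: power2_eq_square)
  have "t * (m P - m (P + t)) \<ge> 0"
  proof (cases "t \<ge> 0")
    case True
    then show ?thesis using mono[of P "P + t"] assms by auto
  next
    case False
    then show ?thesis using mono[of "P + t" P] assms by (intro mult_nonpos_nonpos) (auto simp: algebra_simps)
  qed
  then show ?thesis unfolding E by (rule mult_nonneg_nonneg[OF zero_le_power2])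
qed

text \<open>The method of images for the wedge x1 > |x3| with zero values on both faces: charges +,
  -, -, + on the orbit of \<open>x\<close>.\<close>

definition wedge_kernel :: "real^3 \<Rightarrow> real^3 \<Rightarrow> real" where
  "wedge_kernel x y = 1 / norm (x - y) - 1 / norm (swap13 x - y)
     - 1 / norm (antiswap13 x - y) + 1 / norm (antiswap13 (swap13 x) - y)"

text \<open>The image kernel of the half-space x1 > x3, added to its mirror image under
  \<open>antiswap13\<close>. It suits y1 - y3, which is odd under \<open>swap13\<close> and even
  under \<open>antiswap13\<close>.\<close>

definition half_kernel :: "real^3 \<Rightarrow> real^3 \<Rightarrow> real" where
  "half_kernel x y = 1 / norm (x - y) - 1 / norm (swap13 x - y)
     + 1 / norm (antiswap13 x - y) - 1 / norm (antiswap13 (swap13 x) - y)"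

text \<open>Reflecting \<open>x\<close> in a plane through 0 with unit normal n adds 4 (x.n)(y.n) to
  the squared distance from \<open>y\<close>. The two normals are orthogonal, so the increments add
  up for the composition. The four squared distances P, P + s, P + t, P + s + t exhibit the wedge
  kernel as a second difference.\<close>

lemma norm_swap13_diff:
  "(norm (swap13 x - y))\<^sup>2 = (norm (x - y))\<^sup>2 + 2 * ((x$1 - x$3) * (y$1 - y$3))"
  "(norm (antiswap13 x - y))\<^sup>2 = (norm (x - y))\<^sup>2 + 2 * ((x$1 + x$3) * (y$1 + y$3))"
  "(norm (antiswap13 (swap13 x) - y))\<^sup>2 = (norm (x - y))\<^sup>2 + 2 * ((x$1 - x$3) * (y$1 - y$3)) + 2 * ((x$1 + x$3) * (y$1 + y$3))"
  unfolding norm_sq_3 by (simp_all add: power2_eq_square algebra_simps)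

lemma norm_swap_commute:
  "norm (swap13 x - y) = norm (swap13 y - x)" "norm (antiswap13 x - y) = norm (antiswap13 y - x)"
  "norm (antiswap13 (swap13 x) - y) = norm (antiswap13 (swap13 y) - x)"
  by (rule power2_eq_imp_eq; (unfold norm_swap13_diff)?; simp add: norm_minus_commute mult.commute add.commute)+

lemma wedge_kernel_commute: "wedge_kernel x y = wedge_kernel y x"
  unfolding wedge_kernel_def
  by (simp add: norm_swap_commute[of x y] norm_minus_commute[of x y])

text \<open>The kernels are \<open>d - d'\<close> and \<open>d + d'\<close>, where \<open>d\<close>
  and \<open>d'\<close> are first differences of 1/sqrt with the same increment \<open>s\<close>.
  Both have the sign of \<open>s\<close>, whence |d - d'| < |d + d'| for nonzero \<open>s\<close>,
  and convexity gives \<open>d - d'\<close> the sign of \<open>s * t\<close>. The excluded points, a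
  null set, are those where a distance vanishes.\<close>

lemma kernel_signs:
  assumes y: "y \<noteq> x" "y \<noteq> swap13 x" "y \<noteq> antiswap13 x" "y \<noteq> antiswap13 (swap13 x)"
  shows wedge_kernel_abs: "\<bar>wedge_kernel x y\<bar> = sgn ((x$1)\<^sup>2 - (x$3)\<^sup>2) * sgn ((y$1)\<^sup>2 - (y$3)\<^sup>2) * wedge_kernel x y"
    and half_kernel_abs: "\<bar>half_kernel x y\<bar> = sgn (x$1 - x$3) * sgn (y$1 - y$3) * half_kernel x y"
    and wedge_less_half: "(x$1 - x$3) * (y$1 - y$3) \<noteq> 0 \<Longrightarrow> \<bar>wedge_kernel x y\<bar> < \<bar>half_kernel x y\<bar>"
proof -
  define P where "P = (norm (x - y))\<^sup>2"
  define s where "s = 2 * ((x$1 - x$3) * (y$1 - y$3))"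
  define t where "t = 2 * ((x$1 + x$3) * (y$1 + y$3))"
  define d where "d = 1 / sqrt P - 1 / sqrt (P + s)"
  define d' where "d' = 1 / sqrt (P + t) - 1 / sqrt (P + s + t)"
  have n: "norm (x - y) = sqrt P" "norm (swap13 x - y) = sqrt (P + s)"
    "norm (antiswap13 x - y) = sqrt (P + t)" "norm (antiswap13 (swap13 x) - y) = sqrt (P + s + t)"
    by (rule real_sqrt_unique[symmetric]; simp add: P_def s_def t_def norm_swap13_diff)+
  have pos: "P > 0" "P + s > 0" "P + t > 0" "P + s + t > 0"
    using y n by (metis eq_iff_diff_eq_0 zero_less_norm_iff real_sqrt_gt_0_iff)+
  have W: "wedge_kernel x y = d - d'" and Hk: "half_kernel x y = d + d'"
    unfolding wedge_kernel_def half_kernel_def n d_def d'_def by simp_all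
  have st: "0 \<le> s * t * (d - d')"
    using second_difference_inverse_sqrt[OF pos] unfolding d_def d'_def by (simp add: algebra_simps)
  have zero: "s = 0 \<or> t = 0 \<Longrightarrow> d - d' = 0" unfolding d_def d'_def by auto
  have sgnst: "sgn ((x$1)\<^sup>2 - (x$3)\<^sup>2) * sgn ((y$1)\<^sup>2 - (y$3)\<^sup>2) = sgn s * sgn t"
  proof -
    have "((x$1)\<^sup>2 - (x$3)\<^sup>2) * ((y$1)\<^sup>2 - (y$3)\<^sup>2) = s * t * (1 / 4)"
      unfolding s_def t_def by (simp add: power2_eq_square algebra_simps)
    then have "sgn (((x$1)\<^sup>2 - (x$3)\<^sup>2) * ((y$1)\<^sup>2 - (y$3)\<^sup>2)) = sgn (s * t)"
      by (simp only: sgn_mult) simp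
    then show ?thesis by (simp add: sgn_mult)
  qed
  show "\<bar>wedge_kernel x y\<bar> = sgn ((x$1)\<^sup>2 - (x$3)\<^sup>2) * sgn ((y$1)\<^sup>2 - (y$3)\<^sup>2) * wedge_kernel x y"
  proof -
    consider "s * t = 0" | "s * t > 0" | "s * t < 0" by linarith
    then show ?thesis
    proof cases
      case 2
      then have "d - d' \<ge> 0" using st by (simp add: zero_le_mult_iff)
      moreover have "sgn s * sgn t = 1" using 2 by (simp add: sgn_mult[symmetric])
      ultimately show ?thesis unfolding sgnst W by simp
    next
      case 3
      then have "d - d' \<le> 0" using st zero_le_mult_iff[of "s * t" "d - d'"] by linarith
      moreover have "sgn s * sgn t = - 1" using 3 by (simp add: sgn_mult[symmetric])
      ultimately show ?thesis unfolding sgnst W by simp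
    qed (use zero in \<open>auto simp: sgnst W\<close>)
  qed
  have sd: "s > 0 \<Longrightarrow> d > 0 \<and> d' > 0" "s < 0 \<Longrightarrow> d < 0 \<and> d' < 0" "s = 0 \<Longrightarrow> d + d' = 0"
    unfolding d_def d'_def using pos by (auto intro!: divide_strict_left_mono)
  have sgns: "sgn (x$1 - x$3) * sgn (y$1 - y$3) = sgn s"
    unfolding s_def by (simp add: sgn_mult)
  show "\<bar>half_kernel x y\<bar> = sgn (x$1 - x$3) * sgn (y$1 - y$3) * half_kernel x y"
    unfolding sgns Hk using sd by (auto simp: sgn_if)
  show "\<bar>wedge_kernel x y\<bar> < \<bar>half_kernel x y\<bar>" if "(x$1 - x$3) * (y$1 - y$3) \<noteq> 0"
  proof -
    have "s \<noteq> 0" using that by (simp add: s_def)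
    then show ?thesis unfolding W Hk using sd by (cases "s > 0") auto
  qed
qed

lemma AE_off_orbit:
  "AE y in lborel. y \<noteq> x \<and> y \<noteq> swap13 x \<and> y \<noteq> antiswap13 x \<and> y \<noteq> antiswap13 (swap13 x)"
  using AE_lborel_singleton[of x] AE_lborel_singleton[of "swap13 x"]
    AE_lborel_singleton[of "antiswap13 x"] AE_lborel_singleton[of "antiswap13 (swap13 x)"]
  by eventually_elim simp

text \<open>Here \<open>\<tau>\<close> is the parity under \<open>antiswap13\<close> of the
  densities for which the kernel is meant: -1 for the wedge, 1 for the half-space.\<close>

definition reflected_kernel :: "real \<Rightarrow> real^3 \<Rightarrow> real^3 \<Rightarrow> real" where
  "reflected_kernel \<tau> x y = 1 / norm (x - y) - 1 / norm (swap13 x - y)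
     + \<tau> * (1 / norm (antiswap13 x - y) - 1 / norm (antiswap13 (swap13 x) - y))"

text \<open>Each image term integrates to the potential of \<open>q\<close> at an image of
  \<open>x\<close>, and the parities of \<open>q\<close> make the four signed contributions equal.
  Hence the factor 4, with integrals over the whole space.\<close>

lemma reflected_kernel_integral:
  assumes q: "bdd_supp r B q"
  shows "integrable lborel (\<lambda>y. q y * reflected_kernel \<tau> x y)"
    and "(\<And>y. q (swap13 y) = - q y) \<Longrightarrow> (\<And>y. q (antiswap13 y) = \<tau> * q y) \<Longrightarrow> \<tau> * \<tau> = 1 \<Longrightarrow>
      (LINT y|lborel. q y * reflected_kernel \<tau> x y) = 4 * newton q x"
proof -
  let ?f = "\<lambda>z y. q y / norm (z - y)"
  have e: "(\<lambda>y. q y * reflected_kernel \<tau> x y)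
    = (\<lambda>y. ?f x y - ?f (swap13 x) y + \<tau> * (?f (antiswap13 x) y - ?f (antiswap13 (swap13 x)) y))"
    unfolding reflected_kernel_def by (simp add: algebra_simps)
  note I = newton_integrable[OF q]
  show "integrable lborel (\<lambda>y. q y * reflected_kernel \<tau> x y)"
    unfolding e by (intro lintegrable_add lintegrable_diff integrable_mult_right I)
  assume s: "\<And>y. q (swap13 y) = - q y" and t: "\<And>y. q (antiswap13 y) = \<tau> * q y" and \<tau>: "\<tau> * \<tau> = 1"
  have ns: "newton q (swap13 z) = - newton q z" for z
    using newton_orthogonal[OF orthogonal_swap13 q, of z] by (simp add: s newton_def)
  have nt: "newton q (antiswap13 z) = \<tau> * newton q z" for z
    unfolding newton_orthogonal[OF orthogonal_antiswap13 q, symmetric] t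
    by (simp add: newton_def mult.assoc flip: times_divide_eq_right)
  have "(LINT y|lborel. q y * reflected_kernel \<tau> x y)
    = newton q x - newton q (swap13 x) + \<tau> * (newton q (antiswap13 x) - newton q (antiswap13 (swap13 x)))"
    unfolding e newton_def
    by (simp add: I lint_add lint_diff lintegrable_diff integrable_mult_right)
  also have "\<dots> = 2 * newton q x + 2 * (\<tau> * \<tau>) * newton q x"
    by (simp add: ns nt algebra_simps)
  finally show "(LINT y|lborel. q y * reflected_kernel \<tau> x y) = 4 * newton q x" by (simp add: \<tau>)
qed

lemma wedge_kernel_reflected: "wedge_kernel = reflected_kernel (- 1)"
  and half_kernel_reflected: "half_kernel = reflected_kernel 1"
  by (simp_all add: fun_eq_iff wedge_kernel_def half_kernel_def reflected_kernel_def)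

lemmas wedge_kernel_integral = reflected_kernel_integral[of _ _ _ "- 1", folded wedge_kernel_reflected]
  and half_kernel_integral = reflected_kernel_integral[of _ _ _ 1, folded half_kernel_reflected]

lemma swap13_borel [measurable]: "swap13 \<in> borel_measurable borel"
  and antiswap13_borel [measurable]: "antiswap13 \<in> borel_measurable borel"
  by (rule orthogonal_transformation_borel orthogonal_swap13 orthogonal_antiswap13)+

lemma
  fixes f g :: "'a \<Rightarrow> real^3"
  assumes [measurable]: "f \<in> borel_measurable M" "g \<in> borel_measurable M"
  shows wedge_kernel_borel [measurable (raw)]: "(\<lambda>z. wedge_kernel (f z) (g z)) \<in> borel_measurable M"
    and half_kernel_borel [measurable (raw)]: "(\<lambda>z. half_kernel (f z) (g z)) \<in> borel_measurable M"
  unfolding wedge_kernel_def half_kernel_def by measurable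

text \<open>By \<open>E2\<close>, y1 - y3 solves the homogeneous equation with the half-space
  kernel, which strictly dominates the wedge kernel; this is the source of strictness. The equations
  are available only where \<open>b\<close> is nonzero, which is enough because the weights
  \<open>e\<close> and \<open>w\<close> both carry a factor \<open>b\<close>. Assumption
  \<open>nz\<close> says that \<open>w\<close> is not a null function, without which the two kernels
  could not be told apart.\<close>

lemma wedge_positivity:
  fixes a b D :: "real^3 \<Rightarrow> real"
  assumes p: "bdd_supp r B1 (\<lambda>y. b y * (y$1 - y$3))"
    and q: "bdd_supp r B2 (\<lambda>y. b y * D y)"
    and b: "\<And>y. b y \<ge> 0" "\<And>y. b (swap13 y) = b y" "\<And>y. b (antiswap13 y) = b y"
    and D: "\<And>y. D (swap13 y) = - D y" "\<And>y. D (antiswap13 y) = - D y"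
    and a: "\<And>x. b x \<noteq> 0 \<Longrightarrow> a x \<ge> 0"
    and E1: "\<And>x. b x \<noteq> 0 \<Longrightarrow> a x * D x = newton (\<lambda>y. b y * D y) x + c * ((x$1)\<^sup>2 - (x$3)\<^sup>2)"
    and E2: "\<And>x. b x \<noteq> 0 \<Longrightarrow> a x * (x$1 - x$3) = newton (\<lambda>y. b y * (y$1 - y$3)) x"
    and c: "c \<ge> 0"
    and nz: "\<not> (AE y in lborel. b y * (y$1 - y$3) = 0)"
  shows "((x$1)\<^sup>2 - (x$3)\<^sup>2) * newton (\<lambda>y. b y * D y) x \<ge> 0"
proof -
  let ?G = wedge_kernel and ?H = half_kernel
  define p q s where "p = (\<lambda>y. b y * (y$1 - y$3))" and "q = (\<lambda>y. b y * D y)"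
    and "s = (\<lambda>y::real^3. sgn ((y$1)\<^sup>2 - (y$3)\<^sup>2))"
  define w e where "w = (\<lambda>y. \<bar>p y\<bar>)" and "e = (\<lambda>y. max 0 (- (s y * q y)))"
  note bp = assms(1)[folded p_def] and bq = assms(2)[folded q_def]
  have pm [measurable]: "p \<in> borel_measurable borel" and qm [measurable]: "q \<in> borel_measurable borel"
    using bdd_suppD(1)[OF bp] bdd_suppD(1)[OF bq] .
  have sm [measurable]: "s \<in> borel_measurable borel" unfolding s_def by measurable
  have wm [measurable]: "w \<in> borel_measurable borel" unfolding w_def by measurable
  have em [measurable]: "e \<in> borel_measurable borel" unfolding e_def by measurable
  have s1: "\<bar>s y\<bar> \<le> 1" for y by (simp add: s_def sgn_if)
  have be: "bdd_supp r B2 e"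
    unfolding bdd_supp_def
  proof (intro conjI allI impI)
    fix y
    have "\<bar>e y\<bar> \<le> \<bar>s y\<bar> * \<bar>q y\<bar>" by (simp add: e_def abs_mult[symmetric])
    also have "\<dots> \<le> 1 * B2" using s1 bdd_suppD(2)[OF bq, of y] by (intro mult_mono) auto
    finally show "\<bar>e y\<bar> \<le> B2" by simp
    show "e y = 0" if "y \<notin> cball 0 r" using bdd_suppD(3)[OF bq that] by (simp add: e_def)
  qed (rule em)
  have bw: "bdd_supp r B1 w" using bp by (auto simp: bdd_supp_def w_def)
  have qs: "q (swap13 y) = - q y" "q (antiswap13 y) = - q y" for y by (simp_all add: q_def b D)
  have ps: "p (swap13 y) = - p y" "p (antiswap13 y) = p y" for y by (simp_all add: p_def b algebra_simps)

  have sq_int: "s x * newton q x = (LINT y|lborel. s y * q y * \<bar>?G x y\<bar>) / 4" for x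
  proof -
    have "4 * (s x * newton q x) = s x * (LINT y|lborel. q y * ?G x y)"
      using wedge_kernel_integral(2)[OF bq] qs by simp
    also have "\<dots> = (LINT y|lborel. s x * (q y * ?G x y))" by simp
    also have "\<dots> = (LINT y|lborel. s y * q y * \<bar>?G x y\<bar>)"
    proof (rule integral_cong_AE)
      show "AE y in lborel. s x * (q y * ?G x y) = s y * q y * \<bar>?G x y\<bar>"
        using AE_off_orbit[of x]
      proof eventually_elim
        case (elim y)
        \<comment> \<open>The sign \<open>s\<close> vanishes on the two mirror planes, but there
          \<open>y\<close> is fixed by a reflection and oddness forces
          \<open>D y = 0\<close>.\<close>
        have "s y * s y = 1 \<or> q y = 0"
        proof (cases "s y = 0")
          case True
          then consider "y$3 = y$1" | "y$3 = - y$1" by (auto simp: s_def power2_eq_iff sgn_0_0)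
          then have "D y = 0"
          proof cases
            case 1 then have "swap13 y = y" by (simp add: vec_eq_iff forall_3)
            then show ?thesis using D(1)[of y] by simp
          next
            case 2 then have "antiswap13 y = y" by (simp add: vec_eq_iff forall_3)
            then show ?thesis using D(2)[of y] by simp
          qed
          then show ?thesis by (simp add: q_def)
        qed (auto simp: s_def sgn_if)
        moreover have "\<bar>?G x y\<bar> = s x * s y * ?G x y"
          unfolding s_def using elim by (intro wedge_kernel_abs) auto
        ultimately show ?case by (auto simp: mult_ac)
      qed
    qed measurable
    finally show ?thesis by simp
  qed

  \<comment> \<open>The plane x1 = x3, on which the sign of x1 - x3 is 0, may be left out because
    \<open>e\<close> vanishes on it.\<close>
  have pw_int: "\<bar>newton p x\<bar> = (LINT y|lborel. w y * \<bar>?H x y\<bar>) / 4" if "x$1 \<noteq> x$3" for x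
  proof -
    let ?t = "sgn (x$1 - x$3)"
    have t: "?t * ?t = 1" "\<bar>?t\<bar> = 1" using that by (auto simp: sgn_if)
    have "4 * (?t * newton p x) = ?t * (LINT y|lborel. p y * ?H x y)"
      using half_kernel_integral(2)[OF bp] ps by simp
    also have "\<dots> = (LINT y|lborel. ?t * (p y * ?H x y))" by simp
    also have "\<dots> = (LINT y|lborel. w y * \<bar>?H x y\<bar>)"
    proof (rule integral_cong_AE)
      show "AE y in lborel. ?t * (p y * ?H x y) = w y * \<bar>?H x y\<bar>"
        using AE_off_orbit[of x]
      proof eventually_elim
        case (elim y)
        have P: "p y = w y * sgn (y$1 - y$3)"
          using b(1)[of y] by (simp add: w_def p_def abs_mult sgn_if)
        have Hk: "\<bar>?H x y\<bar> = ?t * sgn (y$1 - y$3) * ?H x y"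
          using elim by (intro half_kernel_abs) auto
        show ?case unfolding Hk unfolding P by (simp add: mult_ac)
      qed
    qed measurable
    finally have *: "4 * (?t * newton p x) = (LINT y|lborel. w y * \<bar>?H x y\<bar>)" .
    moreover have "0 \<le> (LINT y|lborel. w y * \<bar>?H x y\<bar>)"
      by (intro integral_nonneg_AE AE_I2) (simp add: w_def)
    ultimately have "\<bar>?t * newton p x\<bar> = (LINT y|lborel. w y * \<bar>?H x y\<bar>) / 4"
      by simp
    then show ?thesis using t(2) by (simp only: abs_mult mult_1_left)
  qed

  have eG: "integrable lborel (\<lambda>y. e y * \<bar>?G x y\<bar>)" for x
    using integrable_abs[OF wedge_kernel_integral(1)[OF be, of x]] by (simp add: abs_mult e_def)
  have wG: "integrable lborel (\<lambda>y. w y * \<bar>?G x y\<bar>)" for x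
    using integrable_abs[OF wedge_kernel_integral(1)[OF bw, of x]] by (simp add: abs_mult w_def)
  have wH: "integrable lborel (\<lambda>y. w y * \<bar>?H x y\<bar>)" for x
    using integrable_abs[OF half_kernel_integral(1)[OF bw, of x]] by (simp add: abs_mult w_def)
  have sqG: "integrable lborel (\<lambda>y. s y * q y * \<bar>?G x y\<bar>)" for x
  proof (rule lintegrable_bound[OF wedge_kernel_integral(1)[OF bq, of x]])
    show "AE y in lborel. norm (s y * q y * \<bar>?G x y\<bar>) \<le> norm (q y * ?G x y)"
      using s1 by (intro AE_I2) (simp add: abs_mult mult_right_mono mult_left_le_one_le mult.assoc)
  qed measurable

  \<comment> \<open>Where \<open>e y\<close> is nonzero it equals \<open>- (s y * q y)\<close>, and
    the factor \<open>b y\<close> can be handed from \<open>q\<close> to \<open>w\<close>: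
    \<open>e y\<close> times a |y1 - y3| becomes \<open>w y\<close> times
    \<open>- (s y * (a y * D y))\<close>. The inhomogeneity has the sign of \<open>s\<close> and is
    dropped; replacing \<open>- (s x * q x)\<close> by its positive part \<open>e x\<close> under
    the integral only increases it.\<close>
  have step: "e y * \<bar>newton p y\<bar> \<le> w y * ((LINT x|lborel. e x * \<bar>?G y x\<bar>) / 4)" for y
  proof (cases "e y = 0")
    case True
    have "0 \<le> (LINT x|lborel. e x * \<bar>?G y x\<bar>)"
      by (intro integral_nonneg_AE AE_I2) (simp add: e_def)
    then show ?thesis using True by (simp add: w_def)
  next
    case False
    then have by0: "b y \<noteq> 0" and ey: "e y = - (s y * q y)" by (auto simp: e_def q_def)
    have "\<bar>newton p y\<bar> = a y * \<bar>y$1 - y$3\<bar>"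
      using E2[OF by0] a[OF by0] unfolding p_def by (metis abs_mult abs_of_nonneg)
    then have "e y * \<bar>newton p y\<bar> = w y * (- (s y * (a y * D y)))"
      using b(1)[of y] by (simp add: ey w_def p_def q_def abs_mult)
    also have "- (s y * (a y * D y)) \<le> - (s y * newton q y)"
    proof -
      have "0 \<le> s y * (c * ((y$1)\<^sup>2 - (y$3)\<^sup>2))"
        using c by (simp add: s_def sgn_if mult_nonneg_nonneg zero_le_mult_iff mult_le_0_iff)
      moreover have "s y * (a y * D y) = s y * newton q y + s y * (c * ((y$1)\<^sup>2 - (y$3)\<^sup>2))"
        unfolding E1[OF by0] q_def by (rule distrib_left)
      ultimately show ?thesis by linarith
    qed
    also have "- (s y * newton q y) \<le> (LINT x|lborel. e x * \<bar>?G y x\<bar>) / 4"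
    proof -
      have "- (LINT x|lborel. s x * q x * \<bar>?G y x\<bar>) = (LINT x|lborel. - (s x * q x * \<bar>?G y x\<bar>))"
        by simp
      also have "\<dots> \<le> (LINT x|lborel. e x * \<bar>?G y x\<bar>)"
      proof (rule integral_mono)
        fix x
        have "- (s x * q x) * \<bar>?G y x\<bar> \<le> e x * \<bar>?G y x\<bar>"
          by (intro mult_right_mono) (auto simp: e_def)
        then show "- (s x * q x * \<bar>?G y x\<bar>) \<le> e x * \<bar>?G y x\<bar>" by simp
      qed (use sqG eG in auto)
      finally show ?thesis by (simp add: sq_int)
    qed
    finally show ?thesis by (simp add: mult_left_mono w_def)
  qed

  \<comment> \<open>The absolute wedge and half-space kernels applied to \<open>w\<close>, as
    \<open>ennreal\<close> integrals so that Tonelli and the strict comparison of integrals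
    apply.\<close>
  define I J where "I y = (\<integral>\<^sup>+x. ennreal (w x * \<bar>?G y x\<bar>) \<partial>lborel)"
    and "J y = (\<integral>\<^sup>+x. ennreal (w x * \<bar>?H y x\<bar>) \<partial>lborel)" for y
  have Ir: "I y = ennreal (LINT x|lborel. w x * \<bar>?G y x\<bar>)" for y
    unfolding I_def by (rule nn_integral_eq_integral[OF wG]) (simp add: w_def)
  have Jr: "J y = ennreal (LINT x|lborel. w x * \<bar>?H y x\<bar>)" for y
    unfolding J_def by (rule nn_integral_eq_integral[OF wH]) (simp add: w_def)
  have "(\<lambda>y. \<integral>\<^sup>+x. ennreal (w x * \<bar>?G y x\<bar>) \<partial>lborel) \<in> borel_measurable borel"
    by measurable
  then have Im [measurable]: "I \<in> borel_measurable borel" by (simp add: I_def[abs_def])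
  have "(\<lambda>y. \<integral>\<^sup>+x. ennreal (w x * \<bar>?H y x\<bar>) \<partial>lborel) \<in> borel_measurable borel"
    by measurable
  then have Jm [measurable]: "J \<in> borel_measurable borel" by (simp add: J_def[abs_def])
  have IJ: "I y < J y" if "y$1 \<noteq> y$3" for y
    unfolding I_def J_def
  proof (rule nn_integral_less)
    show "(\<integral>\<^sup>+x. ennreal (w x * \<bar>?G y x\<bar>) \<partial>lborel) \<noteq> \<infinity>"
      unfolding I_def[symmetric] Ir by simp
    have lt: "AE x in lborel. w x * \<bar>?G y x\<bar> \<le> w x * \<bar>?H y x\<bar> \<and>
        (w x * \<bar>?H y x\<bar> \<le> w x * \<bar>?G y x\<bar> \<longrightarrow> p x = 0)"
      using AE_off_orbit[of y]
    proof eventually_elim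
      case (elim x)
      show ?case
      proof (cases "p x = 0")
        case False
        then have "x$1 - x$3 \<noteq> 0" by (auto simp: p_def)
        then have "\<bar>?G y x\<bar> < \<bar>?H y x\<bar>"
          using that elim by (intro wedge_less_half) auto
        moreover have "w x > 0" using False by (simp add: w_def)
        ultimately show ?thesis by auto
      qed (simp add: w_def)
    qed
    then show "AE x in lborel. ennreal (w x * \<bar>?G y x\<bar>) \<le> ennreal (w x * \<bar>?H y x\<bar>)"
      by eventually_elim (rule ennreal_leI, blast)
    show "\<not> (AE x in lborel. ennreal (w x * \<bar>?H y x\<bar>) \<le> ennreal (w x * \<bar>?G y x\<bar>))"
    proof
      assume "AE x in lborel. ennreal (w x * \<bar>?H y x\<bar>) \<le> ennreal (w x * \<bar>?G y x\<bar>)"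
      with lt have "AE x in lborel. p x = 0"
      proof eventually_elim
        case (elim x)
        have "0 \<le> w x * \<bar>?G y x\<bar>" by (simp add: w_def)
        from ennreal_le_iff[OF this] elim show "p x = 0" by blast
      qed
      then show False using nz by (simp add: p_def)
    qed
  qed measurable

  \<comment> \<open>Symmetry of the wedge kernel moves it from \<open>e\<close> to \<open>w\<close>, against which it is strictly smaller
    than the half-space kernel.\<close>
  have fub: "(\<integral>\<^sup>+y. ennreal (e y) * J y \<partial>lborel) \<le> (\<integral>\<^sup>+y. ennreal (e y) * I y \<partial>lborel)"
  proof -
    have "(\<integral>\<^sup>+y. ennreal (e y) * J y \<partial>lborel)
       \<le> (\<integral>\<^sup>+y. ennreal (w y) * (\<integral>\<^sup>+x. ennreal (e x * \<bar>?G y x\<bar>) \<partial>lborel) \<partial>lborel)"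
    proof (rule nn_integral_mono)
      fix y
      show "ennreal (e y) * J y \<le> ennreal (w y) * (\<integral>\<^sup>+x. ennreal (e x * \<bar>?G y x\<bar>) \<partial>lborel)"
      proof (cases "y$1 = y$3")
        case True
        then have "e y = 0" by (simp add: e_def s_def)
        then show ?thesis by simp
      next
        case False
        have "(\<integral>\<^sup>+x. ennreal (e x * \<bar>?G y x\<bar>) \<partial>lborel) = ennreal (LINT x|lborel. e x * \<bar>?G y x\<bar>)"
          by (rule nn_integral_eq_integral[OF eG]) (simp add: e_def)
        moreover have "e y * (LINT x|lborel. w x * \<bar>?H y x\<bar>) \<le> w y * (LINT x|lborel. e x * \<bar>?G y x\<bar>)"
          using step[of y] pw_int[OF False] by simp
        moreover have "0 \<le> e y" "0 \<le> w y" by (simp_all add: e_def w_def)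
        ultimately show ?thesis
          by (simp add: Jr ennreal_mult'[symmetric] ennreal_leI)
      qed
    qed
    also have "\<dots> = (\<integral>\<^sup>+y. (\<integral>\<^sup>+x. ennreal (w y * e x * \<bar>?G y x\<bar>) \<partial>lborel) \<partial>lborel)"
    proof (rule nn_integral_cong)
      fix y
      have "ennreal (w y) * (\<integral>\<^sup>+x. ennreal (e x * \<bar>?G y x\<bar>) \<partial>lborel)
          = (\<integral>\<^sup>+x. ennreal (w y) * ennreal (e x * \<bar>?G y x\<bar>) \<partial>lborel)"
        by (rule nn_integral_cmult[symmetric]) measurable
      also have "\<dots> = (\<integral>\<^sup>+x. ennreal (w y * e x * \<bar>?G y x\<bar>) \<partial>lborel)"
        by (simp add: ennreal_mult'[symmetric] w_def mult.assoc)
      finally show "ennreal (w y) * (\<integral>\<^sup>+x. ennreal (e x * \<bar>?G y x\<bar>) \<partial>lborel)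
          = (\<integral>\<^sup>+x. ennreal (w y * e x * \<bar>?G y x\<bar>) \<partial>lborel)" .
    qed
    also have "\<dots> = (\<integral>\<^sup>+x. (\<integral>\<^sup>+y. ennreal (w y * e x * \<bar>?G y x\<bar>) \<partial>lborel) \<partial>lborel)"
      by (rule lborel_pair.Fubini'[symmetric]) measurable
    also have "\<dots> = (\<integral>\<^sup>+x. ennreal (e x) * (\<integral>\<^sup>+y. ennreal (w y * \<bar>?G x y\<bar>) \<partial>lborel) \<partial>lborel)"
    proof (rule nn_integral_cong)
      fix x
      have "(\<integral>\<^sup>+y. ennreal (w y * e x * \<bar>?G y x\<bar>) \<partial>lborel)
          = (\<integral>\<^sup>+y. ennreal (e x) * ennreal (w y * \<bar>?G x y\<bar>) \<partial>lborel)"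
      proof (rule nn_integral_cong)
        fix y
        have "0 \<le> e x" by (simp add: e_def)
        then have "ennreal (e x) * ennreal (w y * \<bar>?G x y\<bar>) = ennreal (e x * (w y * \<bar>?G x y\<bar>))"
          by (rule ennreal_mult'[symmetric])
        also have "e x * (w y * \<bar>?G x y\<bar>) = w y * e x * \<bar>?G y x\<bar>"
          unfolding wedge_kernel_commute[of x y] by simp
        finally show "ennreal (w y * e x * \<bar>?G y x\<bar>) = ennreal (e x) * ennreal (w y * \<bar>?G x y\<bar>)"
          by simp
      qed
      also have "\<dots> = ennreal (e x) * (\<integral>\<^sup>+y. ennreal (w y * \<bar>?G x y\<bar>) \<partial>lborel)"
        by (rule nn_integral_cmult) measurable
      finally show "(\<integral>\<^sup>+y. ennreal (w y * e x * \<bar>?G y x\<bar>) \<partial>lborel)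
          = ennreal (e x) * (\<integral>\<^sup>+y. ennreal (w y * \<bar>?G x y\<bar>) \<partial>lborel)" .
    qed
    finally show ?thesis by (simp add: I_def)
  qed
  \<comment> \<open>The strict comparison of integrals below requires the smaller one to be finite.
    The wedge kernel is bounded by four translates of 1/|x|, so \<open>I\<close> is bounded, and
    \<open>e\<close> has bounded support.\<close>
  have finI: "(\<integral>\<^sup>+y. ennreal (e y) * I y \<partial>lborel) \<noteq> \<infinity>"
  proof -
    have Ile: "I y \<le> ennreal (4 * B1 * kernel_const r)" for y
    proof -
      note Nw = newton_integrable[OF bw]
      have "(LINT x|lborel. w x * \<bar>?G y x\<bar>) \<le> (LINT x|lborel. w x / norm (y - x) + w x / norm (swap13 y - x)
          + w x / norm (antiswap13 y - x) + w x / norm (antiswap13 (swap13 y) - x))"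
      proof (rule integral_mono[OF wG])
        fix x
        have "\<bar>?G y x\<bar> \<le> 1 / norm (y - x) + 1 / norm (swap13 y - x)
          + 1 / norm (antiswap13 y - x) + 1 / norm (antiswap13 (swap13 y) - x)"
          unfolding wedge_kernel_def by (rule abs_leI) simp_all
        then have "w x * \<bar>?G y x\<bar> \<le> w x * (1 / norm (y - x) + 1 / norm (swap13 y - x)
          + 1 / norm (antiswap13 y - x) + 1 / norm (antiswap13 (swap13 y) - x))"
          by (rule mult_left_mono) (simp add: w_def)
        then show "w x * \<bar>?G y x\<bar> \<le> w x / norm (y - x) + w x / norm (swap13 y - x)
          + w x / norm (antiswap13 y - x) + w x / norm (antiswap13 (swap13 y) - x)"
          by (simp add: distrib_left)
      qed (intro lintegrable_add Nw)
      also have "\<dots> = newton w y + newton w (swap13 y) + newton w (antiswap13 y) + newton w (antiswap13 (swap13 y))"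
        unfolding newton_def
        by (subst lint_add; (intro lintegrable_add Nw)?)+ simp
      also have "\<dots> \<le> 4 * B1 * kernel_const r"
        using newton_abs_le[OF bw, of y] newton_abs_le[OF bw, of "swap13 y"]
          newton_abs_le[OF bw, of "antiswap13 y"] newton_abs_le[OF bw, of "antiswap13 (swap13 y)"] by linarith
      finally show ?thesis unfolding Ir by (rule ennreal_leI)
    qed
    have "(\<integral>\<^sup>+y. ennreal (e y) * I y \<partial>lborel)
      \<le> (\<integral>\<^sup>+y. ennreal (B2 * (4 * B1 * kernel_const r)) * indicator (cball (0::real^3) r) y \<partial>lborel)"
    proof (rule nn_integral_mono)
      fix y
      have "ennreal (e y) * I y \<le> ennreal (B2 * indicator (cball 0 r) y) * ennreal (4 * B1 * kernel_const r)"
        using bdd_suppD(5)[OF be, of y] by (intro mult_mono ennreal_leI Ile) auto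
      also have "\<dots> = ennreal (B2 * (4 * B1 * kernel_const r)) * indicator (cball 0 r) y"
        using bdd_suppD(4)[OF be] bdd_suppD(4)[OF bw] kernel_const_nonneg[of r]
        by (auto simp: indicator_def ennreal_mult)
      finally show "ennreal (e y) * I y \<le> ennreal (B2 * (4 * B1 * kernel_const r)) * indicator (cball 0 r) y" .
    qed
    also have "\<dots> = ennreal (B2 * (4 * B1 * kernel_const r)) * emeasure lborel (cball (0::real^3) r)"
      by (rule nn_integral_cmult_indicator) (simp add: borel_closed)
    also have "\<dots> < \<infinity>"
      using emeasure_bounded_finite[of "cball (0::real^3) r"] by (simp add: ennreal_mult_less_top)
    finally show ?thesis by simp
  qed
  have "AE y in lborel. e y = 0"
  proof -
    have le: "AE y in lborel. ennreal (e y) * I y \<le> ennreal (e y) * J y"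
    proof (rule AE_I2)
      fix y show "ennreal (e y) * I y \<le> ennreal (e y) * J y"
      proof (cases "y$1 = y$3")
        case True
        then have "e y = 0" by (simp add: e_def s_def)
        then show ?thesis by simp
      next
        case False
        show ?thesis by (intro mult_left_mono less_imp_le[OF IJ[OF False]]) simp
      qed
    qed
    have "AE y in lborel. ennreal (e y) * J y \<le> ennreal (e y) * I y"
    proof (rule ccontr)
      assume "\<not> ?thesis"
      from nn_integral_less[OF _ _ finI le this] fub show False by (simp add: not_less)
    qed
    then show ?thesis
    proof eventually_elim
      case (elim y)
      show ?case
      proof (rule ccontr)
        assume ne: "e y \<noteq> 0"
        then have "y$1 \<noteq> y$3" by (auto simp: e_def s_def)
        from IJ[OF this] have "ennreal (e y) * I y < ennreal (e y) * J y"
          using ne by (intro ennreal_mult_strict_left_mono) (auto simp: e_def)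
        with elim show False by simp
      qed
    qed
  qed
  \<comment> \<open>Knowing the sign of \<open>s * q\<close> almost everywhere gives, through
    \<open>sq_int\<close>, the sign of the potential at every point. This matters because it is
    evaluated at one point of the equator.\<close>
  then have "AE y in lborel. 0 \<le> s y * q y * \<bar>?G x y\<bar>"
    by eventually_elim (auto simp: e_def max_def split: if_splits)
  then have "0 \<le> s x * newton q x"
    unfolding sq_int by (simp add: integral_nonneg_AE)
  then have "0 \<le> \<bar>(x$1)\<^sup>2 - (x$3)\<^sup>2\<bar> * (s x * newton q x)" by simp
  also have "\<dots> = ((x$1)\<^sup>2 - (x$3)\<^sup>2) * newton q x" by (simp add: s_def abs_sgn mult.assoc[symmetric] sgn_if)
  finally show ?thesis by (simp add: q_def)
qed

section \<open>Radial monotonicity of the potential\<close>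

text \<open>The exact cubic coefficient is - 5/16, so |u|^3 is a generous error term. The claim is
  squared to 1 <= P^2 (1 + u). For u >= 0 the quadratic part of \<open>P\<close> already satisfies
  this; for u < 0 the cubic term contributes at least 2 v^3 (1 - v), which outweighs a deficit of
  leading order 5/8 v^3.\<close>

lemma inverse_sqrt_taylor_le:
  fixes u :: real assumes "\<bar>u\<bar> \<le> 1/2"
  shows "1 / sqrt (1 + u) \<le> 1 - u / 2 + 3 / 8 * u\<^sup>2 + \<bar>u\<bar> ^ 3"
proof -
  define P where "P = 1 - u / 2 + 3 / 8 * u\<^sup>2 + \<bar>u\<bar> ^ 3"
  define v where "v = \<bar>u\<bar>"
  have v: "0 \<le> v" "v \<le> 1/2" using assms by (auto simp: v_def)
  have P0: "P > 0"
  proof -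
    have "1 - u / 2 > 0" using assms by linarith
    moreover have "0 \<le> 3 / 8 * u\<^sup>2 + \<bar>u\<bar> ^ 3" by simp
    ultimately show ?thesis unfolding P_def by linarith
  qed
  have v3: "v ^ 4 \<le> v ^ 3 / 2" "v ^ 5 \<le> v ^ 3 / 4"
  proof -
    have "v ^ 3 * v \<le> v ^ 3 * (1/2)" using v by (intro mult_left_mono) auto
    then show "v ^ 4 \<le> v ^ 3 / 2" by (simp add: eval_nat_numeral)
    have "v ^ 3 * v\<^sup>2 \<le> v ^ 3 * (1/2)\<^sup>2" using v by (intro mult_left_mono power_mono) auto
    then show "v ^ 5 \<le> v ^ 3 / 4" by (simp add: eval_nat_numeral)
  qed
  have n3: "v ^ 3 \<ge> 0" "v ^ 4 \<ge> 0" "v ^ 5 \<ge> 0" using v by auto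
  have "1 \<le> P\<^sup>2 * (1 + u)"
  proof (cases "u \<ge> 0")
    case True
    then have uv: "u = v" by (simp add: v_def)
    define Q where "Q = 1 - v / 2 + 3 / 8 * v\<^sup>2"
    have "Q\<^sup>2 * (1 + v) = 1 + 5/8 * v ^ 3 - 15/64 * v ^ 4 + 9/64 * v ^ 5"
      unfolding Q_def by (simp add: eval_nat_numeral field_simps)
    then have "1 \<le> Q\<^sup>2 * (1 + v)" using v3 n3 by linarith
    also have "\<dots> \<le> P\<^sup>2 * (1 + v)"
    proof (intro mult_right_mono power_mono)
      show "Q \<le> P" using v by (simp add: P_def Q_def uv)
      show "0 \<le> Q" unfolding Q_def using v zero_le_power2[of v] by linarith
    qed (use v in auto)
    finally show ?thesis by (simp add: uv)
  next
    case False
    then have uv: "u = - v" by (simp add: v_def)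
    define Q where "Q = 1 + v / 2 + 3 / 8 * v\<^sup>2"
    have Q1: "Q \<ge> 1" unfolding Q_def using v by simp
    have "(Q\<^sup>2 + 2 * v ^ 3) * (1 - v) = 1 + 11/8 * v ^ 3 - 15/64 * v ^ 4 - 9/64 * v ^ 5 - 2 * v ^ 4"
      unfolding Q_def by (simp add: eval_nat_numeral field_simps)
    then have "1 \<le> (Q\<^sup>2 + 2 * v ^ 3) * (1 - v)" using v3 n3 by linarith
    also have "\<dots> \<le> P\<^sup>2 * (1 - v)"
    proof (intro mult_right_mono)
      have "P = Q + v ^ 3" by (simp add: P_def Q_def uv v)
      then have "P\<^sup>2 = Q\<^sup>2 + 2 * (Q * v ^ 3) + (v ^ 3)\<^sup>2" by (simp add: power2_sum)
      moreover have "1 * v ^ 3 \<le> Q * v ^ 3" using Q1 n3 by (intro mult_right_mono) auto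
      ultimately show "Q\<^sup>2 + 2 * v ^ 3 \<le> P\<^sup>2" using zero_le_power2[of "v ^ 3"] by linarith
    qed (use v in auto)
    finally show ?thesis by (simp add: uv)
  qed
  then have "sqrt 1 \<le> sqrt (P\<^sup>2 * (1 + u))" by (rule real_sqrt_le_mono)
  then have "1 \<le> P * sqrt (1 + u)" using P0 by (simp add: real_sqrt_mult)
  then show ?thesis unfolding P_def[symmetric] using assms by (simp add: divide_le_eq)
qed

text \<open>Plummer softening of the Newtonian kernel. It is bounded and strictly superharmonic
  everywhere, whereas 1/|z| is singular at 0 and merely harmonic elsewhere, which would not give a
  strict contradiction at a minimum.\<close>

definition soft_kernel :: "real \<Rightarrow> real^3 \<Rightarrow> real" where
  "soft_kernel \<epsilon> z = 1 / sqrt ((norm z)\<^sup>2 + \<epsilon>\<^sup>2)"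

text \<open>\<open>soft_sum \<epsilon> t z\<close> minus \<open>6 * soft_kernel \<epsilon> z\<close>
  is t^2 times the seven-point discrete Laplacian.\<close>

abbreviation soft_sum :: "real \<Rightarrow> real \<Rightarrow> real^3 \<Rightarrow> real" where
  "soft_sum \<epsilon> t z \<equiv> (\<Sum>i\<in>UNIV. soft_kernel \<epsilon> (z + t *\<^sub>R axis i 1) + soft_kernel \<epsilon> (z + (- t) *\<^sub>R axis i 1))"

lemma norm_sq_add_axis:
  "(norm (z + t *\<^sub>R axis i 1 :: real^3))\<^sup>2 = (norm z)\<^sup>2 + t\<^sup>2 + 2 * t * z$i"
proof -
  have "axis i (1::real) $ i = (1::real)" by (simp add: axis_def)
  then show ?thesis unfolding power2_norm_eq_inner
    by (simp add: inner_add_left inner_add_right inner_axis inner_axis' power2_eq_square algebra_simps)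
qed

text \<open>The Laplacian of the softened kernel is \<open>- 3 \<epsilon>\<^sup>2 / (|z|\<^sup>2 + \<epsilon>\<^sup>2) powr (5/2)\<close>; a discrete
  Laplacian avoids differentiating under the integral sign.\<close>

lemma soft_kernel_superharmonic:
  assumes eps: "\<epsilon> > 0" and S: "S \<ge> 0"
  obtains t0 where "t0 > 0" "\<And>t. 0 < t \<Longrightarrow> t \<le> t0 \<Longrightarrow> \<exists>c>0. \<forall>z. norm z \<le> S \<longrightarrow>
     soft_sum \<epsilon> t z
       \<le> 6 * soft_kernel \<epsilon> z - c"
proof -
  define A where "A = (1 + 2 * S) / \<epsilon>\<^sup>2"
  define s0 where "s0 = S\<^sup>2 + \<epsilon>\<^sup>2"
  \<comment> \<open>\<open>A\<close> bounds the relative change of |z|^2 + \<epsilon>^2 per unit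
    step. The first bound on \<open>t\<close> allows t^2 <= t, the second keeps that change below
    1/2 as the Taylor estimate demands, and the third limits the higher-order errors to
    \<epsilon>^2.\<close>
  define t0 where "t0 = Min {1, 1 / (2 * A), \<epsilon>\<^sup>2 / (9/4 + 6 * A ^ 3 * s0\<^sup>2)}"
  have A: "A > 0" using eps S by (auto simp: A_def intro!: divide_pos_pos)
  have s0: "s0 > 0" using eps by (auto simp: s0_def intro: add_nonneg_pos)
  have den: "9/4 + 6 * A ^ 3 * s0\<^sup>2 > 0" using A s0 by (intro add_pos_pos) auto
  have "t0 > 0" unfolding t0_def using A den eps by (auto intro!: divide_pos_pos)
  moreover have "\<exists>c>0. \<forall>z. norm z \<le> S \<longrightarrow>
     soft_sum \<epsilon> t z
       \<le> 6 * soft_kernel \<epsilon> z - c" if t: "0 < t" "t \<le> t0" for t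
  proof -
    have t': "t \<le> 1" "t \<le> 1 / (2 * A)" "t \<le> \<epsilon>\<^sup>2 / (9/4 + 6 * A ^ 3 * s0\<^sup>2)"
      using t(2) by (auto simp: t0_def)
    have tA: "t * A \<le> 1/2" using t'(2) A by (simp add: field_simps)
    have tb: "t * (9/4 + 6 * A ^ 3 * s0\<^sup>2) \<le> \<epsilon>\<^sup>2" using t'(3) den by (simp add: pos_le_divide_eq)
    define c where "c = 1 / sqrt s0 * (2 * t\<^sup>2 * \<epsilon>\<^sup>2 / s0\<^sup>2)"
    have "c > 0" unfolding c_def using s0 t eps by (intro mult_pos_pos divide_pos_pos) auto
    moreover have "soft_sum \<epsilon> t z
       \<le> 6 * soft_kernel \<epsilon> z - c" if z: "norm z \<le> S" for z
    proof -
      define s where "s = (norm z)\<^sup>2 + \<epsilon>\<^sup>2"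
      have s: "s > 0" "s \<ge> \<epsilon>\<^sup>2" "s \<le> s0"
        using eps power_mono[OF z, of 2] by (auto simp: s_def s0_def intro: add_nonneg_pos)
      define u where "u i \<tau> = (t\<^sup>2 + 2 * \<tau> * z$i) / s" for i \<tau>
      have zi: "\<bar>z$i\<bar> \<le> S" for i using component_le_norm_cart[of z i] z by linarith
      have ub: "\<bar>u i \<tau>\<bar> \<le> t * A" if "\<bar>\<tau>\<bar> = t" for i \<tau>
      proof -
        have "\<bar>t\<^sup>2 + 2 * \<tau> * z$i\<bar> \<le> t\<^sup>2 + 2 * t * \<bar>z$i\<bar>"
          using that t abs_triangle_ineq[of "t\<^sup>2" "2 * \<tau> * z$i"] by (simp add: abs_mult)
        also have "\<dots> \<le> t * (1 + 2 * S)"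
        proof -
          have "t\<^sup>2 \<le> t" using t t' by (simp add: power2_eq_square mult_left_le)
          moreover have "t * \<bar>z$i\<bar> \<le> t * S" using zi t by (intro mult_left_mono) auto
          ultimately show ?thesis by (simp add: algebra_simps)
        qed
        finally have "\<bar>u i \<tau>\<bar> \<le> t * (1 + 2 * S) / s" using s by (simp add: u_def divide_right_mono)
        also have "\<dots> \<le> t * (1 + 2 * S) / \<epsilon>\<^sup>2" using s t S eps by (intro divide_left_mono) auto
        finally show ?thesis by (simp add: A_def)
      qed
      have k: "soft_kernel \<epsilon> (z + \<tau> *\<^sub>R axis i 1) \<le> 1 / sqrt s * (1 - u i \<tau> / 2 + 3 / 8 * (u i \<tau>)\<^sup>2 + (t * A) ^ 3)"
        if "\<bar>\<tau>\<bar> = t" for i \<tau>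
      proof -
        have "(norm (z + \<tau> *\<^sub>R axis i 1))\<^sup>2 + \<epsilon>\<^sup>2 = s * (1 + u i \<tau>)"
        proof -
          have "s * (1 + u i \<tau>) = s + (t\<^sup>2 + 2 * \<tau> * z$i)"
            unfolding u_def using s by (simp only: distrib_left) simp
          moreover have "t\<^sup>2 = \<tau>\<^sup>2" using that by (metis power2_abs)
          ultimately show ?thesis by (simp add: norm_sq_add_axis s_def)
        qed
        then have "soft_kernel \<epsilon> (z + \<tau> *\<^sub>R axis i 1) = 1 / sqrt s * (1 / sqrt (1 + u i \<tau>))"
          by (simp add: soft_kernel_def real_sqrt_mult)
        also have "\<dots> \<le> 1 / sqrt s * (1 - u i \<tau> / 2 + 3 / 8 * (u i \<tau>)\<^sup>2 + \<bar>u i \<tau>\<bar> ^ 3)"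
          using ub[OF that, of i] tA s by (intro mult_left_mono inverse_sqrt_taylor_le) auto
        also have "\<dots> \<le> 1 / sqrt s * (1 - u i \<tau> / 2 + 3 / 8 * (u i \<tau>)\<^sup>2 + (t * A) ^ 3)"
          using ub[OF that, of i] s by (intro mult_left_mono add_left_mono power_mono) auto
        finally show ?thesis .
      qed
      have "soft_sum \<epsilon> t z
        \<le> (\<Sum>i\<in>UNIV. 1 / sqrt s * (1 - u i t / 2 + 3 / 8 * (u i t)\<^sup>2 + (t * A) ^ 3)
            + 1 / sqrt s * (1 - u i (- t) / 2 + 3 / 8 * (u i (- t))\<^sup>2 + (t * A) ^ 3))"
        using t by (intro sum_mono add_mono k) auto
      also have "\<dots> = 1 / sqrt s * (\<Sum>i\<in>UNIV. 2 - (u i t + u i (- t)) / 2 + 3 / 8 * ((u i t)\<^sup>2 + (u i (- t))\<^sup>2) + 2 * (t * A) ^ 3)"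
        unfolding sum_distrib_left distrib_left[symmetric]
        by (intro sum.cong refl arg_cong[where f = "\<lambda>v. 1 / sqrt s * v"]) (simp add: field_simps)
      also have "(\<Sum>i\<in>UNIV. 2 - (u i t + u i (- t)) / 2 + 3 / 8 * ((u i t)\<^sup>2 + (u i (- t))\<^sup>2) + 2 * (t * A) ^ 3)
         = (\<Sum>i\<in>UNIV. 2 - t\<^sup>2 / s + 3 / 8 * (2 * t ^ 4 + 8 * t\<^sup>2 * (z$i)\<^sup>2) / s\<^sup>2 + 2 * (t * A) ^ 3)"
      proof (intro sum.cong refl)
        fix i
        have "u i t + u i (- t) = 2 * (t\<^sup>2 / s)" by (simp add: u_def add_divide_distrib diff_divide_distrib)
        moreover have "(u i t)\<^sup>2 + (u i (- t))\<^sup>2 = (2 * t ^ 4 + 8 * t\<^sup>2 * (z$i)\<^sup>2) / s\<^sup>2"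
          unfolding u_def power_divide add_divide_distrib[symmetric] by (simp add: eval_nat_numeral algebra_simps)
        ultimately show "2 - (u i t + u i (- t)) / 2 + 3 / 8 * ((u i t)\<^sup>2 + (u i (- t))\<^sup>2) + 2 * (t * A) ^ 3 =
          2 - t\<^sup>2 / s + 3 / 8 * (2 * t ^ 4 + 8 * t\<^sup>2 * (z$i)\<^sup>2) / s\<^sup>2 + 2 * (t * A) ^ 3" by simp
      qed
      also have "\<dots> = 6 - 3 * t\<^sup>2 / s + 3 / 8 * (6 * t ^ 4 + 8 * t\<^sup>2 * (norm z)\<^sup>2) / s\<^sup>2 + 6 * (t * A) ^ 3"
        by (simp add: sum_3 norm_sq_3 add_divide_distrib algebra_simps)
      \<comment> \<open>Substituting |z|^2 = s - \<epsilon>^2 cancels the terms of order t^2 / s.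
        What remains is the contribution 3 \<epsilon>^2 of the Laplacian, of which one \<epsilon>^2
        is then spent on the errors.\<close>
      also have "\<dots> = 6 - t\<^sup>2 / s\<^sup>2 * (3 * \<epsilon>\<^sup>2 - 9 / 4 * t\<^sup>2 - 6 * t * A ^ 3 * s\<^sup>2)"
      proof -
        have n: "(norm z)\<^sup>2 = s - \<epsilon>\<^sup>2" by (simp add: s_def)
        show ?thesis unfolding n using s(1) by (simp add: field_simps eval_nat_numeral)
      qed
      also have "\<dots> \<le> 6 - 2 * t\<^sup>2 * \<epsilon>\<^sup>2 / s0\<^sup>2"
      proof -
        have "t\<^sup>2 \<le> t" using t t' by (simp add: power2_eq_square mult_left_le)
        moreover have "6 * t * A ^ 3 * s\<^sup>2 \<le> 6 * t * A ^ 3 * s0\<^sup>2"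
          using s t A by (intro mult_left_mono power_mono) auto
        ultimately have ge: "2 * \<epsilon>\<^sup>2 \<le> 3 * \<epsilon>\<^sup>2 - 9 / 4 * t\<^sup>2 - 6 * t * A ^ 3 * s\<^sup>2"
          using tb by (simp add: algebra_simps)
        have "t\<^sup>2 / s0\<^sup>2 * (2 * \<epsilon>\<^sup>2) \<le> t\<^sup>2 / s\<^sup>2 * (3 * \<epsilon>\<^sup>2 - 9 / 4 * t\<^sup>2 - 6 * t * A ^ 3 * s\<^sup>2)"
          using s by (intro mult_mono[OF _ ge] divide_left_mono power_mono) auto
        then show ?thesis by (simp add: mult_ac)
      qed
      finally have "soft_sum \<epsilon> t z
        \<le> 1 / sqrt s * (6 - 2 * t\<^sup>2 * \<epsilon>\<^sup>2 / s0\<^sup>2)"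
        using s by (simp add: divide_right_mono)
      also have "\<dots> \<le> 6 * soft_kernel \<epsilon> z - c"
      proof -
        have "1 / sqrt s0 * (2 * t\<^sup>2 * \<epsilon>\<^sup>2 / s0\<^sup>2) \<le> 1 / sqrt s * (2 * t\<^sup>2 * \<epsilon>\<^sup>2 / s0\<^sup>2)"
          using s by (intro mult_right_mono divide_left_mono) auto
        then show ?thesis by (simp add: soft_kernel_def s_def[symmetric] c_def right_diff_distrib)
      qed
      finally show ?thesis .
    qed
    ultimately show ?thesis by blast
  qed
  ultimately show ?thesis by (rule that)
qed

lemma soft_kernel_norm_Pair: "soft_kernel \<epsilon> z = 1 / norm (z, \<epsilon>)"
  by (simp add: soft_kernel_def norm_Pair)

text \<open>As the reciprocal norm of the point (z, \<epsilon>) in a product space, the kernel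
  inherits both difference estimates from the reverse triangle inequality. The last one, integrated
  against a bounded density, makes softening an O(\<epsilon>) perturbation of the potential,
  uniformly in space.\<close>

lemma soft_kernel_bounds:
  assumes "\<epsilon> > 0"
  shows "0 \<le> soft_kernel \<epsilon> z" "soft_kernel \<epsilon> z \<le> 1 / \<epsilon>"
    and "\<bar>soft_kernel \<epsilon> z - soft_kernel \<epsilon> z'\<bar> \<le> norm (z - z') / \<epsilon>\<^sup>2"
    and "z \<noteq> 0 \<Longrightarrow> \<bar>soft_kernel \<epsilon> z - 1 / norm z\<bar> \<le> \<epsilon> / (norm z)\<^sup>2"
proof -
  have lb: "norm (w, \<epsilon>) \<ge> \<epsilon>" "norm (w, \<epsilon>) \<ge> norm w" for w :: "real^3"
    using assms by (auto simp: norm_Pair intro!: real_le_rsqrt)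
  have pos: "norm (w, \<epsilon>) > 0" for w :: "real^3" using lb(1)[of w] assms by linarith
  have lip: "\<bar>norm (w, \<epsilon>) - norm (w', \<delta>)\<bar> \<le> norm (w - w', \<epsilon> - \<delta>)" for w w' :: "real^3" and \<delta>
    using norm_triangle_ineq3[of "(w, \<epsilon>)" "(w', \<delta>)"] by simp
  show "0 \<le> soft_kernel \<epsilon> z" by (simp add: soft_kernel_norm_Pair)
  show "soft_kernel \<epsilon> z \<le> 1 / \<epsilon>"
    unfolding soft_kernel_norm_Pair using lb(1)[of z] pos[of z] assms by (intro divide_left_mono) auto
  have "\<bar>soft_kernel \<epsilon> z - soft_kernel \<epsilon> z'\<bar> = \<bar>norm (z', \<epsilon>) - norm (z, \<epsilon>)\<bar> / (norm (z, \<epsilon>) * norm (z', \<epsilon>))"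
    unfolding soft_kernel_norm_Pair using pos[of z] pos[of z']
    by (simp add: diff_divide_eq_iff divide_diff_eq_iff diff_frac_eq abs_mult)
  also have "\<dots> \<le> norm (z - z') / (\<epsilon> * \<epsilon>)"
    using lip[of z' z \<epsilon>] lb(1)[of z] lb(1)[of z'] assms
    by (intro frac_le mult_mono) (auto simp: norm_minus_commute)
  finally show "\<bar>soft_kernel \<epsilon> z - soft_kernel \<epsilon> z'\<bar> \<le> norm (z - z') / \<epsilon>\<^sup>2" by (simp add: power2_eq_square)
  assume z: "z \<noteq> 0"
  have "\<bar>soft_kernel \<epsilon> z - 1 / norm z\<bar> = \<bar>norm z - norm (z, \<epsilon>)\<bar> / (norm (z, \<epsilon>) * norm z)"
    unfolding soft_kernel_norm_Pair using pos[of z] z by (simp add: diff_frac_eq abs_mult)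
  also have "\<dots> \<le> \<epsilon> / (norm z * norm z)"
    using lip[of z z 0] lb(2)[of z] z assms
    by (intro frac_le mult_mono) (auto simp: abs_minus_commute)
  finally show "\<bar>soft_kernel \<epsilon> z - 1 / norm z\<bar> \<le> \<epsilon> / (norm z)\<^sup>2" by (simp add: power2_eq_square)
qed

lemma soft_kernel_borel [measurable]: "soft_kernel \<epsilon> \<in> borel_measurable borel"
  unfolding soft_kernel_def[abs_def] by measurable

lemma bdd_supp_integrable:
  assumes "bdd_supp r B q"
  shows "integrable lborel q"
proof -
  have V: "integrable lborel (\<lambda>y. B * indicator (cball (0::real^3) r) y)"
    using emeasure_bounded_finite[of "cball (0::real^3) r"]
    by (intro integrable_mult_right integrable_real_indicator) (simp_all add: borel_closed)
  show "integrable lborel q"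
    using bdd_suppD(1)[OF assms] bdd_suppD(5)[OF assms] bdd_suppD(4)[OF assms]
    by (intro lintegrable_bound[OF V] AE_I2) (auto simp: abs_mult)
qed

lemma soft_integrable:
  assumes q: "bdd_supp r B q" and "\<epsilon> > 0"
  shows "integrable lborel (\<lambda>y. q y * soft_kernel \<epsilon> (x - y))"
proof (rule lintegrable_bound)
  show "integrable lborel (\<lambda>y. 1 / \<epsilon> * q y)" by (intro integrable_mult_right bdd_supp_integrable[OF q])
  note [measurable] = bdd_suppD(1)[OF q]
  show "(\<lambda>y. q y * soft_kernel \<epsilon> (x - y)) \<in> borel_measurable lborel" by measurable
  show "AE y in lborel. norm (q y * soft_kernel \<epsilon> (x - y)) \<le> norm (1 / \<epsilon> * q y)"
  proof (rule AE_I2)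
    fix y
    have "\<bar>q y\<bar> * \<bar>soft_kernel \<epsilon> (x - y)\<bar> \<le> \<bar>q y\<bar> * (1 / \<epsilon>)"
      using soft_kernel_bounds(1,2)[OF assms(2), of "x - y"] by (intro mult_left_mono) auto
    then show "norm (q y * soft_kernel \<epsilon> (x - y)) \<le> norm (1 / \<epsilon> * q y)"
      using assms(2) by (simp add: abs_mult)
  qed
qed

lemma orthogonal_radial:
  assumes T: "orthogonal_transformation T" and "\<And>x y. norm x = norm y \<Longrightarrow> f x = f y"
  shows "f (T y) = f y"
  using assms orthogonal_transformation_norm by blast

lemma newton_radial:
  assumes q: "bdd_supp r B q" and rad: "\<And>x y. norm x = norm y \<Longrightarrow> q x = q y"
    and xy: "norm x = norm y"
  shows "newton q x = newton q y"
proof -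
  obtain T where T: "orthogonal_transformation T" "T x = y"
    using orthogonal_transformation_exists[OF xy] by blast
  have "(\<lambda>y. q (T y)) = q" 
    by (rule ext) (rule orthogonal_radial[OF T(1)], rule rad)
  then show ?thesis using newton_orthogonal[OF T(1) q, of x] T(2) by simp
qed

text \<open>A radial superharmonic function is nonincreasing in the radius: otherwise its minimum over
  some ball would be interior. The minimum principle is applied to the softened potential.\<close>

lemma newton_radially_antimono:
  assumes q: "bdd_supp r B q" and rad: "\<And>x y. norm x = norm y \<Longrightarrow> q x = q y"
    and nonneg: "\<And>y. q y \<ge> 0" and pos: "(LINT y|lborel. q y) > 0"
    and xx: "norm x < norm x'"
  shows "newton q x' \<le> newton q x"
proof (rule ccontr)
  assume neg: "\<not> ?thesis"
  define d where "d = newton q x' - newton q x"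
  have d: "d > 0" using neg by (simp add: d_def)
  have B: "B \<ge> 0" by (rule bdd_suppD(4)[OF q])
  \<comment> \<open>With \<epsilon> = d / (3 K) the softening error is at most d/3 at every point,
    hence less than half the assumed gap \<open>d\<close>. The summand 1 only keeps \<open>K\<close>
    positive.\<close>
  define K where "K = B * kernel_const r + 1"
  define \<epsilon> where "\<epsilon> = d / (3 * K)"
  have K: "K > 0" unfolding K_def using B kernel_const_nonneg[of r] by (intro add_nonneg_pos) auto
  have eps: "\<epsilon> > 0" using d K by (simp add: \<epsilon>_def)
  have epsd: "\<epsilon> * (B * kernel_const r) < d / 2"
  proof -
    have "\<epsilon> * (B * kernel_const r) \<le> \<epsilon> * K" using eps by (simp add: K_def)
    also have "\<dots> = d / 3" using K by (simp add: \<epsilon>_def)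
    finally show ?thesis using d by linarith
  qed
  let ?k = "soft_kernel \<epsilon>"
  define U where "U z = (LINT y|lborel. q y * ?k (z - y))" for z
  note I = soft_integrable[OF q eps]
  have close: "\<bar>U z - newton q z\<bar> < d / 2" for z
  proof -
    have "\<bar>U z - newton q z\<bar> = \<bar>LINT y|lborel. q y * ?k (z - y) - q y / norm (z - y)\<bar>"
      unfolding U_def newton_def by (simp add: I newton_integrable[OF q] lint_diff)
    also have "\<dots> \<le> (LINT y|lborel. \<bar>q y * ?k (z - y) - q y / norm (z - y)\<bar>)"
      by (rule integral_abs_bound)
    also have "\<dots> \<le> (LINT y|lborel. \<epsilon> * B * inv_sq r z y)"
    proof (rule integral_mono_AE)
      show "integrable lborel (\<lambda>y. \<bar>q y * ?k (z - y) - q y / norm (z - y)\<bar>)"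
        by (intro integrable_abs lintegrable_diff I newton_integrable[OF q])
      show "integrable lborel (\<lambda>y. \<epsilon> * B * inv_sq r z y)"
        by (rule integrable_mult_right[OF inverse_square_integrable])
      show "AE y in lborel. \<bar>q y * ?k (z - y) - q y / norm (z - y)\<bar>
          \<le> \<epsilon> * B * inv_sq r z y"
        using AE_lborel_singleton[of z]
      proof eventually_elim
        case (elim y)
        have "\<bar>q y * ?k (z - y) - q y / norm (z - y)\<bar> = \<bar>q y\<bar> * \<bar>?k (z - y) - 1 / norm (z - y)\<bar>"
          by (simp add: abs_mult[symmetric] right_diff_distrib)
        also have "\<dots> \<le> (B * indicator (cball 0 r) y) * (\<epsilon> / (norm (z - y))\<^sup>2)"
          using soft_kernel_bounds(4)[OF eps, of "z - y"] elim B by (intro mult_mono bdd_suppD(5)[OF q]) auto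
        finally show ?case by (simp add: mult_ac)
      qed
    qed
    also have "\<dots> = \<epsilon> * B * (LINT y|lborel. inv_sq r z y)"
      by (rule integral_mult_right_zero)
    also have "\<dots> \<le> \<epsilon> * B * kernel_const r"
      using eps B by (intro mult_left_mono inverse_square_integral_le) auto
    also have "\<dots> < d / 2" using epsd by (simp add: mult.assoc)
    finally show ?thesis .
  qed
  have cont: "continuous_on S U" for S
  proof -
    define L where "L = (LINT y|lborel. \<bar>q y\<bar>) / \<epsilon>\<^sup>2"
    have L0: "L \<ge> 0" unfolding L_def by (intro divide_nonneg_nonneg integral_nonneg_AE) auto
    have "\<bar>U z - U z'\<bar> \<le> L * norm (z - z')" for z z'
    proof -
      have "\<bar>U z - U z'\<bar> = \<bar>LINT y|lborel. q y * ?k (z - y) - q y * ?k (z' - y)\<bar>"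
        unfolding U_def by (simp add: I lint_diff)
      also have "\<dots> \<le> (LINT y|lborel. \<bar>q y * ?k (z - y) - q y * ?k (z' - y)\<bar>)"
        by (rule integral_abs_bound)
      also have "\<dots> \<le> (LINT y|lborel. norm (z - z') / \<epsilon>\<^sup>2 * \<bar>q y\<bar>)"
      proof (rule integral_mono)
        show "integrable lborel (\<lambda>y. \<bar>q y * ?k (z - y) - q y * ?k (z' - y)\<bar>)"
          by (intro integrable_abs lintegrable_diff I)
        show "integrable lborel (\<lambda>y. norm (z - z') / \<epsilon>\<^sup>2 * \<bar>q y\<bar>)"
          by (intro integrable_mult_right integrable_abs bdd_supp_integrable[OF q])
        fix y
        have "\<bar>q y * ?k (z - y) - q y * ?k (z' - y)\<bar> = \<bar>q y\<bar> * \<bar>?k (z - y) - ?k (z' - y)\<bar>"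
          by (simp add: abs_mult[symmetric] right_diff_distrib)
        also have "\<dots> \<le> \<bar>q y\<bar> * (norm ((z - y) - (z' - y)) / \<epsilon>\<^sup>2)"
          by (intro mult_left_mono soft_kernel_bounds(3)[OF eps]) auto
        finally show "\<bar>q y * ?k (z - y) - q y * ?k (z' - y)\<bar> \<le> norm (z - z') / \<epsilon>\<^sup>2 * \<bar>q y\<bar>"
          by (simp add: mult.commute)
      qed
      also have "\<dots> = L * norm (z - z')" by (simp add: L_def)
      finally show ?thesis .
    qed
    then have "L-lipschitz_on S U" using L0 by (intro lipschitz_onI) (auto simp: dist_norm)
    then show ?thesis by (rule lipschitz_on_continuous_on)
  qed
  define \<rho> where "\<rho> = norm x'"
  obtain x0 where x0: "x0 \<in> cball 0 \<rho>" "\<And>y. y \<in> cball 0 \<rho> \<Longrightarrow> U x0 \<le> U y"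
    using continuous_attains_inf[OF compact_cball, of 0 \<rho> U] cont xx by (auto simp: \<rho>_def)
  \<comment> \<open>On the bounding sphere the potential equals its value at x', which exceeds the
    value at \<open>x\<close> by \<open>d\<close>. Errors below d/2 at both points cannot make such
    a point a minimizer of \<open>U\<close>.\<close>
  have "norm x0 < \<rho>"
  proof (rule ccontr)
    assume "\<not> ?thesis"
    then have "norm x0 = norm x'" using x0(1) by (simp add: \<rho>_def)
    then have "newton q x0 = newton q x'"
      by (intro newton_radial[OF q]) (rule rad)
    moreover have "U x0 \<le> U x" using x0(2)[of x] xx by (simp add: \<rho>_def)
    ultimately show False using close[of x0] close[of x] by (simp add: d_def field_simps abs_if split: if_splits)
  qed
  \<comment> \<open>\<open>S\<close> bounds |x0 - y| for every y in the support; the maximum keeps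
    it nonnegative for any \<open>r\<close>.\<close>
  define S where "S = norm x0 + max r 0"
  obtain t0 where t0: "t0 > 0" "\<And>t. 0 < t \<Longrightarrow> t \<le> t0 \<Longrightarrow> \<exists>c>0. \<forall>z. norm z \<le> S \<longrightarrow>
     soft_sum \<epsilon> t z
       \<le> 6 * ?k z - c"
    using soft_kernel_superharmonic[OF eps, of S] by (auto simp: S_def)
  define t where "t = min t0 (\<rho> - norm x0)"
  have t: "0 < t" "t \<le> t0" "norm x0 + t \<le> \<rho>" using t0(1) \<open>norm x0 < \<rho>\<close> by (auto simp: t_def)
  obtain c where c: "c > 0" "\<And>z. norm z \<le> S \<Longrightarrow>
     soft_sum \<epsilon> t z
       \<le> 6 * ?k z - c"
    using t0(2)[OF t(1,2)] by blast
  have sh: "x0 + v - y = (x0 - y) + v" for v y by simp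
  have J: "integrable lborel (\<lambda>y. q y * ?k ((x0 - y) + v))" for v
    using I[of "x0 + v"] unfolding sh .
  have U': "U (x0 + v) = (LINT y|lborel. q y * ?k ((x0 - y) + v))" for v
    unfolding U_def sh ..
  \<comment> \<open>The six neighbours stay in the ball over which \<open>x0\<close> is a minimizer.
    Integrating the superharmonicity estimate against \<open>q\<close> bounds the same sum by
    \<open>6 * U x0\<close> minus \<open>c\<close> times the positive mass.\<close>
  have "6 * U x0 \<le> (\<Sum>i\<in>UNIV. U (x0 + t *\<^sub>R axis i 1) + U (x0 + (- t) *\<^sub>R axis i 1))"
  proof -
    have le: "U x0 \<le> U (x0 + \<tau> *\<^sub>R axis i 1)" if "\<bar>\<tau>\<bar> = t" for \<tau> and i :: 3
      using norm_triangle_ineq[of x0 "\<tau> *\<^sub>R axis i 1"] that t(3)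
      by (intro x0(2)) auto
    have "(\<Sum>i\<in>(UNIV::3 set). U x0 + U x0) \<le> (\<Sum>i\<in>UNIV. U (x0 + t *\<^sub>R axis i 1) + U (x0 + (- t) *\<^sub>R axis i 1))"
      using t(1) by (intro sum_mono add_mono le) simp_all
    then show ?thesis by simp
  qed
  also have "\<dots> = (LINT y|lborel. q y * soft_sum \<epsilon> t (x0 - y))"
    unfolding U' sum_distrib_left distrib_left
    by (subst lint_sum, intro lintegrable_add J)
      (simp only: lint_add[OF J J])
  also have "\<dots> \<le> (LINT y|lborel. 6 * (q y * ?k (x0 - y)) - c * q y)"
  proof (rule integral_mono)
    show "integrable lborel (\<lambda>y. q y * soft_sum \<epsilon> t (x0 - y))"
      unfolding sum_distrib_left distrib_left
      by (intro lintegrable_sum lintegrable_add J)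
    show "integrable lborel (\<lambda>y. 6 * (q y * ?k (x0 - y)) - c * q y)"
      by (intro lintegrable_diff integrable_mult_right I bdd_supp_integrable[OF q])
    fix y
    show "q y * soft_sum \<epsilon> t (x0 - y)
      \<le> 6 * (q y * ?k (x0 - y)) - c * q y"
    proof (cases "y \<in> cball 0 r")
      case True
      then have "norm (x0 - y) \<le> S" using norm_triangle_ineq4[of x0 y] by (auto simp: S_def)
      from mult_left_mono[OF c(2)[OF this] nonneg[of y]] show ?thesis by (simp add: algebra_simps)
    qed (simp add: bdd_suppD(3)[OF q])
  qed
  also have "\<dots> = 6 * U x0 - c * (LINT y|lborel. q y)"
    unfolding U_def
    by (subst lint_diff)
      (auto intro!: integrable_mult_right I bdd_supp_integrable[OF q])
  finally show False using mult_pos_pos[OF c(1) pos] by linarith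
qed

section \<open>Radial densities\<close>

lemma has_derivative_grad_on:
  assumes "f differentiable (at x within S)"
  shows "(f has_derivative (\<lambda>h. grad_on S f x \<bullet> h)) (at x within S)"
proof -
  let ?D = "frechet_derivative f (at x within S)"
  have D: "(f has_derivative ?D) (at x within S)" using assms by (simp add: frechet_derivative_works)
  then have lin: "linear ?D" by (rule has_derivative_linear)
  have "?D h = grad_on S f x \<bullet> h" for h
  proof -
    have "?D h = ?D (\<Sum>i\<in>UNIV. h$i *\<^sub>R axis i 1)" by (simp add: basis_expansion scalar_mult_eq_scaleR[symmetric])
    also have "\<dots> = (\<Sum>i\<in>UNIV. h$i * ?D (axis i 1))"
      by (simp add: linear_sum[OF lin] linear_cmul[OF lin])
    also have "\<dots> = grad_on S f x \<bullet> h" by (simp add: grad_on_def inner_vec_def mult.commute)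
    finally show ?thesis .
  qed
  then have "?D = (\<lambda>h. grad_on S f x \<bullet> h)" by (rule ext)
  with D show ?thesis by metis
qed

lemma has_real_derivative_along:
  assumes "(f has_derivative F) (at x)"
  shows "((\<lambda>t. f (x + t *\<^sub>R v)) has_real_derivative F v) (at 0)"
proof -
  have "((\<lambda>t. x + t *\<^sub>R v) has_derivative (\<lambda>t. t *\<^sub>R v)) (at 0)"
    by (auto intro!: derivative_eq_intros)
  moreover have "(f has_derivative F) (at (x + 0 *\<^sub>R v))" using assms by simp
  ultimately have "((\<lambda>t. f (x + t *\<^sub>R v)) has_derivative (\<lambda>t. F (t *\<^sub>R v))) (at 0)"
    by (rule has_derivative_compose)
  then show ?thesis
    by (simp add: linear_cmul[OF has_derivative_linear[OF assms]] has_field_derivative_def mult_commute_abs)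
qed

text \<open>For u orthogonal to \<open>x\<close> the function t -> f (x + t u) is even, so its
  derivative at 0 vanishes and only the radial part of \<open>v\<close> counts. Linearity of
  \<open>w\<close> is assumed, since only directional derivatives of potentials are computed. At
  \<open>x = 0\<close> the quotient is 0 by convention and every direction is orthogonal to
  \<open>x\<close>.\<close>

lemma radial_directional_derivative:
  fixes f :: "'a::real_inner \<Rightarrow> real" and w :: "'a \<Rightarrow> real"
  assumes rad: "\<And>x y. norm x = norm y \<Longrightarrow> f x = f y"
    and D: "\<And>v. ((\<lambda>t. f (x + t *\<^sub>R v)) has_real_derivative w v) (at 0)"
    and w: "linear w"
  shows "w v = (x \<bullet> v) / (norm x)\<^sup>2 * w x"
proof -
  define c where "c = (x \<bullet> v) / (norm x)\<^sup>2"
  define u where "u = v - c *\<^sub>R x"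
  have perp: "x \<bullet> u = 0"
    by (cases "x = 0") (auto simp: u_def c_def inner_diff_right power2_norm_eq_inner)
  have ev: "f (x + (- t) *\<^sub>R u) = f (x + t *\<^sub>R u)" for t
  proof (rule rad)
    have "(norm (x + (- t) *\<^sub>R u))\<^sup>2 = (norm (x + t *\<^sub>R u))\<^sup>2"
      unfolding power2_norm_eq_inner using perp
      by (simp add: inner_diff_left inner_diff_right inner_add_left inner_add_right inner_commute[of u x])
    then show "norm (x + (- t) *\<^sub>R u) = norm (x + t *\<^sub>R u)" by (simp only: power2_eq_iff_nonneg norm_ge_zero)
  qed
  have "((\<lambda>t. f (x + t *\<^sub>R u)) has_real_derivative w u) (at (- 0))" using D[of u] by simp
  then have "((\<lambda>t. f (x + (- t) *\<^sub>R u)) has_real_derivative - w u) (at 0)"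
    by (rule DERIV_mirror[THEN iffD1])
  then have "w u = - w u" using D[of u] unfolding ev by (rule DERIV_unique[rotated])
  then have "w u = 0" by simp
  then show ?thesis using linear_diff[OF w, of v "c *\<^sub>R x"] linear_cmul[OF w, of c x] by (simp add: u_def c_def)
qed

lemma integral_lborel_translate:
  fixes f :: "'a::euclidean_space \<Rightarrow> real"
  assumes "f \<in> borel_measurable borel"
  shows "(LINT y|lborel. f (z + y)) = (LINT y|lborel. f y)"
proof -
  have "(LINT y|lborel. f y) = (LINT y|distr lborel borel ((+) z). f y)"
    by (simp add: lborel_distr_plus)
  also have "\<dots> = (LINT y|lborel. f (z + y))"
    using assms by (subst integral_distr) auto
  finally show ?thesis by simp
qed

lemma newton_translate:
  assumes q: "bdd_supp r B q"
  shows "newton q (x + z) = (LINT y|lborel. q (y + z) / norm (x - y))"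
proof -
  note [measurable] = bdd_suppD(1)[OF q]
  have "newton q (x + z) = (LINT y|lborel. q (z + y) / norm (x + z - (z + y)))"
    unfolding newton_def by (rule integral_lborel_translate[symmetric]) measurable
  then show ?thesis by (simp add: add.commute)
qed

text \<open>Translation moves the increment from the singular kernel to the Lipschitz density. The
  difference quotients of \<open>q\<close> then converge pointwise and are dominated by a multiple
  of 1/|x - y| on a fixed ball.\<close>

lemma newton_directional_derivative:
  fixes g :: "real^3 \<Rightarrow> real^3"
  assumes q: "bdd_supp r B q"
    and d: "\<And>y. (q has_derivative (\<lambda>h. g y \<bullet> h)) (at y)"
    and L: "\<And>y. norm (g y) \<le> L"
  shows "((\<lambda>t. newton q (x + t *\<^sub>R v)) has_real_derivative newton (\<lambda>y. g y \<bullet> v) x) (at 0)"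
proof -
  note [measurable] = bdd_suppD(1)[OF q]
  have L0: "L \<ge> 0" using L[of 0] norm_ge_zero order_trans by blast
  have lip: "\<bar>q (y + t *\<^sub>R v) - q y\<bar> \<le> L * (\<bar>t\<bar> * norm v)" for y t
  proof -
    have "norm (q (y + t *\<^sub>R v) - q y) \<le> L * norm (y + t *\<^sub>R v - y)"
    proof (rule differentiable_bound[of UNIV q "\<lambda>y h. g y \<bullet> h"])
      show "onorm (\<lambda>h. g y \<bullet> h) \<le> L" for y
        by (rule onorm_bound[OF L0])
          (simp add: order_trans[OF Cauchy_Schwarz_ineq2 mult_right_mono[OF L norm_ge_zero]])
    qed (use d in auto)
    then show ?thesis by simp
  qed
  have "((\<lambda>t. (newton q (x + t *\<^sub>R v) - newton q x) / t) \<longlongrightarrow> newton (\<lambda>y. g y \<bullet> v) x) (at 0)"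
    unfolding tendsto_at_iff_sequentially comp_def
  proof (intro allI impI)
    fix X :: "nat \<Rightarrow> real" assume X: "\<forall>i. X i \<in> UNIV - {0}" "X \<longlonglongrightarrow> 0"
    obtain K where K: "\<And>i. \<bar>X i\<bar> \<le> K"
      using X(2) Bseq_def convergentI convergent_imp_Bseq by (metis real_norm_def)
    \<comment> \<open>\<open>K\<close> bounds the increments, so this radius covers the supports of
      all the translated densities at once.\<close>
    define r' where "r' = max r 0 + K * norm v"
    have I: "integrable lborel (\<lambda>y. q (y + z) / norm (x - y))" for z
    proof -
      have "bdd_supp (r + norm z) B (\<lambda>y. q (y + z))"
        unfolding bdd_supp_def
      proof (intro conjI allI impI)
        show "\<bar>q (y + z)\<bar> \<le> B" for y by (rule bdd_suppD(2)[OF q])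
        show "q (y + z) = 0" if "y \<notin> cball 0 (r + norm z)" for y
        proof (rule bdd_suppD(3)[OF q])
          show "y + z \<notin> cball 0 r" using that norm_triangle_ineq4[of "y + z" z] by auto
        qed
      qed measurable
      then show ?thesis by (rule newton_integrable)
    qed
    have e: "(newton q (x + X i *\<^sub>R v) - newton q x) / X i
        = (LINT y|lborel. (q (y + X i *\<^sub>R v) - q y) / X i / norm (x - y))" for i
    proof -
      have "newton q (x + X i *\<^sub>R v) - newton q x
        = (LINT y|lborel. q (y + X i *\<^sub>R v) / norm (x - y) - q y / norm (x - y))"
        unfolding newton_translate[OF q] using I[of "X i *\<^sub>R v"] I[of 0]
        by (simp add: newton_def lint_diff)
      then show ?thesis
        by (simp add: diff_divide_distrib mult.commute flip: integral_divide_zero)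
    qed
    show "(\<lambda>i. (newton q (x + X i *\<^sub>R v) - newton q x) / X i) \<longlonglongrightarrow> newton (\<lambda>y. g y \<bullet> v) x"
      unfolding e unfolding newton_def
    proof (rule integral_dominated_convergence)
      show "integrable lborel (\<lambda>y. L * norm v * (inv_norm r' x y))"
        by (rule integrable_mult_right[OF inverse_integrable])
      show "AE y in lborel. (\<lambda>i. (q (y + X i *\<^sub>R v) - q y) / X i / norm (x - y)) \<longlonglongrightarrow> g y \<bullet> v / norm (x - y)"
      proof (rule AE_I2)
        fix y
        have "((\<lambda>t. (q (y + t *\<^sub>R v) - q y) / t) \<longlongrightarrow> g y \<bullet> v) (at 0)"
          using has_real_derivative_along[OF d, of y v] by (simp add: has_field_derivative_iff)
        then have "(\<lambda>i. (q (y + X i *\<^sub>R v) - q y) / X i) \<longlonglongrightarrow> g y \<bullet> v"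
          using X unfolding tendsto_at_iff_sequentially comp_def by blast
        then show "(\<lambda>i. (q (y + X i *\<^sub>R v) - q y) / X i / norm (x - y)) \<longlonglongrightarrow> g y \<bullet> v / norm (x - y)"
          unfolding divide_inverse[of _ "norm (x - y)"] by (intro tendsto_mult_right)
      qed
      show "AE y in lborel. norm ((q (y + X i *\<^sub>R v) - q y) / X i / norm (x - y))
           \<le> L * norm v * (inv_norm r' x y)" for i
      proof (rule AE_I2)
        fix y
        show "norm ((q (y + X i *\<^sub>R v) - q y) / X i / norm (x - y))
           \<le> L * norm v * (inv_norm r' x y)"
        proof (cases "y \<in> cball 0 r'")
          case True
          have "\<bar>q (y + X i *\<^sub>R v) - q y\<bar> / \<bar>X i\<bar> \<le> L * norm v"
            using lip[of y "X i"] X(1) by (simp add: divide_le_eq mult_ac)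
          then have "\<bar>q (y + X i *\<^sub>R v) - q y\<bar> / \<bar>X i\<bar> / norm (x - y) \<le> L * norm v / norm (x - y)"
            by (rule divide_right_mono) simp
          moreover have "norm ((q (y + X i *\<^sub>R v) - q y) / X i / norm (x - y)) = \<bar>q (y + X i *\<^sub>R v) - q y\<bar> / \<bar>X i\<bar> / norm (x - y)"
            by (simp only: real_norm_def abs_divide abs_norm_cancel)
          moreover have "L * norm v * (inv_norm r' x y) = L * norm v / norm (x - y)"
            using True by simp
          ultimately show ?thesis by (simp only:)
        next
          case False
          have Kv: "\<bar>X i\<bar> * norm v \<le> K * norm v" using K[of i] by (intro mult_right_mono) auto
          moreover have "0 \<le> K * norm v" by (rule order_trans[OF _ Kv]) simp
          ultimately have "norm (y + X i *\<^sub>R v) > r" "norm y > r"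
            using False norm_triangle_ineq4[of "y + X i *\<^sub>R v" "X i *\<^sub>R v"]
              mult_nonneg_nonneg[of "\<bar>X i\<bar>" "norm v"]
            by (auto simp: r'_def max_def split: if_splits)
          then show ?thesis using bdd_suppD(3)[OF q] False L0 by simp
        qed
      qed
      show "(\<lambda>y. g y \<bullet> v / norm (x - y)) \<in> borel_measurable lborel"
      proof -
        have "(\<lambda>y. g y \<bullet> v) \<in> borel_measurable borel"
        proof (rule borel_measurable_LIMSEQ_real)
          show "(\<lambda>i. (q (y + X i *\<^sub>R v) - q y) / X i) \<longlonglongrightarrow> g y \<bullet> v" for y
            using has_real_derivative_along[OF d, of y v] X
            unfolding has_field_derivative_iff tendsto_at_iff_sequentially comp_def by simp
        qed measurable
        then show ?thesis by measurable
      qed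
    qed measurable
  qed
  then show ?thesis by (simp add: has_field_derivative_iff)
qed

lemma continuous_AE_zero_imp_zero:
  fixes f :: "'a::euclidean_space \<Rightarrow> real"
  assumes f: "continuous_on UNIV f" and z: "AE y in lborel. f y = 0"
  shows "f y = 0"
proof -
  have cl: "closed {y. f y = 0}"
    using continuous_closed_vimage[of "{0::real}" f] f
    by (simp add: continuous_on_eq_continuous_at vimage_def)
  have "AE y in lebesgue. y \<in> {y. f y = 0}" using z by (simp add: AE_completion)
  from mem_closed_if_AE_lebesgue[OF cl this] show ?thesis by simp
qed

section \<open>Slope of a radial density and gravity of its potential\<close>

locale radial_density =
  fixes \<rho> :: "real^3 \<Rightarrow> real" and R :: real
  assumes R_pos: "R > 0"
    and radial: "\<And>x y. norm x = norm y \<Longrightarrow> \<rho> x = \<rho> y"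
    and rho_pos: "\<And>x. x \<in> ball 0 R \<Longrightarrow> \<rho> x > 0"
    and rho_zero: "\<And>x. x \<notin> ball 0 R \<Longrightarrow> \<rho> x = 0"
    and rho_C1: "C1_on UNIV \<rho>"
begin

abbreviation grd :: "real^3 \<Rightarrow> real^3" where "grd \<equiv> grad_on UNIV \<rho>"

lemma rho_has_derivative: "(\<rho> has_derivative (\<lambda>h. grd y \<bullet> h)) (at y)"
  using rho_C1 has_derivative_grad_on[of \<rho> y UNIV] by (simp add: C1_on_def differentiable_on_def)

lemma grd_continuous: "continuous_on UNIV grd"
  using rho_C1 by (simp add: C1_on_def)

lemma rho_continuous: "continuous_on S \<rho>"
  by (intro continuous_at_imp_continuous_on ballI has_derivative_continuous[OF rho_has_derivative])

lemma rho_nonneg: "\<rho> y \<ge> 0"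
  using rho_pos[of y] rho_zero[of y] by force

text \<open>Such a point, on the boundary sphere or beyond, is a global minimum of the nonnegative
  density.\<close>

lemma grd_zero: assumes "y \<notin> ball 0 R" shows "grd y = 0"
proof -
  have "(\<lambda>h. grd y \<bullet> h) = (\<lambda>h. 0)"
  proof (rule has_derivative_local_min[OF rho_has_derivative])
    show "eventually (\<lambda>z. \<rho> y \<le> \<rho> z) (at y)"
      using rho_zero[OF assms] rho_nonneg by simp
  qed
  then have "grd y \<bullet> grd y = 0" by metis
  then show ?thesis by simp
qed

lemma grd_bounded: "\<exists>L\<ge>0. \<forall>y. norm (grd y) \<le> L"
proof -
  have "compact (grd ` cball 0 R)"
    using grd_continuous by (intro compact_continuous_image) (auto intro: continuous_on_subset)
  then obtain L where L: "\<And>y. y \<in> cball 0 R \<Longrightarrow> norm (grd y) \<le> L"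
    by (meson bounded_iff compact_imp_bounded imageI)
  have "norm (grd y) \<le> max L 0" for y
    using L[of y] grd_zero[of y] by (cases "y \<in> cball 0 R") auto
  then show ?thesis by (intro exI[of _ "max L 0"]) auto
qed

definition lip :: real where "lip = (SOME L. L \<ge> 0 \<and> (\<forall>y. norm (grd y) \<le> L))"

lemma lip_nonneg: "lip \<ge> 0" and norm_grd_le: "norm (grd y) \<le> lip"
  using someI_ex[OF grd_bounded] unfolding lip_def by blast+

lemma rho_lipschitz: "\<bar>\<rho> x - \<rho> y\<bar> \<le> lip * norm (x - y)"
proof -
  have "norm (\<rho> x - \<rho> y) \<le> lip * norm (x - y)"
  proof (rule differentiable_bound[of UNIV \<rho> "\<lambda>y h. grd y \<bullet> h"])
    show "onorm (\<lambda>h. grd y \<bullet> h) \<le> lip" for y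
      by (rule onorm_bound[OF lip_nonneg])
        (simp add: order_trans[OF Cauchy_Schwarz_ineq2 mult_right_mono[OF norm_grd_le norm_ge_zero]])
  qed (use rho_has_derivative in auto)
  then show ?thesis by simp
qed

lemma rho_borel [measurable]: "\<rho> \<in> borel_measurable borel"
  by (intro borel_measurable_continuous_onI rho_continuous)

lemma grd_borel [measurable]: "grd \<in> borel_measurable borel"
  by (intro borel_measurable_continuous_onI grd_continuous)

lemma rho_le: "\<rho> y \<le> lip * R"
proof (cases "y \<in> ball 0 R")
  case True
  define z :: "real^3" where "z = (if y = 0 then R *\<^sub>R axis 1 1 else (R / norm y) *\<^sub>R y)"
  have nz: "norm z = R" using R_pos by (auto simp: z_def)
  then have "\<rho> z = 0" by (intro rho_zero) auto
  moreover have "norm (y - z) \<le> R"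
  proof (cases "y = 0")
    case False
    have "y - z = (1 - R / norm y) *\<^sub>R y" using False by (simp add: z_def algebra_simps)
    then have "norm (y - z) = \<bar>(1 - R / norm y) * norm y\<bar>" by (simp add: abs_mult)
    also have "(1 - R / norm y) * norm y = norm y - R" using False by (simp add: field_simps)
    finally show ?thesis using True by auto
  qed (use nz in auto)
  ultimately show ?thesis
    using rho_lipschitz[of y z] mult_left_mono[OF \<open>norm (y - z) \<le> R\<close> lip_nonneg] by linarith
qed (use rho_zero lip_nonneg R_pos in auto)

lemma rho_bdd_supp: "bdd_supp R (lip * R) \<rho>"
  using rho_le rho_nonneg rho_zero by (auto simp: bdd_supp_def)

lemma grd_bdd_supp: "bdd_supp R (lip * norm v) (\<lambda>y. grd y \<bullet> v)"
  unfolding bdd_supp_def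
proof (intro conjI allI impI)
  show "(\<lambda>y. grd y \<bullet> v) \<in> borel_measurable borel" by measurable
  show "\<bar>grd y \<bullet> v\<bar> \<le> lip * norm v" for y
    by (rule order_trans[OF Cauchy_Schwarz_ineq2 mult_right_mono[OF norm_grd_le norm_ge_zero]])
  show "grd y \<bullet> v = 0" if "y \<notin> cball 0 R" for y using that by (simp add: grd_zero)
qed

lemma rho_integral_pos: "(LINT y|lborel. \<rho> y) > 0"
proof -
  have "(LINT y|lborel. \<rho> y) \<noteq> 0"
  proof
    assume "(LINT y|lborel. \<rho> y) = 0"
    then have "AE y in lborel. \<rho> y = 0"
      using integral_nonneg_eq_0_iff_AE[OF bdd_supp_integrable[OF rho_bdd_supp]] rho_nonneg by auto
    from continuous_AE_zero_imp_zero[OF rho_continuous this, of 0] rho_pos[of 0] R_pos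
    show False by simp
  qed
  moreover have "(LINT y|lborel. \<rho> y) \<ge> 0" by (intro integral_nonneg_AE AE_I2 rho_nonneg)
  ultimately show ?thesis by linarith
qed

lemma newton_rho_derivative:
  "((\<lambda>t. newton \<rho> (x + t *\<^sub>R v)) has_real_derivative newton (\<lambda>y. grd y \<bullet> v) x) (at 0)"
  by (rule newton_directional_derivative[OF rho_bdd_supp rho_has_derivative norm_grd_le])

text \<open>The gradients of the density and of its potential are \<open>- slope y\<close> times \<open>y\<close> and
  \<open>- gravity x\<close> times \<open>x\<close>. Both coefficients are \<open>0\<close> at the origin because \<open>x / 0 = 0\<close>.\<close>

definition slope :: "real^3 \<Rightarrow> real" where "slope y = - (grd y \<bullet> y) / (norm y)\<^sup>2"

definition gravity :: "real^3 \<Rightarrow> real" where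
  "gravity x = - newton (\<lambda>y. grd y \<bullet> x) x / (norm x)\<^sup>2"

lemma slope: "slope y * (y \<bullet> v) = - (grd y \<bullet> v)"
proof -
  have "grd y \<bullet> v = (y \<bullet> v) / (norm y)\<^sup>2 * (grd y \<bullet> y)"
  proof (rule radial_directional_derivative[of \<rho>])
    show "((\<lambda>t. \<rho> (y + t *\<^sub>R v)) has_real_derivative grd y \<bullet> v) (at 0)" for v
      by (rule has_real_derivative_along[OF rho_has_derivative])
    show "linear (\<lambda>v. grd y \<bullet> v)" by (intro linearI) (simp_all add: inner_add_right)
  qed (rule radial)
  then show ?thesis by (simp add: slope_def)
qed

lemma newton_rho_radial: "norm x = norm y \<Longrightarrow> newton \<rho> x = newton \<rho> y"
  by (rule newton_radial[OF rho_bdd_supp]) (rule radial)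

text \<open>Translating the potential differentiates the density, and radial symmetry expresses both
  derivatives through one coefficient. Thus every linear function x.v solves a f = T (b f); the
  direction e1 - e3 supplies the supersolution.\<close>

lemma gravity: "gravity x * (x \<bullet> v) = newton (\<lambda>y. slope y * (y \<bullet> v)) x"
proof -
  have "newton (\<lambda>y. grd y \<bullet> v) x = (x \<bullet> v) / (norm x)\<^sup>2 * newton (\<lambda>y. grd y \<bullet> x) x"
  proof (rule radial_directional_derivative[of "newton \<rho>"])
    show "linear (\<lambda>v. newton (\<lambda>y. grd y \<bullet> v) x)"
    proof (rule linearI)
      show "newton (\<lambda>y. grd y \<bullet> (v + w)) x = newton (\<lambda>y. grd y \<bullet> v) x + newton (\<lambda>y. grd y \<bullet> w) x" for v w
        unfolding newton_def inner_add_right add_divide_distrib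
        by (rule lint_add; rule newton_integrable[OF grd_bdd_supp])
      show "newton (\<lambda>y. grd y \<bullet> (c *\<^sub>R v)) x = c *\<^sub>R newton (\<lambda>y. grd y \<bullet> v) x" for c v
        unfolding newton_def by (simp add: times_divide_eq_right[symmetric] del: times_divide_eq_right)
    qed
  qed (rule newton_rho_radial newton_rho_derivative; assumption?)+
  then show ?thesis by (simp add: gravity_def slope newton_def)
qed

lemma slope_radial: assumes "norm x = norm y" shows "slope x = slope y"
proof -
  have "\<rho> (x + t *\<^sub>R x) = \<rho> (y + t *\<^sub>R y)" for t
  proof (rule radial)
    have "x + t *\<^sub>R x = (1 + t) *\<^sub>R x" "y + t *\<^sub>R y = (1 + t) *\<^sub>R y" by (simp_all add: algebra_simps)
    then show "norm (x + t *\<^sub>R x) = norm (y + t *\<^sub>R y)" using assms by simp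
  qed
  then have "grd x \<bullet> x = grd y \<bullet> y"
    using has_real_derivative_along[OF rho_has_derivative, of x x]
      has_real_derivative_along[OF rho_has_derivative, of y y] DERIV_unique by simp
  then show ?thesis using assms by (simp add: slope_def)
qed

lemma gravity_radial: assumes "norm x = norm y" shows "gravity x = gravity y"
proof -
  have "newton \<rho> (x + t *\<^sub>R x) = newton \<rho> (y + t *\<^sub>R y)" for t
  proof (rule newton_rho_radial)
    have "x + t *\<^sub>R x = (1 + t) *\<^sub>R x" "y + t *\<^sub>R y = (1 + t) *\<^sub>R y" by (simp_all add: algebra_simps)
    then show "norm (x + t *\<^sub>R x) = norm (y + t *\<^sub>R y)" using assms by simp
  qed
  then have "newton (\<lambda>z. grd z \<bullet> x) x = newton (\<lambda>z. grd z \<bullet> y) y"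
    using newton_rho_derivative[of x x] newton_rho_derivative[of y y] DERIV_unique by simp
  then show ?thesis using assms by (simp add: gravity_def)
qed

lemma slope_borel [measurable]: "slope \<in> borel_measurable borel"
  unfolding slope_def[abs_def] by measurable

lemma slope_zero: "y \<notin> ball 0 R \<Longrightarrow> slope y = 0"
  by (simp add: slope_def grd_zero)

lemma slope_bound: "\<bar>slope y\<bar> * norm y \<le> lip"
proof (cases "y = 0")
  case False
  have "\<bar>grd y \<bullet> y\<bar> \<le> lip * norm y"
    by (rule order_trans[OF Cauchy_Schwarz_ineq2 mult_right_mono[OF norm_grd_le norm_ge_zero]])
  then show ?thesis using False by (simp add: slope_def power2_eq_square field_simps)
qed (simp add: lip_nonneg)

lemma directional_derivative_nonpos:
  assumes D: "((\<lambda>t. f (x + t *\<^sub>R x)) has_real_derivative d) (at 0)"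
    and anti: "\<And>y. norm x < norm y \<Longrightarrow> f y \<le> (f x :: real)" and x: "(x :: real^3) \<noteq> 0"
  shows "d \<le> 0"
proof (rule ccontr)
  assume "\<not> d \<le> 0"
  then obtain e where e: "e > 0" "\<And>h. h > 0 \<Longrightarrow> h < e \<Longrightarrow> f (x + 0 *\<^sub>R x) < f (x + (0 + h) *\<^sub>R x)"
    using DERIV_pos_inc_right[OF D] by auto
  have "x + (e/2) *\<^sub>R x = (1 + e/2) *\<^sub>R x" by (simp add: algebra_simps)
  then have "norm (x + (e/2) *\<^sub>R x) = (1 + e/2) * norm x" using e(1) by simp
  also have "\<dots> > norm x" using e(1) x by simp
  finally have "f (x + (e/2) *\<^sub>R x) \<le> f x" by (rule anti)
  with e(2)[of "e/2"] e(1) show False by simp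
qed

lemma gravity_nonneg: "gravity x \<ge> 0"
proof (cases "x = 0")
  case False
  have "newton (\<lambda>y. grd y \<bullet> x) x \<le> 0"
  proof (rule directional_derivative_nonpos[OF newton_rho_derivative _ False])
    show "newton \<rho> y \<le> newton \<rho> x" if "norm x < norm y" for y
      by (rule newton_radially_antimono[OF rho_bdd_supp _ rho_nonneg rho_integral_pos that]) (rule radial)
  qed
  then show ?thesis by (simp add: gravity_def divide_nonpos_nonneg)
qed (simp add: gravity_def)

end

section \<open>Equator against pole for the linearized equation\<close>

locale decreasing_radial_density = radial_density +
  assumes rho_antimono: "\<And>x y. norm x < norm y \<Longrightarrow> \<rho> y \<le> \<rho> x"
begin

lemma slope_nonneg: "slope y \<ge> 0"
proof (cases "y = 0")
  case False
  have "grd y \<bullet> y \<le> 0"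
    by (rule directional_derivative_nonpos[OF has_real_derivative_along[OF rho_has_derivative] rho_antimono False])
  then show ?thesis by (simp add: slope_def divide_nonpos_nonneg)
qed (simp add: slope_def)

text \<open>The weight \<open>max (norm x) (norm y)\<close> in \<open>lip_eta\<close> makes \<eta>
  quadratically small at the origin. This compensates for \<open>slope\<close>, which is only known
  to be O(1/|y|) there, and keeps \<open>slope y * \<eta> y\<close> bounded.\<close>

lemma equator_exceeds_pole:
  assumes lip_eta: "\<And>x y. x \<in> cball 0 R \<Longrightarrow> y \<in> cball 0 R \<Longrightarrow> \<bar>\<eta> x - \<eta> y\<bar> \<le> C * max (norm x) (norm y) * norm (x - y)"
    and eta0: "\<eta> 0 = 0"
    and sym: "\<And>x. x \<in> cball 0 R \<Longrightarrow> \<eta> (antiswap13 (swap13 x)) = \<eta> x"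
    and c: "c > 0"
    and eq: "\<And>x. x \<in> cball 0 R \<Longrightarrow> x \<noteq> 0 \<Longrightarrow> gravity x * (\<eta> x - \<eta> (swap13 x))
       = newton (\<lambda>y. slope y * \<eta> y) x - newton (\<lambda>y. slope y * \<eta> y) (swap13 x) + c * ((x$1)\<^sup>2 - (x$3)\<^sup>2)"
  shows "\<eta> (axis 3 R) < \<eta> (axis 1 R)"
proof -
  \<comment> \<open>\<eta> is controlled only on the closed ball; the cut-off makes the oddness of
    \<open>D\<close> global and leaves \<open>slope y * D y\<close> zero outside.\<close>
  define D where "D x = (if x \<in> cball 0 R then \<eta> x - \<eta> (swap13 x) else 0)" for x
  have nT [simp]: "norm (swap13 x) = norm x" "norm (antiswap13 x) = norm x" for x
    by (rule orthogonal_transformation_norm[OF orthogonal_swap13] orthogonal_transformation_norm[OF orthogonal_antiswap13])+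
  have cT [simp]: "swap13 x \<in> cball 0 R \<longleftrightarrow> x \<in> cball 0 R" "antiswap13 x \<in> cball 0 R \<longleftrightarrow> x \<in> cball 0 R" for x
    by simp_all
  have D1: "D (swap13 x) = - D x" for x by (simp add: D_def del: mem_cball_0)
  have D2: "D (antiswap13 x) = - D x" for x
  proof (cases "x \<in> cball 0 R")
    case True
    have "\<eta> (antiswap13 x) = \<eta> (swap13 x)" using sym[of "swap13 x"] True by (simp del: mem_cball_0)
    moreover have "\<eta> (swap13 (antiswap13 x)) = \<eta> x" using sym[of x] True swap13_antiswap13[of x] by simp
    ultimately show ?thesis using True by (simp add: D_def del: mem_cball_0)
  qed (simp add: D_def)
  have eta_cont: "continuous_on (cball 0 R) \<eta>"
  proof (rule continuous_onI)
    fix x :: "real^3" and e :: real assume x: "x \<in> cball 0 R" and e: "e > 0"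
    define K where "K = max C 0 * R + 1"
    have K: "K > 0" using R_pos by (auto simp: K_def intro: add_nonneg_pos)
    have "dist (\<eta> y) (\<eta> x) \<le> e" if y: "y \<in> cball 0 R" and d: "dist y x < e / K" for y
    proof -
      have "\<bar>\<eta> y - \<eta> x\<bar> \<le> C * max (norm y) (norm x) * norm (y - x)" by (rule lip_eta[OF y x])
      also have "\<dots> \<le> K * norm (y - x)"
      proof (rule mult_right_mono)
        have "C * max (norm y) (norm x) \<le> max C 0 * R" using x y by (intro mult_mono) (auto simp: max_def)
        then show "C * max (norm y) (norm x) \<le> K" by (simp add: K_def)
      qed simp
      also have "\<dots> \<le> e" using d K by (simp add: dist_norm field_simps)
      finally show ?thesis by (simp add: dist_real_def)
    qed
    then show "\<exists>d>0. \<forall>y\<in>cball 0 R. dist y x < d \<longrightarrow> dist (\<eta> y) (\<eta> x) \<le> e"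
      using e K by (intro exI[of _ "e / K"]) auto
  qed
  define q where "q y = slope y * \<eta> y" for y
  have eta_le: "\<bar>\<eta> y\<bar> \<le> C * (norm y)\<^sup>2" if "y \<in> cball 0 R" for y
    using lip_eta[OF that, of 0] eta0 R_pos by (simp add: power2_eq_square)
  have C0: "C \<ge> 0"
  proof -
    have n: "norm (axis 1 R :: real^3) = R" using R_pos by (simp add: norm_eq_sqrt_inner inner_axis_axis)
    have "0 \<le> C * (norm (axis 1 R :: real^3))\<^sup>2"
      by (rule order_trans[OF abs_ge_zero eta_le]) (use n in simp)
    then show ?thesis using R_pos by (simp add: n zero_le_mult_iff)
  qed
  have bq: "bdd_supp R (lip * C * R) q"
    unfolding bdd_supp_def
  proof (intro conjI allI impI)
    have "(\<lambda>y. indicator (cball 0 R) y *\<^sub>R \<eta> y) \<in> borel_measurable borel"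
      by (rule borel_measurable_continuous_on_indicator[OF _ eta_cont]) measurable
    then have "(\<lambda>y. slope y * (indicator (cball 0 R) y *\<^sub>R \<eta> y)) \<in> borel_measurable borel" by measurable
    moreover have "slope y * (indicator (cball 0 R) y *\<^sub>R \<eta> y) = q y" for y
      using slope_zero[of y] by (cases "y \<in> cball 0 R") (auto simp: q_def)
    ultimately show "q \<in> borel_measurable borel" by simp
    show "q y = 0" if "y \<notin> cball 0 R" for y using that slope_zero[of y] by (simp add: q_def)
    show "\<bar>q y\<bar> \<le> lip * C * R" for y
    proof (cases "y \<in> cball 0 R")
      case True
      have "\<bar>q y\<bar> \<le> \<bar>slope y\<bar> * (C * (norm y)\<^sup>2)" 
        unfolding q_def abs_mult by (intro mult_left_mono eta_le True) simp
      also have "\<dots> = (\<bar>slope y\<bar> * norm y) * (C * norm y)" by (simp add: power2_eq_square)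
      also have "\<dots> \<le> lip * (C * R)"
        using True C0 lip_nonneg by (intro mult_mono slope_bound) auto
      finally show ?thesis by simp
    qed (use slope_zero[of y] lip_nonneg C0 R_pos in \<open>simp add: q_def\<close>)
  qed
  have bqs: "bdd_supp R (lip * C * R) (\<lambda>y. q (swap13 y))"
    by (rule bdd_supp_orthogonal[OF orthogonal_swap13 bq])
  have bD_eq: "slope y * D y = q y - q (swap13 y)" for y
  proof (cases "y \<in> cball 0 R")
    case True
    then show ?thesis using slope_radial[of "swap13 y" y] by (simp add: D_def q_def right_diff_distrib)
  next
    case False
    then show ?thesis using slope_zero[of y] slope_zero[of "swap13 y"] by (simp add: q_def)
  qed
  have bD: "bdd_supp R (2 * (lip * C * R)) (\<lambda>y. slope y * D y)"
    unfolding bD_eq bdd_supp_def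
  proof (intro conjI allI impI)
    note [measurable] = bdd_suppD(1)[OF bq] bdd_suppD(1)[OF bqs]
    show "(\<lambda>y. q y - q (swap13 y)) \<in> borel_measurable borel" by measurable
    show "\<bar>q y - q (swap13 y)\<bar> \<le> 2 * (lip * C * R)" for y
      using bdd_suppD(2)[OF bq, of y] bdd_suppD(2)[OF bqs, of y] by linarith
    show "q y - q (swap13 y) = 0" if "y \<notin> cball 0 R" for y
      using bdd_suppD(3)[OF bq that] bdd_suppD(3)[OF bqs that] by simp
  qed
  have newton_bD: "newton (\<lambda>y. slope y * D y) x = newton q x - newton q (swap13 x)" for x
    unfolding bD_eq newton_orthogonal[OF orthogonal_swap13 bq, symmetric] unfolding newton_def diff_divide_distrib
    by (rule lint_diff; rule newton_integrable[OF bq] newton_integrable[OF bqs])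
  have eqD: "gravity x * D x = newton (\<lambda>y. slope y * D y) x + c * ((x$1)\<^sup>2 - (x$3)\<^sup>2)"
    if "x \<in> cball 0 R" "x \<noteq> 0" for x
    using eq[OF that] that(1) unfolding newton_bD q_def by (simp add: D_def)
  let ?v = "axis 1 1 - axis 3 1 :: real^3"
  have iv: "y \<bullet> ?v = y$1 - y$3" for y :: "real^3" by (simp add: inner_diff_right inner_axis)
  have p: "bdd_supp R (lip * norm ?v) (\<lambda>y. slope y * (y$1 - y$3))"
    using grd_bdd_supp[of ?v] unfolding iv[symmetric] slope bdd_supp_def by simp
  have pos: "0 \<le> ((x$1)\<^sup>2 - (x$3)\<^sup>2) * newton (\<lambda>y. slope y * D y) x" for x
  proof (rule wedge_positivity[OF p bD slope_nonneg _ _ D1 D2 gravity_nonneg])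
    show "slope (swap13 y) = slope y" "slope (antiswap13 y) = slope y" for y
      by (rule slope_radial, simp)+
    fix x assume "slope x \<noteq> 0"
    then have "x \<in> ball 0 R" "x \<noteq> 0" using slope_zero by (auto simp: slope_def simp del: mem_ball)
    then have x: "x \<in> cball 0 R" "x \<noteq> 0" by auto
    show "gravity x * D x = newton (\<lambda>y. slope y * D y) x + c * ((x$1)\<^sup>2 - (x$3)\<^sup>2)" by (rule eqD[OF x])
    show "gravity x * (x$1 - x$3) = newton (\<lambda>y. slope y * (y$1 - y$3)) x"
      unfolding iv[symmetric] by (rule gravity)
  next
    \<comment> \<open>Otherwise, by continuity, the derivative of \<rho> along e1 - e3 would vanish
      everywhere. Then \<rho> would be constant on a line through the origin, although it is
      positive at 0 and zero at R (e1 - e3).\<close>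
    show "\<not> (AE y in lborel. slope y * (y$1 - y$3) = 0)"
    proof
      assume "AE y in lborel. slope y * (y$1 - y$3) = 0"
      then have "AE y in lborel. grd y \<bullet> ?v = 0" unfolding iv[symmetric] slope by simp
      then have z: "grd y \<bullet> ?v = 0" for y
        by (intro continuous_AE_zero_imp_zero continuous_intros grd_continuous)
      have "((\<lambda>t. \<rho> (t *\<^sub>R ?v)) has_real_derivative 0) (at t)" for t
      proof -
        have "((\<lambda>s. \<rho> (t *\<^sub>R ?v + s *\<^sub>R ?v)) has_real_derivative 0) (at 0)"
          using has_real_derivative_along[OF rho_has_derivative, of "t *\<^sub>R ?v" ?v] unfolding z .
        then show ?thesis
          using DERIV_shift[of "\<lambda>s. \<rho> (s *\<^sub>R ?v)" 0 0 t] by (simp add: scaleR_add_left add.commute)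
      qed
      then have "\<rho> (R *\<^sub>R ?v) = \<rho> (0 *\<^sub>R ?v)" using DERIV_isconst_all by blast
      moreover have "\<rho> (R *\<^sub>R ?v) = 0"
      proof (rule rho_zero)
        have "\<bar>(R *\<^sub>R ?v) $ 1\<bar> \<le> norm (R *\<^sub>R ?v)" by (rule component_le_norm_cart)
        then show "R *\<^sub>R ?v \<notin> ball 0 R" using R_pos by (simp add: axis_def)
      qed
      ultimately show False using rho_pos[of 0] R_pos by simp
    qed
  qed (use c in simp)
  let ?e = "axis 1 R :: real^3"
  have ne: "norm ?e = R" using R_pos by (simp add: norm_eq_sqrt_inner inner_axis_axis)
  have sw: "swap13 ?e = axis 3 R" by (simp add: vec_eq_iff forall_3 axis_def)
  \<comment> \<open>At (R, 0, 0) the factor x1^2 - x3^2 is positive, so the potential term is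
    nonnegative; strictness comes from the inhomogeneity alone.\<close>
  have "0 \<le> R\<^sup>2 * newton (\<lambda>y. slope y * D y) ?e" using pos[of ?e] by (simp add: axis_def)
  then have "0 \<le> newton (\<lambda>y. slope y * D y) ?e" using R_pos by (simp add: zero_le_mult_iff)
  moreover have "0 < c * ((?e$1)\<^sup>2 - (?e$3)\<^sup>2)" using c R_pos by (simp add: axis_def)
  ultimately have "0 < gravity ?e * D ?e"
    using eqD[of ?e] ne R_pos by (auto simp del: mult_pos_pos)
  then have "D ?e > 0" using gravity_nonneg[of ?e] by (simp add: zero_less_mult_iff)
  then show ?thesis using ne R_pos sw by (simp add: D_def)
qed

end

section \<open>Deformations\<close>

text \<open>\<open>Z_lip\<close> is the integrated form of |grad Z| <= k |x|. The bound 1/4 makes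
  the displacement, which is 2k-Lipschitz, a contraction with factor 1/2.\<close>

locale small_deformation =
  fixes Z :: "real^3 \<Rightarrow> real" and k R :: real
  assumes R_pos: "R > 0" and k: "0 \<le> k" "k \<le> 1/4"
    and Z_lip: "\<And>x y. x \<in> cball 0 R \<Longrightarrow> y \<in> cball 0 R \<Longrightarrow> \<bar>Z x - Z y\<bar> \<le> k * max (norm x) (norm y) * norm (x - y)"
    and Z_0: "Z 0 = 0"
begin

lemma Z_le: "x \<in> cball 0 R \<Longrightarrow> \<bar>Z x\<bar> \<le> k * (norm x)\<^sup>2"
  using Z_lip[of x 0] Z_0 R_pos by (simp add: power2_eq_square)

definition shift :: "real^3 \<Rightarrow> real^3" where "shift x = (Z x / (norm x)\<^sup>2) *\<^sub>R x"

text \<open>With i(z) = z / |z|^2 and |y| <= |x|, the difference is (Z x - Z y) i(x) + Z y (i(x) -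
  i(y)). As |i(x) - i(y)| = |x - y| / (|x| |y|) and |Z y| <= k |y|^2, each summand is at most k |x -
  y|.\<close>

lemma shift_lipschitz:
  assumes "x \<in> cball 0 R" "y \<in> cball 0 R"
  shows "norm (shift x - shift y) \<le> 2 * k * norm (x - y)"
proof -
  have wlog: "norm (shift x - shift y) \<le> 2 * k * norm (x - y)"
    if xy: "x \<in> cball 0 R" "y \<in> cball 0 R" "norm y \<le> norm x" for x y
  proof (cases "x = 0 \<or> y = 0")
    case True
    have s: "norm (shift z) \<le> k * norm z" if "z \<in> cball 0 R" for z
      using Z_le[OF that] by (cases "z = 0") (auto simp: shift_def power2_eq_square field_simps)
    have "norm (shift x - shift y) \<le> k * norm (x - y)"
      using True s[OF xy(1)] s[OF xy(2)] by (auto simp: shift_def)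
    also have "\<dots> \<le> 2 * k * norm (x - y)" using k by (intro mult_right_mono) auto
    finally show ?thesis .
  next
    case False
    let ?i = "\<lambda>z::real^3. z /\<^sub>R (norm z)\<^sup>2"
    have "shift x - shift y = (Z x - Z y) *\<^sub>R ?i x + Z y *\<^sub>R (?i x - ?i y)"
      by (simp add: shift_def algebra_simps divide_inverse)
    then have "norm (shift x - shift y) \<le> \<bar>Z x - Z y\<bar> * norm (?i x) + \<bar>Z y\<bar> * norm (?i x - ?i y)"
      by (simp only: order_trans[OF norm_triangle_ineq] norm_scaleR[of "Z x - Z y" "?i x"] norm_scaleR[of "Z y" "?i x - ?i y"] order_refl)
    also have "\<dots> \<le> k * norm (x - y) + k * norm (x - y)"
    proof (rule add_mono)
      have "\<bar>Z x - Z y\<bar> \<le> k * norm x * norm (x - y)" using Z_lip[OF xy(1,2)] xy(3) by (simp add: max_def)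
      then have "\<bar>Z x - Z y\<bar> * norm (?i x) \<le> k * norm x * norm (x - y) * norm (?i x)"
        by (rule mult_right_mono) simp
      also have "\<dots> = k * norm (x - y)" using False by (simp add: power2_eq_square field_simps)
      finally show "\<bar>Z x - Z y\<bar> * norm (?i x) \<le> k * norm (x - y)" .
      have "(norm (?i x - ?i y))\<^sup>2 = (norm (x - y) / (norm x * norm y))\<^sup>2"
      proof -
        have nn: "x \<bullet> x \<noteq> 0" "y \<bullet> y \<noteq> 0" using False by auto
        have "(norm (?i x - ?i y))\<^sup>2 = 1 / (x \<bullet> x) - 2 * (x \<bullet> y) / ((x \<bullet> x) * (y \<bullet> y)) + 1 / (y \<bullet> y)"
          unfolding power2_norm_eq_inner using nn
          by (simp add: inner_diff_left inner_diff_right inner_commute[of y x] field_simps)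
        also have "\<dots> = (x \<bullet> x - 2 * (x \<bullet> y) + y \<bullet> y) / ((x \<bullet> x) * (y \<bullet> y))"
          using nn by (simp add: field_simps)
        also have "x \<bullet> x - 2 * (x \<bullet> y) + y \<bullet> y = (norm (x - y))\<^sup>2"
          unfolding power2_norm_eq_inner by (simp add: inner_diff_left inner_diff_right inner_commute[of y x])
        finally show ?thesis by (simp add: power_divide power_mult_distrib power2_norm_eq_inner)
      qed
      then have ie: "norm (?i x - ?i y) = norm (x - y) / (norm x * norm y)"
        by (rule power2_eq_imp_eq) auto
      have "\<bar>Z y\<bar> * norm (?i x - ?i y) \<le> k * (norm y)\<^sup>2 * (norm (x - y) / (norm x * norm y))"
        unfolding ie by (intro mult_right_mono Z_le xy(2)) auto
      also have "\<dots> = k * norm (x - y) * (norm y / norm x)" using False by (simp add: power2_eq_square)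
      also have "\<dots> \<le> k * norm (x - y) * 1" using k xy(3) False by (intro mult_left_mono) auto
      finally show "\<bar>Z y\<bar> * norm (?i x - ?i y) \<le> k * norm (x - y)" by simp
    qed
    finally show ?thesis by simp
  qed
  show ?thesis
    using wlog[OF assms] wlog[OF assms(2,1)] by (cases "norm y \<le> norm x") (auto simp: norm_minus_commute)
qed

definition proj :: "real^3 \<Rightarrow> real^3" where "proj = closest_point (cball 0 R)"

lemma proj_in: "proj x \<in> cball 0 R"
  unfolding proj_def using R_pos by (intro closest_point_in_set) auto

lemma proj_id: "x \<in> cball 0 R \<Longrightarrow> proj x = x"
  unfolding proj_def by (rule closest_point_self)

lemma proj_lipschitz: "norm (proj x - proj y) \<le> norm (x - y)"
  unfolding proj_def using closest_point_lipschitz[of "cball (0::real^3) R" x y] R_pos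
  by (simp add: dist_norm)

text \<open>The Lipschitz extension of the deformation to the whole space makes it a global
  homeomorphism, and the deformed density a composition with its inverse.\<close>

definition ext :: "real^3 \<Rightarrow> real^3" where "ext x = x + shift (proj x)"

lemma shift_proj_lipschitz: "norm (shift (proj x) - shift (proj y)) \<le> 2 * k * norm (x - y)"
proof -
  have "norm (shift (proj x) - shift (proj y)) \<le> 2 * k * norm (proj x - proj y)"
    by (rule shift_lipschitz) (rule proj_in)+
  also have "\<dots> \<le> 2 * k * norm (x - y)" using k by (intro mult_left_mono proj_lipschitz) auto
  finally show ?thesis .
qed

lemma shift_proj_le: "norm (shift (proj x)) \<le> k * R"
proof -
  have "norm (shift z) \<le> k * norm z" if "z \<in> cball 0 R" for z
    using Z_le[OF that] by (cases "z = 0") (auto simp: shift_def power2_eq_square field_simps)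
  from this[OF proj_in[of x]] have "norm (shift (proj x)) \<le> k * norm (proj x)" .
  also have "\<dots> \<le> k * R" using proj_in[of x] k by (intro mult_left_mono) auto
  finally show ?thesis .
qed

lemma ext_eq_deform: "x \<in> cball 0 R \<Longrightarrow> ext x = deform Z x"
  by (simp add: ext_def proj_id shift_def deform_def algebra_simps del: mem_cball_0)

lemma ext_expansive: "norm (x - y) \<le> 2 * norm (ext x - ext y)"
proof -
  have "norm (x - y) \<le> norm (ext x - ext y) + norm (shift (proj x) - shift (proj y))"
    using norm_triangle_ineq4[of "ext x - ext y" "shift (proj x) - shift (proj y)"] by (simp add: ext_def)
  also have "norm (shift (proj x) - shift (proj y)) \<le> 2 * k * norm (x - y)" by (rule shift_proj_lipschitz)
  also have "\<dots> \<le> 1/2 * norm (x - y)" using k by (intro mult_right_mono) auto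
  finally show ?thesis by simp
qed

lemma inj_ext: "inj ext"
proof (rule injI)
  fix x y assume "ext x = ext y"
  then show "x = y" using ext_expansive[of x y] by simp
qed

text \<open>A preimage of \<open>y\<close> is a fixed point of z -> y - shift (proj z), a
  contraction of the whole space.\<close>

lemma surj_ext: "surj ext"
proof -
  have "\<exists>z. y = ext z" for y
  proof -
  have "\<exists>!z. y - shift (proj z) = z"
  proof (rule banach_fix_type[of "1/2"])
    show "\<forall>x z. dist (y - shift (proj x)) (y - shift (proj z)) \<le> 1/2 * dist x z"
    proof (intro allI)
      fix x z
      have "norm (shift (proj x) - shift (proj z)) \<le> 2 * k * norm (x - z)" by (rule shift_proj_lipschitz)
      also have "\<dots> \<le> 1/2 * norm (x - z)" using k by (intro mult_right_mono) auto
      finally show "dist (y - shift (proj x)) (y - shift (proj z)) \<le> 1/2 * dist x z"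
        by (simp add: dist_norm norm_minus_commute)
    qed
  qed auto
  then obtain z where "y - shift (proj z) = z" by blast
  then have "y = ext z" by (simp add: ext_def algebra_simps)
  then show ?thesis by blast
  qed
  then show ?thesis by (simp add: surj_def)
qed

abbreviation ext_inv :: "real^3 \<Rightarrow> real^3" where "ext_inv \<equiv> inv ext"

lemma ext_ext_inv [simp]: "ext (ext_inv y) = y" and ext_inv_ext [simp]: "ext_inv (ext x) = x"
  by (simp_all add: surj_f_inv_f[OF surj_ext] inv_f_f[OF inj_ext])

lemma ext_inv_displacement: "ext_inv y = y - shift (proj (ext_inv y))"
  using ext_def[of "ext_inv y"] unfolding ext_ext_inv eq_diff_eq by (rule sym)

lemma ext_inv_diff_le: "norm (ext_inv y - y) \<le> k * R"
  using shift_proj_le[of "ext_inv y"] by (subst ext_inv_displacement) simp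

lemma continuous_ext: "continuous_on S ext"
proof -
  have "(2 * k)-lipschitz_on S (\<lambda>x. shift (proj x))"
    using k shift_proj_lipschitz by (intro lipschitz_onI) (auto simp: dist_norm)
  then have "continuous_on S (\<lambda>x. shift (proj x))" by (rule lipschitz_on_continuous_on)
  then show ?thesis unfolding ext_def[abs_def] by (intro continuous_intros)
qed

lemma continuous_ext_inv: "continuous_on S ext_inv"
proof -
  have "2-lipschitz_on S ext_inv"
  proof (rule lipschitz_onI)
    fix x y show "dist (ext_inv x) (ext_inv y) \<le> 2 * dist x y"
      using ext_expansive[of "ext_inv x" "ext_inv y"] by (simp add: dist_norm)
  qed simp
  then show ?thesis by (rule lipschitz_on_continuous_on)
qed

lemma homeomorphic_map_ext: "homeomorphic_map euclidean euclidean ext"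
proof -
  have "homeomorphic_maps euclidean euclidean ext ext_inv"
    unfolding homeomorphic_maps_def using continuous_ext continuous_ext_inv by simp
  then show ?thesis by (simp add: homeomorphic_maps_map)
qed

lemma deform_inv_eq: "x \<in> cball 0 R \<Longrightarrow> deform_inv R Z (deform Z x) = x"
  unfolding deform_inv_def
  by (rule inv_into_f_f) (auto intro!: inj_onI simp: ext_eq_deform[symmetric] inj_eq[OF inj_ext] simp del: mem_cball_0)

end

section \<open>Densities carried by a deformation\<close>

locale deformed_density = radial_density \<rho> R + small_deformation Z k R
  for \<rho> :: "real^3 \<Rightarrow> real" and R :: real and Z :: "real^3 \<Rightarrow> real" and k :: real
begin

definition moved :: "real^3 \<Rightarrow> real" where "moved y = \<rho> (ext_inv y)"

lemma moved_eq: "y \<in> deform Z ` cball 0 R \<Longrightarrow> moved y = \<rho> (deform_inv R Z y)"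
proof (erule imageE)
  fix x assume x: "x \<in> cball 0 R" "y = deform Z x"
  have "ext_inv y = x" using ext_inv_ext[of x] unfolding x(2) ext_eq_deform[OF x(1)] .
  moreover have "deform_inv R Z y = x" unfolding x(2) by (rule deform_inv_eq[OF x(1)])
  ultimately show "moved y = \<rho> (deform_inv R Z y)" by (simp add: moved_def)
qed

lemma moved_nonzero: "moved y \<noteq> 0 \<longleftrightarrow> y \<in> ext ` ball 0 R"
proof -
  have "moved y \<noteq> 0 \<longleftrightarrow> ext_inv y \<in> ball 0 R"
    unfolding moved_def using rho_pos rho_zero by (metis less_irrefl)
  also have "\<dots> \<longleftrightarrow> y \<in> ext ` ball 0 R"
    by (metis ext_ext_inv ext_inv_ext imageE imageI)
  finally show ?thesis .
qed

lemma ext_image: "S \<subseteq> cball 0 R \<Longrightarrow> ext ` S = deform Z ` S"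
  using ext_eq_deform by (intro image_cong) auto

lemma rotating_density_eq: "rotating_density R \<rho> Z y = mass_factor R \<rho> Z * moved y"
proof (cases "y \<in> deform Z ` cball 0 R")
  case False
  then have "y \<notin> ext ` ball 0 R" using ext_image[of "ball 0 R"] ball_subset_cball by blast
  then show ?thesis using False moved_nonzero[of y] by (simp add: rotating_density_def)
qed (simp add: rotating_density_def moved_eq)

text \<open>Closure and frontier commute with the global homeomorphism \<open>ext\<close>, so both
  are computed for round balls. A nonzero mass factor keeps the support from being empty.\<close>

lemma frontier_supp_rotating:
  assumes "mass_factor R \<rho> Z \<noteq> 0"
  shows "frontier (supp (rotating_density R \<rho> Z)) = deform Z ` sphere 0 R"
proof -
  have "{y. rotating_density R \<rho> Z y \<noteq> 0} = ext ` ball 0 R"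
    using assms moved_nonzero by (auto simp: rotating_density_eq)
  then have "supp (rotating_density R \<rho> Z) = closure (ext ` ball 0 R)" by (simp add: supp_def)
  also have "\<dots> = ext ` cball 0 R"
    using homeomorphic_map_closure_of[OF homeomorphic_map_ext, of "ball 0 R"] R_pos by simp
  finally have "frontier (supp (rotating_density R \<rho> Z)) = ext ` frontier (cball 0 R)"
    using homeomorphic_map_frontier_of[OF homeomorphic_map_ext, of "cball 0 R"] by simp
  then show ?thesis using ext_image[of "sphere 0 R"] by simp
qed

lemma moved_borel [measurable]: "moved \<in> borel_measurable borel"
  unfolding moved_def[abs_def]
  by (rule borel_measurable_continuous_onI)
    (intro continuous_on_compose2[OF rho_continuous[of UNIV] continuous_ext_inv] subset_UNIV)

lemma moved_diff_le: "\<bar>moved y - \<rho> y\<bar> \<le> lip * (k * R)"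
  unfolding moved_def
  by (rule order_trans[OF rho_lipschitz mult_left_mono[OF ext_inv_diff_le lip_nonneg]])

lemma moved_zero: assumes "y \<notin> cball 0 (2 * R)" shows "moved y = 0"
proof -
  have "norm y \<le> norm (ext_inv y) + norm (ext_inv y - y)"
    using norm_triangle_ineq4[of "ext_inv y" "ext_inv y - y"] by simp
  moreover have "k * R \<le> R" using k R_pos by (simp add: mult_left_le_one_le)
  ultimately have "norm (ext_inv y) > R" using assms ext_inv_diff_le[of y] by simp
  then show ?thesis unfolding moved_def by (intro rho_zero) auto
qed

lemma moved_bdd_supp: "bdd_supp (2 * R) (lip * R) moved"
  using moved_zero rho_le rho_nonneg by (auto simp: bdd_supp_def moved_def)

lemma moved_diff_bdd_supp: "bdd_supp (2 * R) (lip * (k * R)) (\<lambda>y. moved y - \<rho> y)"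
  unfolding bdd_supp_def
proof (intro conjI allI impI)
  show "(\<lambda>y. moved y - \<rho> y) \<in> borel_measurable borel" by measurable
  show "moved y - \<rho> y = 0" if "y \<notin> cball 0 (2 * R)" for y
    using moved_zero[OF that] rho_zero[of y] that R_pos by simp
qed (rule moved_diff_le)

lemma newton_moved:
  "(LINT y:deform Z ` ball 0 R|lborel. \<rho> (deform_inv R Z y) * (1 / norm (z - y) - 1 / norm y))
    = newton moved z - newton moved 0"
proof -
  have "(LINT y:deform Z ` ball 0 R|lborel. \<rho> (deform_inv R Z y) * (1 / norm (z - y) - 1 / norm y))
     = (LINT y|lborel. moved y / norm (z - y) - moved y / norm (0 - y))"
    unfolding set_lebesgue_integral_def
  proof (rule lint_cong[OF refl])
    fix y
    show "indicator (deform Z ` ball 0 R) y *\<^sub>R (\<rho> (deform_inv R Z y) * (1 / norm (z - y) - 1 / norm y))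
       = moved y / norm (z - y) - moved y / norm (0 - y)"
    proof (cases "y \<in> deform Z ` ball 0 R")
      case True
      then have "y \<in> deform Z ` cball 0 R" using ball_subset_cball by blast
      from moved_eq[OF this] show ?thesis using True by (simp add: right_diff_distrib)
    next
      case False
      then have "moved y = 0" using moved_nonzero[of y] ext_image[of "ball 0 R"] ball_subset_cball by blast
      then show ?thesis using False by simp
    qed
  qed
  also have "\<dots> = newton moved z - newton moved 0"
    unfolding newton_def by (rule lint_diff; rule newton_integrable[OF moved_bdd_supp])
  finally show ?thesis .
qed

end

section \<open>First-order expansion along a sequence of deformations\<close>

lemma difference_quotient_along:
  fixes f :: "real \<Rightarrow> real"
  assumes D: "(f has_real_derivative d) (at 0)" and u: "(\<lambda>n. u n / \<kappa> n) \<longlonglongrightarrow> s" "\<kappa> \<longlonglongrightarrow> 0"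
    and k: "\<And>n. \<kappa> n > (0::real)"
  shows "(\<lambda>n. (f (u n) - f 0) / \<kappa> n) \<longlonglongrightarrow> d * s"
proof -
  \<comment> \<open>Caratheodory's form of the derivative avoids dividing by \<open>u n\<close>,
    which may be 0.\<close>
  obtain g where g: "\<And>z. f z - f 0 = g z * (z - 0)" "isCont g 0" "g 0 = d"
    using D by (auto simp: CARAT_DERIV)
  have "(\<lambda>n. u n / \<kappa> n * \<kappa> n) \<longlonglongrightarrow> s * 0" by (intro tendsto_mult u)
  moreover have "u n / \<kappa> n * \<kappa> n = u n" for n using k[of n] by simp
  ultimately have "u \<longlonglongrightarrow> 0" by simp
  then have "(\<lambda>n. g (u n)) \<longlonglongrightarrow> d" using g(2,3) isCont_tendsto_compose[of 0 g u] by simp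
  then have "(\<lambda>n. g (u n) * (u n / \<kappa> n)) \<longlonglongrightarrow> d * s" by (intro tendsto_mult u)
  then show ?thesis using g(1) by simp
qed

text \<open>\<open>Z_lipschitz\<close> is of order \<open>\<kappa> n\<close>: after division by
  \<open>\<kappa> n\<close> it is uniform in n. It thus passes to the limit \<eta> and furnishes the
  dominating functions below.\<close>

locale deformation_sequence = radial_density \<rho> R for \<rho> :: "real^3 \<Rightarrow> real" and R :: real +
  fixes Z :: "nat \<Rightarrow> real^3 \<Rightarrow> real" and \<kappa> :: "nat \<Rightarrow> real" and C :: real and \<eta> :: "real^3 \<Rightarrow> real"
  assumes kappa_pos: "\<And>n. \<kappa> n > 0" and kappa_lim: "\<kappa> \<longlonglongrightarrow> 0"
    and C: "C \<ge> 0" "\<And>n. C * \<kappa> n \<le> 1/4"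
    and Z_lipschitz: "\<And>n x y. x \<in> cball 0 R \<Longrightarrow> y \<in> cball 0 R \<Longrightarrow>
      \<bar>Z n x - Z n y\<bar> \<le> C * \<kappa> n * max (norm x) (norm y) * norm (x - y)"
    and Z_zero: "\<And>n. Z n 0 = 0"
    and Z_lim: "\<And>x. x \<in> cball 0 R \<Longrightarrow> (\<lambda>n. Z n x / \<kappa> n) \<longlonglongrightarrow> \<eta> x"
begin

sublocale S: deformed_density \<rho> R "Z n" "C * \<kappa> n" for n
proof unfold_locales
  show "0 \<le> C * \<kappa> n" using C(1) kappa_pos[of n] by simp
qed (use C(2) Z_lipschitz Z_zero R_pos in auto)

lemma eta_lipschitz:
  assumes "x \<in> cball 0 R" "y \<in> cball 0 R"
  shows "\<bar>\<eta> x - \<eta> y\<bar> \<le> C * max (norm x) (norm y) * norm (x - y)"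
proof (rule Lim_bounded)
  show "(\<lambda>n. \<bar>Z n x / \<kappa> n - Z n y / \<kappa> n\<bar>) \<longlonglongrightarrow> \<bar>\<eta> x - \<eta> y\<bar>"
    by (intro tendsto_intros Z_lim assms)
  show "\<forall>n\<ge>0. \<bar>Z n x / \<kappa> n - Z n y / \<kappa> n\<bar> \<le> C * max (norm x) (norm y) * norm (x - y)"
  proof (intro allI impI)
    fix n
    have "\<bar>Z n x / \<kappa> n - Z n y / \<kappa> n\<bar> = \<bar>Z n x - Z n y\<bar> / \<kappa> n"
      using kappa_pos[of n] by (simp add: diff_divide_distrib[symmetric])
    also have "\<dots> \<le> C * \<kappa> n * max (norm x) (norm y) * norm (x - y) / \<kappa> n"
      using kappa_pos[of n] by (intro divide_right_mono Z_lipschitz assms) auto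
    also have "\<dots> = C * max (norm x) (norm y) * norm (x - y)" using kappa_pos[of n] by simp
    finally show "\<bar>Z n x / \<kappa> n - Z n y / \<kappa> n\<bar> \<le> C * max (norm x) (norm y) * norm (x - y)" .
  qed
qed

lemma eta_zero: "\<eta> 0 = 0"
  using Z_lim[of 0] R_pos by (simp add: Z_zero LIMSEQ_const_iff)

text \<open>The inverse deformation displaces \<open>y\<close> by minus the shift, evaluated at a
  point that is itself O(\<kappa>) away. To first order this is - \<kappa> \<eta>(y) y / |y|^2
  inside the ball, and the chain rule pairs it with the gradient - slope y times y.\<close>

lemma moved_quotient_tendsto: "(\<lambda>n. (S.moved n y - \<rho> y) / \<kappa> n) \<longlonglongrightarrow> slope y * \<eta> y"
proof -
  define h where "h n = S.ext_inv n y" for n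
  define P where "P = S.proj y"
  have P: "P \<in> cball 0 R" unfolding P_def by (rule S.proj_in)
  define v where "v = (\<eta> P / (norm P)\<^sup>2) *\<^sub>R P"
  have hd: "h n - y = - S.shift n (S.proj (h n))" for n
    using S.ext_inv_displacement[of n y] unfolding h_def by (metis add_diff_cancel_left' diff_add_cancel minus_diff_eq)
  have hn: "norm (h n - y) \<le> C * \<kappa> n * R" for n unfolding h_def by (rule S.ext_inv_diff_le)
  have sv: "(\<lambda>n. (1 / \<kappa> n) *\<^sub>R S.shift n P) \<longlonglongrightarrow> v"
  proof -
    have "(\<lambda>n. (Z n P / \<kappa> n / (norm P)\<^sup>2) *\<^sub>R P) \<longlonglongrightarrow> v"
      unfolding v_def divide_inverse[of _ "(norm P)\<^sup>2"] by (intro tendsto_intros Z_lim P)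
    then show ?thesis by (simp add: S.shift_def)
  qed
  \<comment> \<open>Evaluating the shift at \<open>y\<close> instead of \<open>h n\<close> costs
    O(\<kappa>^2): its Lipschitz constant and the displacement are both O(\<kappa>).\<close>
  have sd: "(\<lambda>n. (1 / \<kappa> n) *\<^sub>R (S.shift n (S.proj (h n)) - S.shift n P)) \<longlonglongrightarrow> 0"
  proof (rule Lim_null_comparison)
    show "(\<lambda>n. 2 * C * (C * \<kappa> n * R)) \<longlonglongrightarrow> 0"
      using tendsto_mult_right_zero[OF tendsto_mult_left_zero[OF tendsto_mult_right_zero[OF kappa_lim]]] by blast
    show "\<forall>\<^sub>F n in sequentially. norm ((1 / \<kappa> n) *\<^sub>R (S.shift n (S.proj (h n)) - S.shift n P)) \<le> 2 * C * (C * \<kappa> n * R)"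
    proof (rule always_eventually, rule allI)
      fix n
      have "norm (S.shift n (S.proj (h n)) - S.shift n P) \<le> 2 * (C * \<kappa> n) * norm (h n - y)"
        unfolding P_def by (rule S.shift_proj_lipschitz)
      also have "\<dots> \<le> 2 * (C * \<kappa> n) * (C * \<kappa> n * R)"
        using C(1) kappa_pos[of n] by (intro mult_left_mono hn) auto
      finally have "norm (S.shift n (S.proj (h n)) - S.shift n P) / \<kappa> n \<le> 2 * (C * \<kappa> n) * (C * \<kappa> n * R) / \<kappa> n"
        using kappa_pos[of n] by (intro divide_right_mono) auto
      then show "norm ((1 / \<kappa> n) *\<^sub>R (S.shift n (S.proj (h n)) - S.shift n P)) \<le> 2 * C * (C * \<kappa> n * R)"
        using kappa_pos[of n] by simp
    qed
  qed
  have "(\<lambda>n. - ((1 / \<kappa> n) *\<^sub>R (S.shift n (S.proj (h n)) - S.shift n P) + (1 / \<kappa> n) *\<^sub>R S.shift n P)) \<longlonglongrightarrow> - (0 + v)"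
    by (intro tendsto_minus tendsto_add sd sv)
  moreover have "- ((1 / \<kappa> n) *\<^sub>R (S.shift n (S.proj (h n)) - S.shift n P) + (1 / \<kappa> n) *\<^sub>R S.shift n P) = (1 / \<kappa> n) *\<^sub>R (h n - y)" for n
    by (simp add: hd scaleR_right_diff_distrib)
  ultimately have hv: "(\<lambda>n. (1 / \<kappa> n) *\<^sub>R (h n - y)) \<longlonglongrightarrow> - v" by simp
  have rem: "(\<lambda>n. (\<rho> (h n) - \<rho> y - grd y \<bullet> (h n - y)) / \<kappa> n) \<longlonglongrightarrow> 0"
  proof (rule LIMSEQ_I)
    fix e :: real assume e: "e > 0"
    define K where "K = C * R + 1"
    define e' where "e' = e / (2 * K)"
    have K: "K > 0" unfolding K_def using C(1) R_pos by (intro add_nonneg_pos) auto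
    have e': "e' > 0" using e K by (simp add: e'_def)
    obtain d where d: "d > 0" "\<And>z. norm (z - y) < d \<Longrightarrow> norm (\<rho> z - \<rho> y - grd y \<bullet> (z - y)) \<le> e' * norm (z - y)"
      using rho_has_derivative[of y, unfolded has_derivative_at_alt] e' by blast
    have "(\<lambda>n. C * \<kappa> n * R) \<longlonglongrightarrow> 0"
      using tendsto_mult_left_zero[OF tendsto_mult_right_zero[OF kappa_lim]] by blast
    then obtain N where N: "\<And>n. n \<ge> N \<Longrightarrow> \<bar>C * \<kappa> n * R\<bar> < d"
      using LIMSEQ_D[of _ 0 d] d(1) by (metis diff_zero real_norm_def)
    have "norm ((\<rho> (h n) - \<rho> y - grd y \<bullet> (h n - y)) / \<kappa> n - 0) < e" if "n \<ge> N" for n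
    proof -
      have "norm (h n - y) < d" using hn[of n] N[OF that] by linarith
      then have "\<bar>\<rho> (h n) - \<rho> y - grd y \<bullet> (h n - y)\<bar> \<le> e' * norm (h n - y)" using d(2) by simp
      also have "\<dots> \<le> e' * (C * \<kappa> n * R)" using e' by (intro mult_left_mono hn) auto
      finally have "\<bar>\<rho> (h n) - \<rho> y - grd y \<bullet> (h n - y)\<bar> / \<kappa> n \<le> e' * (C * \<kappa> n * R) / \<kappa> n"
        using kappa_pos[of n] by (intro divide_right_mono) auto
      also have "\<dots> = e' * (C * R)" using kappa_pos[of n] by simp
      also have "\<dots> \<le> e' * K" using e' by (simp add: K_def)
      also have "\<dots> = e / 2" using K by (simp add: e'_def)
      also have "\<dots> < e" using e by simp
      finally show ?thesis using kappa_pos[of n] by simp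
    qed
    then show "\<exists>N. \<forall>n\<ge>N. norm ((\<rho> (h n) - \<rho> y - grd y \<bullet> (h n - y)) / \<kappa> n - 0) < e" by blast
  qed
  have "(\<lambda>n. (\<rho> (h n) - \<rho> y - grd y \<bullet> (h n - y)) / \<kappa> n + grd y \<bullet> ((1 / \<kappa> n) *\<^sub>R (h n - y))) \<longlonglongrightarrow> 0 + grd y \<bullet> (- v)"
    by (intro tendsto_add rem tendsto_inner tendsto_const hv)
  moreover have "(\<rho> (h n) - \<rho> y - grd y \<bullet> (h n - y)) / \<kappa> n + grd y \<bullet> ((1 / \<kappa> n) *\<^sub>R (h n - y)) = (S.moved n y - \<rho> y) / \<kappa> n" for n
    by (simp add: S.moved_def h_def diff_divide_distrib)
  \<comment> \<open>Outside the open ball \<open>v\<close> belongs to the projected point, but both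
    \<open>grd y\<close> and \<open>slope y\<close> vanish there.\<close>
  moreover have "0 + grd y \<bullet> (- v) = slope y * \<eta> y"
  proof (cases "y \<in> ball 0 R")
    case True
    then have "P = y" unfolding P_def by (intro S.proj_id) auto
    then show ?thesis by (simp add: v_def slope_def)
  next
    case False
    then show ?thesis by (simp add: grd_zero slope_zero)
  qed
  ultimately show ?thesis by simp
qed

lemma newton_moved_tendsto:
  "(\<lambda>n. newton (\<lambda>y. (S.moved n y - \<rho> y) / \<kappa> n) x) \<longlonglongrightarrow> newton (\<lambda>y. slope y * \<eta> y) x"
  unfolding newton_def
proof (rule integral_dominated_convergence)
  show "integrable lborel (\<lambda>y. lip * C * R * (1 / norm (x - y) * indicator (cball 0 (2 * R)) y))"
    by (rule integrable_mult_right[OF inverse_integrable])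
  show "AE y in lborel. (\<lambda>n. (S.moved n y - \<rho> y) / \<kappa> n / norm (x - y)) \<longlonglongrightarrow> slope y * \<eta> y / norm (x - y)"
    unfolding divide_inverse[of _ "norm (x - _)"] by (intro AE_I2 tendsto_mult_right moved_quotient_tendsto)
  have m: "(\<lambda>y. (S.moved n y - \<rho> y) / \<kappa> n) \<in> borel_measurable borel" for n
    by measurable
  then show "(\<lambda>y. (S.moved n y - \<rho> y) / \<kappa> n / norm (x - y)) \<in> borel_measurable lborel" for n
    by measurable
  have [measurable]: "(\<lambda>y. slope y * \<eta> y) \<in> borel_measurable borel"
    by (rule borel_measurable_LIMSEQ_real[OF moved_quotient_tendsto m])
  show "(\<lambda>y. slope y * \<eta> y / norm (x - y)) \<in> borel_measurable lborel" by measurable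
  show "AE y in lborel. norm ((S.moved n y - \<rho> y) / \<kappa> n / norm (x - y))
     \<le> lip * C * R * (1 / norm (x - y) * indicator (cball 0 (2 * R)) y)" for n
  proof (rule AE_I2)
    fix y
    have "\<bar>S.moved n y - \<rho> y\<bar> \<le> lip * (C * \<kappa> n * R) * indicator (cball 0 (2 * R)) y"
      by (rule bdd_suppD(5)[OF S.moved_diff_bdd_supp])
    then have "\<bar>S.moved n y - \<rho> y\<bar> / \<kappa> n / norm (x - y) \<le> lip * (C * \<kappa> n * R) * indicator (cball 0 (2 * R)) y / \<kappa> n / norm (x - y)"
      using kappa_pos[of n] by (intro divide_right_mono) auto
    then show "norm ((S.moved n y - \<rho> y) / \<kappa> n / norm (x - y))
      \<le> lip * C * R * (1 / norm (x - y) * indicator (cball 0 (2 * R)) y)"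
      using kappa_pos[of n] by (simp add: abs_mult)
  qed
qed

text \<open>Two effects add up: moving the evaluation point in the unperturbed potential gives -
  gravity x * \<eta> x, and changing the density at fixed \<open>x\<close> gives the potential term.
  Their interaction vanishes in the limit, since the quotients \<open>?q n\<close> are uniformly
  bounded and their potentials uniformly Lipschitz.\<close>

lemma deform_quotient_tendsto:
  assumes x: "x \<in> cball 0 R"
  shows "(\<lambda>n. (newton (S.moved n) (deform (Z n) x) - newton \<rho> x) / \<kappa> n)
    \<longlonglongrightarrow> newton (\<lambda>y. slope y * \<eta> y) x - gravity x * \<eta> x"
proof -
  define u where "u n = Z n x / (norm x)\<^sup>2" for n
  have g: "deform (Z n) x = x + u n *\<^sub>R x" for n by (simp add: deform_def u_def algebra_simps)
  have ul: "(\<lambda>n. u n / \<kappa> n) \<longlonglongrightarrow> \<eta> x / (norm x)\<^sup>2"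
  proof -
    have "(\<lambda>n. Z n x / \<kappa> n / (norm x)\<^sup>2) \<longlonglongrightarrow> \<eta> x / (norm x)\<^sup>2"
      unfolding divide_inverse[of _ "(norm x)\<^sup>2"] by (intro tendsto_intros Z_lim x)
    then show ?thesis by (simp add: u_def mult.commute)
  qed
  have T1: "(\<lambda>n. (newton \<rho> (x + u n *\<^sub>R x) - newton \<rho> x) / \<kappa> n) \<longlonglongrightarrow> - (gravity x * \<eta> x)"
  proof -
    have "(\<lambda>n. (newton \<rho> (x + u n *\<^sub>R x) - newton \<rho> (x + 0 *\<^sub>R x)) / \<kappa> n)
       \<longlonglongrightarrow> newton (\<lambda>y. grd y \<bullet> x) x * (\<eta> x / (norm x)\<^sup>2)"
      by (rule difference_quotient_along[OF newton_rho_derivative ul kappa_lim kappa_pos])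
    then show ?thesis by (simp add: gravity_def)
  qed
  let ?q = "\<lambda>n y. (S.moved n y - \<rho> y) / \<kappa> n"
  have bq: "bdd_supp (2 * R) (lip * C * R) (?q n)" for n
    unfolding bdd_supp_def
  proof (intro conjI allI impI)
    show "?q n \<in> borel_measurable borel" by measurable
    show "\<bar>?q n y\<bar> \<le> lip * C * R" for y
    proof -
      have "\<bar>S.moved n y - \<rho> y\<bar> / \<kappa> n \<le> lip * (C * \<kappa> n * R) / \<kappa> n"
        using kappa_pos[of n] by (intro divide_right_mono S.moved_diff_le) auto
      then show ?thesis using kappa_pos[of n] by simp
    qed
    show "?q n y = 0" if "y \<notin> cball 0 (2 * R)" for y
      using bdd_suppD(3)[OF S.moved_diff_bdd_supp that] by simp
  qed
  have nq: "newton (?q n) z = (newton (S.moved n) z - newton \<rho> z) / \<kappa> n" for n z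
  proof -
    have "newton (?q n) z = (LINT y|lborel. (S.moved n y / norm (z - y) - \<rho> y / norm (z - y)) / \<kappa> n)"
      unfolding newton_def by (simp add: diff_divide_distrib mult.commute)
    also have "\<dots> = (LINT y|lborel. S.moved n y / norm (z - y) - \<rho> y / norm (z - y)) / \<kappa> n" by simp
    also have "\<dots> = (newton (S.moved n) z - newton \<rho> z) / \<kappa> n"
      unfolding newton_def
      by (subst lint_diff[OF newton_integrable[OF S.moved_bdd_supp] newton_integrable[OF rho_bdd_supp]]) simp
    finally show ?thesis .
  qed
  have "(\<lambda>n. newton (?q n) (x + u n *\<^sub>R x) - newton (?q n) x) \<longlonglongrightarrow> 0"
  proof (rule Lim_null_comparison)
    have "u \<longlonglongrightarrow> 0"
    proof -
      have "(\<lambda>n. u n / \<kappa> n * \<kappa> n) \<longlonglongrightarrow> \<eta> x / (norm x)\<^sup>2 * 0" by (intro tendsto_mult ul kappa_lim)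
      moreover have "u n / \<kappa> n * \<kappa> n = u n" for n using kappa_pos[of n] by simp
      ultimately show ?thesis by simp
    qed
    then have "(\<lambda>n. 2 * (lip * C * R) * kernel_const (2 * R) * norm (x + u n *\<^sub>R x - x)) \<longlonglongrightarrow> 2 * (lip * C * R) * kernel_const (2 * R) * norm (x + 0 *\<^sub>R x - x)"
      by (intro tendsto_intros)
    then show "(\<lambda>n. 2 * (lip * C * R) * kernel_const (2 * R) * norm (x + u n *\<^sub>R x - x)) \<longlonglongrightarrow> 0" by simp
    show "\<forall>\<^sub>F n in sequentially. norm (newton (?q n) (x + u n *\<^sub>R x) - newton (?q n) x)
       \<le> 2 * (lip * C * R) * kernel_const (2 * R) * norm (x + u n *\<^sub>R x - x)"
      unfolding real_norm_def by (intro always_eventually allI newton_lipschitz[OF bq])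
  qed
  then have "(\<lambda>n. (newton \<rho> (x + u n *\<^sub>R x) - newton \<rho> x) / \<kappa> n + newton (?q n) x + (newton (?q n) (x + u n *\<^sub>R x) - newton (?q n) x))
     \<longlonglongrightarrow> - (gravity x * \<eta> x) + newton (\<lambda>y. slope y * \<eta> y) x + 0"
    by (intro tendsto_add T1 newton_moved_tendsto)
  moreover have "(newton \<rho> (x + u n *\<^sub>R x) - newton \<rho> x) / \<kappa> n + newton (?q n) x + (newton (?q n) (x + u n *\<^sub>R x) - newton (?q n) x)
     = (newton (S.moved n) (deform (Z n) x) - newton \<rho> x) / \<kappa> n" for n
    unfolding nq g by (simp add: diff_divide_distrib)
  ultimately show ?thesis by simp
qed

end

section \<open>The space X\<close>

text \<open>At boundary points derivatives within the ball are compared along segments into it,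
  which settles the directions y - x with y in the ball. Taking y = 0 yields the value at
  \<open>x\<close>, and y = c v then yields the value at any \<open>v\<close>.\<close>

lemma has_derivative_cball_unique:
  fixes f :: "real^3 \<Rightarrow> real"
  assumes R: "R > 0" and x: "x \<in> cball 0 R"
    and f: "(f has_derivative f') (at x within cball 0 R)" "(f has_derivative f'') (at x within cball 0 R)"
  shows "f' = f''"
proof -
  have lin: "linear f'" "linear f''" using f has_derivative_linear by blast+
  have eq: "f' (y - x) = f'' (y - x)" if y: "y \<in> cball 0 R" for y
  proof -
    let ?p = "\<lambda>t::real. x + t *\<^sub>R (y - x)"
    have sub: "?p ` {0..1} \<subseteq> cball 0 R"
    proof (rule image_subsetI)
      fix t :: real assume t: "t \<in> {0..1}"
      have "?p t = (1 - t) *\<^sub>R x + t *\<^sub>R y" by (simp add: algebra_simps)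
      then show "?p t \<in> cball 0 R" using convexD[OF convex_cball x y, of "1 - t" t] t by simp
    qed
    have p: "(?p has_derivative (\<lambda>t. t *\<^sub>R (y - x))) (at 0 within {0..1})"
      by (auto intro!: derivative_eq_intros)
    have "((\<lambda>t. f (?p t)) has_real_derivative g (y - x)) (at 0 within {0..1})"
      if g: "(f has_derivative g) (at x within cball 0 R)" for g
    proof -
      have "(f has_derivative g) (at (?p 0) within ?p ` {0..1})"
        using has_derivative_subset[OF g sub] by simp
      from has_derivative_in_compose[OF p this]
      show ?thesis
        using linear_cmul[OF has_derivative_linear[OF g]]
        by (simp add: has_field_derivative_def mult_commute_abs)
    qed
    from this[OF f(1)] this[OF f(2)] show ?thesis
      by (rule has_field_derivative_unique) (simp add: trivial_limit_within islimpt_Icc)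
  qed
  have fx: "f' x = f'' x"
    using eq[of 0] R linear_neg[OF lin(1), of x] linear_neg[OF lin(2), of x] by simp
  have "f' v = f'' v" for v
  proof (cases "v = 0")
    case False
    define c where "c = R / norm v"
    have c: "c > 0" using R False by (simp add: c_def)
    have "c *\<^sub>R v \<in> cball 0 R" using R False by (simp add: c_def)
    from eq[OF this] have "c * f' v = c * f'' v"
      using fx by (simp add: linear_diff[OF lin(1)] linear_diff[OF lin(2)] linear_cmul[OF lin(1)] linear_cmul[OF lin(2)])
    then show ?thesis using c by simp
  qed (simp add: linear_0[OF lin(1)] linear_0[OF lin(2)])
  then show ?thesis by blast
qed

lemma grad_on_unique:
  assumes R: "R > 0" and x: "x \<in> cball 0 R"
    and f: "(f has_derivative (\<lambda>v. w \<bullet> v)) (at x within cball 0 R)"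
  shows "grad_on (cball 0 R) f x = w"
proof -
  have "f differentiable (at x within cball 0 R)" using f by (rule differentiableI)
  from has_derivative_cball_unique[OF R x has_derivative_grad_on[OF this] f]
  have "grad_on (cball 0 R) f x \<bullet> v = w \<bullet> v" for v by (rule fun_cong)
  then show ?thesis by (metis vector_eq_rdot inner_commute)
qed

lemma C1_on_grad:
  assumes "C1_on S f" "x \<in> S"
  shows "(f has_derivative (\<lambda>v. grad_on S f x \<bullet> v)) (at x within S)"
  using assms has_derivative_grad_on by (auto simp: C1_on_def differentiable_on_def)

lemma C1_on_lincomb:
  assumes R: "R > 0" and f: "C1_on (cball 0 R) f" and g: "C1_on (cball 0 R) g" and h: "C1_on (cball 0 R) h"
  shows "C1_on (cball 0 R) (\<lambda>x. (f x - g x) / t - h x)"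
    and "x \<in> cball 0 R \<Longrightarrow> grad_on (cball 0 R) (\<lambda>x. (f x - g x) / t - h x) x
      = (1 / t) *\<^sub>R (grad_on (cball 0 R) f x - grad_on (cball 0 R) g x) - grad_on (cball 0 R) h x"
proof -
  let ?B = "cball (0::real^3) R"
  let ?w = "\<lambda>x. (1 / t) *\<^sub>R (grad_on ?B f x - grad_on ?B g x) - grad_on ?B h x"
  have d: "((\<lambda>x. (f x - g x) / t - h x) has_derivative (\<lambda>v. ?w x \<bullet> v)) (at x within ?B)" if x: "x \<in> ?B" for x
  proof -
    have "((\<lambda>x. (1 / t) * (f x - g x) - h x) has_derivative
        (\<lambda>v. (1 / t) * (grad_on ?B f x \<bullet> v - grad_on ?B g x \<bullet> v) - grad_on ?B h x \<bullet> v)) (at x within ?B)"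
      by (intro has_derivative_diff has_derivative_mult_right C1_on_grad f g h x)
    then show ?thesis by (simp add: inner_diff_left)
  qed
  show gr: "grad_on ?B (\<lambda>x. (f x - g x) / t - h x) x = ?w x" if "x \<in> ?B" for x
    by (rule grad_on_unique[OF R that d[OF that]])
  have "continuous_on ?B ?w" using f g h by (intro continuous_intros) (auto simp: C1_on_def)
  then have "continuous_on ?B (grad_on ?B (\<lambda>x. (f x - g x) / t - h x))"
    using gr by (subst continuous_on_cong[OF refl]) auto
  moreover have "(\<lambda>x. (f x - g x) / t - h x) differentiable_on ?B"
    using d unfolding differentiable_on_def differentiable_def by blast
  ultimately show "C1_on ?B (\<lambda>x. (f x - g x) / t - h x)" by (simp add: C1_on_def)
qed

text \<open>The mean value inequality on the ball of radius max |x| |y| instead of the full ball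
  produces the weight. The hypothesis says nothing at the origin, where the gradient vanishes by
  continuity.\<close>

lemma C1_on_gradient_bound_lipschitz:
  assumes R: "R > 0" and f: "C1_on (cball 0 R) f"
    and K: "\<And>x. x \<in> cball 0 R \<Longrightarrow> x \<noteq> 0 \<Longrightarrow> norm (grad_on (cball 0 R) f x) \<le> K * norm x"
    and K0: "K \<ge> 0" and x: "x \<in> cball 0 R" and y: "y \<in> cball 0 R"
  shows "\<bar>f x - f y\<bar> \<le> K * max (norm x) (norm y) * norm (x - y)"
proof -
  let ?B = "cball (0::real^3) R"
  have w: "at (0::real^3) within ?B = at 0" using R by (intro at_within_interior) (simp add: interior_cball)
  have "(grad_on ?B f \<longlongrightarrow> grad_on ?B f 0) (at 0 within ?B)"
    using f R by (auto simp: C1_on_def continuous_on_def)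
  moreover have "(grad_on ?B f \<longlongrightarrow> 0) (at 0 within ?B)"
  proof (rule Lim_null_comparison)
    show "\<forall>\<^sub>F x in at 0 within ?B. norm (grad_on ?B f x) \<le> K * norm x"
      using K by (auto simp: eventually_at_filter)
    have "((\<lambda>x::real^3. K * norm x) \<longlongrightarrow> K * norm (0::real^3)) (at 0 within ?B)" by (intro tendsto_intros)
    then show "((\<lambda>x::real^3. K * norm x) \<longlongrightarrow> 0) (at 0 within ?B)" by simp
  qed
  ultimately have g0: "grad_on ?B f 0 = 0"
    using tendsto_unique[of "at (0::real^3) within ?B"] w by (metis at_neq_bot)
  define r where "r = max (norm x) (norm y)"
  have r: "r \<le> R" "0 \<le> r" using x y by (auto simp: r_def max_def)
  have sub: "cball 0 r \<subseteq> ?B" using r by (intro cball_subset_cball_iff[THEN iffD2]) auto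
  have "norm (f x - f y) \<le> (K * r) * norm (x - y)"
  proof (rule differentiable_bound[of "cball 0 r" f "\<lambda>z v. grad_on ?B f z \<bullet> v"])
    fix z :: "real^3" assume z: "z \<in> cball 0 r"
    then have zB: "z \<in> ?B" using sub by blast
    show "(f has_derivative (\<lambda>v. grad_on ?B f z \<bullet> v)) (at z within cball 0 r)"
      by (rule has_derivative_subset[OF C1_on_grad[OF f zB] sub])
    have "norm (grad_on ?B f z) \<le> K * r"
    proof (cases "z = 0")
      case False
      have "norm (grad_on ?B f z) \<le> K * norm z" by (rule K[OF zB False])
      also have "\<dots> \<le> K * r" using z K0 by (intro mult_left_mono) auto
      finally show ?thesis .
    qed (use g0 K0 r in simp)
    then show "onorm (\<lambda>v. grad_on ?B f z \<bullet> v) \<le> K * r"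
      using K0 r by (intro onorm_bound) (auto intro: order_trans[OF Cauchy_Schwarz_ineq2 mult_right_mono])
  qed (auto simp: r_def)
  then show ?thesis by (simp add: r_def)
qed

lemma X_norm_ge:
  assumes "bdd_above ((\<lambda>x. norm (grad_on (cball 0 R) f x) / norm x) ` (cball 0 R - {0}))"
    and "x \<in> cball 0 R" "x \<noteq> 0"
  shows "norm (grad_on (cball 0 R) f x) \<le> X_norm R f * norm x"
proof -
  have "norm (grad_on (cball 0 R) f x) / norm x \<le> X_norm R f"
    unfolding X_norm_def using assms by (intro cSUP_upper) auto
  then show ?thesis using assms(3) by (simp add: divide_le_eq)
qed

lemma X_space_gradient_bound:
  assumes "f \<in> X_space R"
  obtains K where "K \<ge> 0" "\<And>x. x \<in> cball 0 R \<Longrightarrow> x \<noteq> 0 \<Longrightarrow> norm (grad_on (cball 0 R) f x) \<le> K * norm x"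
proof
  show "max 0 (X_norm R f) \<ge> 0" by simp
  fix x :: "real^3" assume x: "x \<in> cball 0 R" "x \<noteq> 0"
  have "norm (grad_on (cball 0 R) f x) \<le> X_norm R f * norm x"
    using assms x by (intro X_norm_ge) (auto simp: X_space_def)
  also have "\<dots> \<le> max 0 (X_norm R f) * norm x" by (intro mult_right_mono) auto
  finally show "norm (grad_on (cball 0 R) f x) \<le> max 0 (X_norm R f) * norm x" .
qed

text \<open>Translates differentiability in the norm of \<open>X\<close> into what the limit
  argument uses: the difference quotient minus \<eta> is the remainder \<open>h\<close>, whose
  gradient is bounded by \<open>X_norm R (h t)\<close> times |x|, hence so are its values by that
  times |x|^2.\<close>

lemma X_C1_curve_expansion:
  assumes R: "R > 0" and "\<epsilon> > 0" and curve: "X_C1_curve R \<epsilon> \<zeta>"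
    and zero: "\<And>x. x \<in> cball 0 R \<Longrightarrow> \<zeta> 0 x = 0"
  obtains \<delta> C \<eta> where "\<delta> > 0" "\<delta> \<le> \<epsilon>" "C \<ge> 0"
    "\<And>\<kappa> x y. 0 < \<kappa> \<Longrightarrow> \<kappa> < \<delta> \<Longrightarrow> x \<in> cball 0 R \<Longrightarrow> y \<in> cball 0 R \<Longrightarrow>
      \<bar>\<zeta> \<kappa> x - \<zeta> \<kappa> y\<bar> \<le> C * \<kappa> * max (norm x) (norm y) * norm (x - y)"
    "\<And>x. x \<in> cball 0 R \<Longrightarrow> ((\<lambda>\<kappa>. \<zeta> \<kappa> x / \<kappa>) \<longlongrightarrow> \<eta> x) (at_right 0)"
proof -
  let ?B = "cball (0::real^3) R"
  have X: "\<zeta> \<kappa> \<in> X_space R" if "\<kappa> \<in> {-\<epsilon><..<\<epsilon>}" for \<kappa> using curve that by (simp add: X_C1_curve_def)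
  obtain \<eta> where eta: "\<eta> \<in> X_space R"
    and lim: "((\<lambda>t. X_norm R (\<lambda>x. (\<zeta> (0 + t) x - \<zeta> 0 x) / t - \<eta> x)) \<longlongrightarrow> 0) (at 0)"
  proof -
    obtain \<zeta>' where "\<forall>\<kappa>\<in>{-\<epsilon><..<\<epsilon>}. \<zeta>' \<kappa> \<in> X_space R \<and>
        ((\<lambda>t. X_norm R (\<lambda>x. (\<zeta> (\<kappa> + t) x - \<zeta> \<kappa> x) / t - \<zeta>' \<kappa> x)) \<longlongrightarrow> 0) (at 0) \<and>
        ((\<lambda>\<mu>. X_norm R (\<lambda>x. \<zeta>' \<mu> x - \<zeta>' \<kappa> x)) \<longlongrightarrow> 0) (at \<kappa>)"
      using curve unfolding X_C1_curve_def by (elim conjE exE)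
    from bspec[OF this, of 0] \<open>\<epsilon> > 0\<close> show ?thesis by (intro that[of "\<zeta>' 0"]) simp_all
  qed
  define h where "h t x = (\<zeta> t x - \<zeta> 0 x) / t - \<eta> x" for t x
  have lim0: "((\<lambda>t. X_norm R (h t)) \<longlongrightarrow> 0) (at 0)" using lim by (simp add: h_def[abs_def])
  have C1: "C1_on ?B f" if "f \<in> X_space R" for f using that by (simp add: X_space_def)
  have z0: "\<zeta> 0 \<in> X_space R" using X[of 0] \<open>\<epsilon> > 0\<close> by simp
  have gz: "grad_on ?B (\<zeta> 0) x = 0" if "x \<in> ?B" for x
  proof (rule grad_on_unique[OF R that])
    have "((\<lambda>_. 0) has_derivative (\<lambda>v. 0 \<bullet> v)) (at x within ?B)" by simp
    then show "(\<zeta> 0 has_derivative (\<lambda>v. 0 \<bullet> v)) (at x within ?B)"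
      by (rule has_derivative_transform[OF that, rotated]) (simp add: zero)
  qed
  obtain K where K: "K \<ge> 0" "\<And>x. x \<in> ?B \<Longrightarrow> x \<noteq> 0 \<Longrightarrow> norm (grad_on ?B \<eta> x) \<le> K * norm x"
    by (rule X_space_gradient_bound[OF eta]) blast
  have hC1: "C1_on ?B (h t)" and hg: "\<And>x. x \<in> ?B \<Longrightarrow> grad_on ?B (h t) x = (1 / t) *\<^sub>R grad_on ?B (\<zeta> t) x - grad_on ?B \<eta> x"
    if "t \<in> {-\<epsilon><..<\<epsilon>}" for t
    using C1_on_lincomb[OF R C1[OF X[OF that]] C1[OF z0] C1[OF eta], where t = t] gz
    unfolding h_def[abs_def] by simp_all
  have hX: "norm (grad_on ?B (h t) x) \<le> X_norm R (h t) * norm x"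
    if t: "t \<in> {-\<epsilon><..<\<epsilon>}" and x: "x \<in> ?B" "x \<noteq> 0" for t x
  proof (rule X_norm_ge[OF _ x])
    obtain K' where K': "\<And>x. x \<in> ?B \<Longrightarrow> x \<noteq> 0 \<Longrightarrow> norm (grad_on ?B (\<zeta> t) x) \<le> K' * norm x"
      by (rule X_space_gradient_bound[OF X[OF t]]) blast
    \<comment> \<open>The supremum defining \<open>X_norm\<close> bounds its members only for a set
      that is bounded above, so this is checked for the remainder first.\<close>
    show "bdd_above ((\<lambda>x. norm (grad_on ?B (h t) x) / norm x) ` (?B - {0}))"
    proof (rule bdd_aboveI2)
      fix x assume "x \<in> ?B - {0}"
      then have x: "x \<in> ?B" "x \<noteq> 0" by auto
      have "norm (grad_on ?B (h t) x) \<le> norm ((1 / t) *\<^sub>R grad_on ?B (\<zeta> t) x) + norm (grad_on ?B \<eta> x)"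
        unfolding hg[OF t x(1)] by (rule norm_triangle_ineq4)
      also have "\<dots> \<le> \<bar>1 / t\<bar> * (K' * norm x) + K * norm x"
        unfolding norm_scaleR using K'[OF x] K(2)[OF x] by (intro add_mono mult_left_mono) auto
      also have "\<dots> = (\<bar>1 / t\<bar> * K' + K) * norm x" by (simp add: distrib_right)
      finally show "norm (grad_on ?B (h t) x) / norm x \<le> \<bar>1 / t\<bar> * K' + K"
        using x(2) by (simp add: divide_le_eq)
    qed
  qed
  have hN: "X_norm R (h t) \<ge> 0" if t: "t \<in> {-\<epsilon><..<\<epsilon>}" for t
  proof -
    let ?e = "axis 1 R :: real^3"
    have e: "norm ?e = R" using R by (simp add: norm_eq_sqrt_inner inner_axis_axis)
    then have "0 \<le> X_norm R (h t) * norm ?e" using R by (intro order_trans[OF norm_ge_zero hX[OF t]]) auto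
    then show ?thesis using e R by (simp add: zero_le_mult_iff)
  qed
  have ev: "\<forall>\<^sub>F t in at 0. X_norm R (h t) < 1" using lim0 by (rule order_tendstoD) simp
  then obtain d where d: "d > 0" "\<And>t. t \<noteq> 0 \<Longrightarrow> \<bar>t\<bar> < d \<Longrightarrow> X_norm R (h t) < 1"
    unfolding eventually_at by (auto simp: dist_real_def)
  show ?thesis
  \<comment> \<open>The 1 in \<open>1 + K\<close> bounds the remainder, whose norm is below 1 for
    |t| < d, and \<open>K\<close> bounds the gradient of \<eta>.\<close>
  proof (rule that[of "min d \<epsilon>" "1 + K" \<eta>])
    show "min d \<epsilon> > 0" using d(1) \<open>\<epsilon> > 0\<close> by simp
    show "1 + K \<ge> 0" using K(1) by simp
    fix x assume x: "x \<in> ?B"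
    show "((\<lambda>\<kappa>. \<zeta> \<kappa> x / \<kappa>) \<longlongrightarrow> \<eta> x) (at_right 0)"
    proof -
      have "((\<lambda>t. h t x) \<longlongrightarrow> 0) (at 0)"
      proof (rule Lim_null_comparison)
        have "((\<lambda>t. X_norm R (h t) * (norm x * norm x)) \<longlongrightarrow> 0 * (norm x * norm x)) (at 0)"
          by (intro tendsto_mult lim0 tendsto_const)
        then show "((\<lambda>t. X_norm R (h t) * (norm x * norm x)) \<longlongrightarrow> 0) (at 0)" by simp
        have "\<forall>\<^sub>F t in at 0. t \<in> {-\<epsilon><..<\<epsilon>}"
          using \<open>\<epsilon> > 0\<close> by (intro eventually_at_in_open' ) auto
        then show "\<forall>\<^sub>F t in at 0. norm (h t x) \<le> X_norm R (h t) * (norm x * norm x)"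
        proof eventually_elim
          case (elim t)
          have "h t 0 = 0" using eta z0 X[OF elim] by (simp add: h_def X_space_def)
          then show ?case
            using C1_on_gradient_bound_lipschitz[OF R hC1[OF elim] hX[OF elim] hN[OF elim] x, of 0] R
            by (simp add: mult.assoc)
        qed
      qed
      then have "((\<lambda>t. h t x) \<longlongrightarrow> 0) (at_right 0)" by (rule filterlim_mono) (auto intro: at_le)
      then have "((\<lambda>t. h t x + \<eta> x) \<longlongrightarrow> 0 + \<eta> x) (at_right 0)" by (intro tendsto_intros)
      then show ?thesis using zero[OF x] by (simp add: h_def)
    qed
    fix \<kappa> y assume k: "0 < \<kappa>" "\<kappa> < min d \<epsilon>" and y: "y \<in> ?B"
    have kI: "\<kappa> \<in> {-\<epsilon><..<\<epsilon>}" using k \<open>\<epsilon> > 0\<close> by auto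
    show "\<bar>\<zeta> \<kappa> x - \<zeta> \<kappa> y\<bar> \<le> (1 + K) * \<kappa> * max (norm x) (norm y) * norm (x - y)"
    proof (rule C1_on_gradient_bound_lipschitz[OF R C1[OF X[OF kI]] _ _ x y])
      show "0 \<le> (1 + K) * \<kappa>" using K(1) k by simp
      fix z assume z: "z \<in> ?B" "z \<noteq> 0"
      have "grad_on ?B (\<zeta> \<kappa>) z = \<kappa> *\<^sub>R (grad_on ?B (h \<kappa>) z + grad_on ?B \<eta> z)"
        using hg[OF kI z(1)] k by simp
      then have "norm (grad_on ?B (\<zeta> \<kappa>) z) \<le> \<kappa> * (norm (grad_on ?B (h \<kappa>) z) + norm (grad_on ?B \<eta> z))"
        using k by (simp add: norm_triangle_ineq)
      also have "\<dots> \<le> \<kappa> * (1 * norm z + K * norm z)"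
      proof (intro mult_left_mono add_mono K(2)[OF z])
        have "norm (grad_on ?B (h \<kappa>) z) \<le> X_norm R (h \<kappa>) * norm z" by (rule hX[OF kI z])
        also have "\<dots> \<le> 1 * norm z" using d(2)[of \<kappa>] k by (intro mult_right_mono) auto
        finally show "norm (grad_on ?B (h \<kappa>) z) \<le> 1 * norm z" .
      qed (use k in auto)
      also have "\<dots> = (1 + K) * \<kappa> * norm z" by (simp add: algebra_simps)
      finally show "norm (grad_on ?B (\<zeta> \<kappa>) z) \<le> (1 + K) * \<kappa> * norm z" .
    qed
  qed simp
qed

section \<open>The linearized equation\<close>

lemma enthalpy_strict_mono:
  assumes p: "admissible_pressure p \<gamma> \<gamma>s" and ab: "0 \<le> a" "a < b"
  shows "enthalpy p a < enthalpy p b"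
proof -
  define f where "f \<alpha> = deriv p \<alpha> / \<alpha>" for \<alpha>
  have f_pos: "f \<alpha> > 0" if "\<alpha> > 0" for \<alpha> using p that by (simp add: f_def admissible_pressure_def)
  have f_nonneg: "f \<alpha> \<ge> 0" if "\<alpha> \<ge> 0" for \<alpha>
    using f_pos[of \<alpha>] that by (cases "\<alpha> = 0") (auto simp: f_def)
  have I: "integrable lborel (\<lambda>x. indicator {0..b} x * f x)"
    using p ab by (simp add: admissible_pressure_def set_integrable_def f_def)
  have Ia: "integrable lborel (\<lambda>x. indicator {0..a} x * f x)"
  \<comment> \<open>Admissibility grants integrability only up to positive endpoints; at a = 0 the
    integrand is 0 because division by zero gives 0.\<close>
  proof (cases "a = 0")
    case True
    then have "(\<lambda>x. indicator {0..a} x * f x) = (\<lambda>x. 0)" by (auto simp: f_def indicator_def)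
    then show ?thesis by (simp only: integrable_zero)
  qed (use p ab in \<open>simp add: admissible_pressure_def set_integrable_def f_def\<close>)
  let ?g = "\<lambda>x. indicator {a<..b} x * f x"
  have g: "?g x = indicator {0..b} x * f x - indicator {0..a} x * f x" for x
    using ab by (auto simp: indicator_def)
  have Ig: "integrable lborel ?g" unfolding g by (intro lintegrable_diff I Ia)
  have "enthalpy p b - enthalpy p a = (LINT x|lborel. ?g x)"
    unfolding g by (simp add: enthalpy_def set_lebesgue_integral_def f_def[symmetric] lint_diff I Ia)
  moreover have "(LINT x|lborel. ?g x) \<ge> 0"
    using f_nonneg ab by (intro integral_nonneg_AE AE_I2) (auto simp: indicator_def)
  moreover have "(LINT x|lborel. ?g x) \<noteq> 0"
  proof
    assume "(LINT x|lborel. ?g x) = 0"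
    moreover have "AE x in lborel. 0 \<le> ?g x" using f_nonneg ab by (intro AE_I2) (auto simp: indicator_def)
    ultimately have "AE x in lborel. ?g x = 0" using integral_nonneg_eq_0_iff_AE[OF Ig] by simp
    then have "AE x in lborel. x \<notin> {a<..b}"
    proof eventually_elim
      case (elim x)
      then show ?case using f_pos[of x] ab by (auto simp: indicator_def split: if_splits)
    qed
    then have "emeasure lborel {a<..b} = 0"
      using AE_iff_null_sets[of "{a<..b}" lborel] by auto
    then show False using ab by simp
  qed
  ultimately show ?thesis by linarith
qed

lemma (in radial_density) antimono_of_hydrostatic_balance:
  assumes h: "\<And>s t. 0 \<le> s \<Longrightarrow> s < t \<Longrightarrow> h s < (h t :: real)"
    and bal: "\<And>x. x \<in> ball 0 R \<Longrightarrow> newton \<rho> x = h (\<rho> x) + c"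
    and xy: "norm x < norm y"
  shows "\<rho> y \<le> \<rho> x"
proof (cases "y \<in> ball 0 R")
  case True
  then have x: "x \<in> ball 0 R" using xy by auto
  have "newton \<rho> y \<le> newton \<rho> x"
    by (rule newton_radially_antimono[OF rho_bdd_supp _ rho_nonneg rho_integral_pos xy]) (rule radial)
  then have "h (\<rho> y) \<le> h (\<rho> x)" using bal[OF True] bal[OF x] by simp
  then show ?thesis using h[of "\<rho> x" "\<rho> y"] rho_nonneg[of x] by fastforce
qed (simp add: rho_zero rho_nonneg)

section \<open>The Jacobian and the limit of the mass factor\<close>

lemma det_near_one:
  fixes e :: real assumes e: "e > 0"
  obtains d where "d > 0" "\<And>A :: real^3^3. (\<And>i j. \<bar>A$i$j - mat 1$i$j\<bar> \<le> d) \<Longrightarrow> \<bar>det A - 1\<bar> \<le> e"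
proof -
  have "((\<lambda>A :: real^3^3. det A) \<longlongrightarrow> det (mat 1 :: real^3^3)) (nhds (mat 1))"
    unfolding det_3 by (intro tendsto_intros filterlim_ident)
  from tendstoD[OF this e] obtain d where d: "d > 0" "\<And>A :: real^3^3. dist A (mat 1) < d \<Longrightarrow> \<bar>det A - 1\<bar> < e"
    unfolding eventually_nhds_metric by (auto simp: dist_real_def det_I)
  show ?thesis
  \<comment> \<open>The norm is at most the sum of the nine entries, hence at most 9 d / 10 <
    d.\<close>
  proof (rule that[of "d / 10"])
    fix A :: "real^3^3" assume A: "\<And>i j. \<bar>A$i$j - mat 1$i$j\<bar> \<le> d / 10"
    have "norm (A - mat 1) \<le> (\<Sum>i\<in>UNIV. norm ((A - mat 1) $ i))"
      unfolding norm_vec_def by (rule L2_set_le_sum) auto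
    also have "\<dots> \<le> (\<Sum>i\<in>(UNIV::3 set). \<Sum>j\<in>(UNIV::3 set). d / 10)"
    proof (intro sum_mono)
      fix i
      have "norm ((A - mat 1) $ i) \<le> (\<Sum>j\<in>UNIV. \<bar>(A - mat 1) $ i $ j\<bar>)" by (rule norm_le_l1_cart)
      also have "\<dots> \<le> (\<Sum>j\<in>(UNIV::3 set). d / 10)" using A by (intro sum_mono) simp
      finally show "norm ((A - mat 1) $ i) \<le> (\<Sum>j\<in>(UNIV::3 set). d / 10)" .
    qed
    also have "\<dots> < d" using d(1) by simp
    finally show "\<bar>det A - 1\<bar> \<le> e" using d(2)[of A] by (simp add: dist_norm)
  qed (use d(1) in simp)
qed

text \<open>The deformation minus the identity is \<open>shift\<close>, and the difference quotients
  of a 2k-Lipschitz map are at most 2k. This bounds the Jacobian without computing the derivative of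
  Z / |x|^2.\<close>

lemma (in small_deformation) jacobian_entry_bound:
  assumes x: "x \<in> ball 0 R" "x \<noteq> 0" and Z: "Z differentiable (at x)"
  shows "\<bar>jacobian (deform Z) (at x) $ i $ j - mat 1 $ i $ j\<bar> \<le> 2 * k"
proof -
  let ?D = "frechet_derivative (deform Z) (at x)"
  have "deform Z differentiable (at x)"
    unfolding deform_def[abs_def] using x(2) Z by (intro derivative_intros) auto
  then have D: "(deform Z has_derivative ?D) (at x)" by (simp add: frechet_derivative_works)
  have lin: "linear ?D" by (rule has_derivative_linear[OF D])
  have S: "((\<lambda>y. (deform Z y - y) $ i) has_derivative (\<lambda>v. (?D v - v) $ i)) (at x)"
    by (intro bounded_linear.has_derivative[OF bounded_linear_vec_nth] has_derivative_diff D has_derivative_ident)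
  let ?e = "axis j 1 :: real^3"
  let ?f = "\<lambda>t. (deform Z (x + t *\<^sub>R ?e) - (x + t *\<^sub>R ?e)) $ i"
  have "((\<lambda>t. (?f t - ?f 0) / t) \<longlongrightarrow> (?D ?e - ?e) $ i) (at 0)"
    using has_real_derivative_along[OF S, of ?e] by (simp add: has_field_derivative_iff)
  then have "((\<lambda>t. \<bar>(?f t - ?f 0) / t\<bar>) \<longlongrightarrow> \<bar>(?D ?e - ?e) $ i\<bar>) (at 0)" by (rule tendsto_rabs)
  moreover have "\<forall>\<^sub>F t in at 0. \<bar>(?f t - ?f 0) / t\<bar> \<le> 2 * k"
    unfolding eventually_at
  proof (intro exI[of _ "R - norm x"] conjI ballI impI)
    show "0 < R - norm x" using x(1) by simp
    fix t :: real assume t: "t \<noteq> 0 \<and> dist t 0 < R - norm x"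
    have sh: "deform Z y - y = shift y" for y by (simp add: deform_def shift_def algebra_simps)
    have xt: "x + t *\<^sub>R ?e \<in> cball 0 R"
      using norm_triangle_ineq[of x "t *\<^sub>R ?e"] t by (simp add: dist_real_def)
    have "\<bar>?f t - ?f 0\<bar> = \<bar>(shift (x + t *\<^sub>R ?e) - shift x) $ i\<bar>" by (simp add: sh[symmetric])
    also have "\<dots> \<le> norm (shift (x + t *\<^sub>R ?e) - shift x)" by (rule component_le_norm_cart)
    also have "\<dots> \<le> 2 * k * norm (x + t *\<^sub>R ?e - x)" using x(1) by (intro shift_lipschitz xt) auto
    finally have "\<bar>?f t - ?f 0\<bar> \<le> 2 * k * \<bar>t\<bar>" by simp
    then show "\<bar>(?f t - ?f 0) / t\<bar> \<le> 2 * k" using t by (simp add: divide_le_eq)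
  qed
  ultimately have "\<bar>(?D ?e - ?e) $ i\<bar> \<le> 2 * k" by (rule tendsto_upperbound) simp
  then show ?thesis by (simp add: jacobian_def matrix_def mat_def axis_def)
qed

text \<open>The Jacobian determinants tend to 1 uniformly on the punctured ball, so the denominator
  of the mass factor tends to the mass of \<rho>.\<close>

lemma (in deformation_sequence) mass_factor_tendsto:
  assumes nz: "\<And>n. mass_factor R \<rho> (Z n) \<noteq> 0"
    and diff: "\<And>n x. x \<in> ball 0 R \<Longrightarrow> Z n differentiable (at x)"
  shows "(\<lambda>n. 1 / mass_factor R \<rho> (Z n)) \<longlonglongrightarrow> 1"
proof -
  let ?J = "\<lambda>n x. det (jacobian (deform (Z n)) (at x))"
  let ?I = "\<lambda>n. (LINT x:ball 0 R|lborel. \<rho> x * ?J n x)"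
  define m where "m = (LINT x|lborel. \<rho> x)"
  have m: "m > 0" unfolding m_def by (rule rho_integral_pos)
  have ball: "indicator (ball 0 R) x *\<^sub>R \<rho> x = \<rho> x" for x using rho_zero[of x] by (auto simp: indicator_def)
  have ball': "indicator (ball 0 R) x *\<^sub>R (\<rho> x * c) = \<rho> x * c" for x c using rho_zero[of x] by (auto simp: indicator_def)
  have mf: "mass_factor R \<rho> (Z n) = m / (LINT x|lborel. \<rho> x * ?J n x)" for n
    unfolding mass_factor_def set_lebesgue_integral_def ball ball' m_def ..
  have int: "integrable lborel (\<lambda>x. \<rho> x * ?J n x)" for n
  proof (rule ccontr)
    \<comment> \<open>A non-integrable function has integral 0 by convention, and division by that 0
      would give mass factor 0, contrary to \<open>nz\<close>.\<close>
    assume "\<not> integrable lborel (\<lambda>x. \<rho> x * ?J n x)"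
    then have "(LINT x|lborel. \<rho> x * ?J n x) = 0" by (rule not_integrable_integral_eq)
    then show False using nz[of n] by (simp add: mf)
  qed
  have "(\<lambda>n. (LINT x|lborel. \<rho> x * ?J n x)) \<longlonglongrightarrow> m"
  proof (rule LIMSEQ_I)
    fix e :: real assume e: "e > 0"
    obtain d where d: "d > 0" "\<And>A :: real^3^3. (\<And>i j. \<bar>A$i$j - mat 1$i$j\<bar> \<le> d) \<Longrightarrow> \<bar>det A - 1\<bar> \<le> e / (2 * m)"
      using det_near_one[of "e / (2 * m)"] e m by auto
    have "(\<lambda>n. 2 * (C * \<kappa> n)) \<longlonglongrightarrow> 0"
      using tendsto_mult_right_zero[OF tendsto_mult_right_zero[OF kappa_lim]] by blast
    from LIMSEQ_D[OF this d(1)] obtain N where N: "\<And>n. n \<ge> N \<Longrightarrow> \<bar>2 * (C * \<kappa> n)\<bar> < d"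
      by auto
    have "norm ((LINT x|lborel. \<rho> x * ?J n x) - m) < e" if n: "n \<ge> N" for n
    proof -
      have "(LINT x|lborel. \<rho> x * ?J n x) - m = (LINT x|lborel. \<rho> x * ?J n x - \<rho> x)"
        unfolding m_def using int[of n] bdd_supp_integrable[OF rho_bdd_supp] by (simp add: lint_diff)
      then have "\<bar>(LINT x|lborel. \<rho> x * ?J n x) - m\<bar> \<le> (LINT x|lborel. \<bar>\<rho> x * ?J n x - \<rho> x\<bar>)"
        by (simp only: integral_abs_bound)
      also have "\<dots> \<le> (LINT x|lborel. e / (2 * m) * \<rho> x)"
      proof (rule integral_mono_AE)
        show "AE x in lborel. \<bar>\<rho> x * ?J n x - \<rho> x\<bar> \<le> e / (2 * m) * \<rho> x"
          using AE_lborel_singleton[of 0]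
        proof eventually_elim
          case (elim x)
          show ?case
          proof (cases "x \<in> ball 0 R")
            case True
            have "\<bar>?J n x - 1\<bar> \<le> e / (2 * m)"
            proof (rule d(2))
              fix i j
              have "\<bar>jacobian (deform (Z n)) (at x) $ i $ j - mat 1 $ i $ j\<bar> \<le> 2 * (C * \<kappa> n)"
                by (rule S.jacobian_entry_bound[OF True elim diff[OF True]])
              then show "\<bar>jacobian (deform (Z n)) (at x) $ i $ j - mat 1 $ i $ j\<bar> \<le> d"
                using N[OF n] by linarith
            qed
            from mult_left_mono[OF this rho_nonneg[of x]] show ?thesis
              using rho_nonneg[of x] by (simp add: abs_mult[symmetric] right_diff_distrib abs_mult_pos' mult.commute)
          qed (simp add: rho_zero)
        qed
      qed (use int[of n] bdd_supp_integrable[OF rho_bdd_supp] in auto)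
      also have "\<dots> = e / 2" using m by (simp add: m_def[symmetric])
      also have "\<dots> < e" using e by simp
      finally show ?thesis by simp
    qed
    then show "\<exists>N. \<forall>n\<ge>N. norm ((LINT x|lborel. \<rho> x * ?J n x) - m) < e" by blast
  qed
  then have "(\<lambda>n. (LINT x|lborel. \<rho> x * ?J n x) / m) \<longlonglongrightarrow> m / m" using m by (intro tendsto_divide) auto
  then show ?thesis unfolding mf using m by simp
qed

lemma cyl_radius_deform: "cyl_radius (deform Z x) = \<bar>1 + Z x / (norm x)\<^sup>2\<bar> * cyl_radius x"
proof -
  have "(deform Z x $ 1)\<^sup>2 + (deform Z x $ 2)\<^sup>2 = (1 + Z x / (norm x)\<^sup>2)\<^sup>2 * ((x$1)\<^sup>2 + (x$2)\<^sup>2)"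
    by (simp add: deform_def power_mult_distrib distrib_left)
  then show ?thesis by (simp add: cyl_radius_def real_sqrt_mult)
qed

lemma centrifugal_integral:
  fixes \<omega> :: "real \<Rightarrow> real"
  assumes w: "\<forall>s\<ge>0. \<omega> s = w" and c: "0 \<le> c"
  shows "(LINT s:{0..c}|lborel. (\<omega> s)\<^sup>2 * s) = w\<^sup>2 / 2 * c\<^sup>2"
proof -
  have "(LINT s:{0..c}|lborel. (\<omega> s)\<^sup>2 * s) = (LINT s:{0..c}|lborel. w\<^sup>2 * s)"
    unfolding set_lebesgue_integral_def
    using w by (intro lint_cong) (auto simp: indicator_def)
  also have "\<dots> = (LINT s|lborel. w\<^sup>2 * s * indicator {0..c} s)"
    unfolding set_lebesgue_integral_def by (intro lint_cong refl) simp
  also have "\<dots> = w\<^sup>2 / 2 * c\<^sup>2 - w\<^sup>2 / 2 * 0\<^sup>2"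
  proof (rule integral_FTC_Icc_real[OF c])
    fix x :: real
    show "DERIV (\<lambda>x. w\<^sup>2 / 2 * x\<^sup>2) x :> w\<^sup>2 * x" by (auto intro!: derivative_eq_intros)
    show "isCont (\<lambda>x. w\<^sup>2 * x) x" by (intro continuous_intros)
  qed
  finally show ?thesis by simp
qed

section \<open>The equation satisfied along the curve\<close>

context deformed_density begin

lemma F_op_eq:
  assumes w: "\<forall>s\<ge>0. \<omega> s = w"
  shows "F_op p \<omega> R \<rho> Z \<kappa> x = mass_factor R \<rho> Z * (newton moved (deform Z x) - newton moved 0)
     + \<kappa> * (w\<^sup>2 / 2 * (cyl_radius (deform Z x))\<^sup>2)
     - enthalpy p (mass_factor R \<rho> Z * \<rho> x) + enthalpy p (mass_factor R \<rho> Z * \<rho> 0)"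
proof -
  have "0 \<le> cyl_radius (deform Z x)" by (simp add: cyl_radius_def)
  from centrifugal_integral[OF w this] show ?thesis
    unfolding F_op_def by (simp add: newton_moved)
qed

lemma scale_pos:
  assumes "x \<in> cball 0 R"
  shows "1 + Z x / (norm x)\<^sup>2 \<ge> 3/4"
proof (cases "x = 0")
  case False
  have "- (1/4) * (norm x)\<^sup>2 \<le> Z x"
    using Z_le[OF assms] mult_right_mono[OF k(2), of "(norm x)\<^sup>2"] by simp
  then have "- (1/4) \<le> Z x / (norm x)\<^sup>2" using False by (simp add: pos_le_divide_eq)
  then show ?thesis by linarith
qed simp

lemma norm_axis_R: "norm (axis i R :: real^3) = R"
  using R_pos by (simp add: norm_eq_sqrt_inner inner_axis_axis)

text \<open>If the mass factor were \<open>0\<close>, which is also its junk value for a vanishing or divergent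
  integral in the denominator, only the centrifugal term would remain in the equation.\<close>

lemma mass_factor_nonzero:
  assumes w: "\<forall>s\<ge>0. \<omega> s = w" and w0: "w \<noteq> 0" and k0: "\<kappa> \<noteq> 0"
    and F: "\<And>x. x \<in> cball 0 R \<Longrightarrow> F_op p \<omega> R \<rho> Z \<kappa> x = 0"
  shows "mass_factor R \<rho> Z \<noteq> 0"
proof
  assume z: "mass_factor R \<rho> Z = 0"
  let ?e = "axis 1 R :: real^3"
  have e: "?e \<in> cball 0 R" using norm_axis_R by simp
  have "\<kappa> * (w\<^sup>2 / 2 * (cyl_radius (deform Z ?e))\<^sup>2) = 0"
    using F[OF e] unfolding F_op_eq[OF w] by (simp add: z)
  then have "cyl_radius (deform Z ?e) = 0" using w0 k0 by simp
  moreover have "cyl_radius ?e = R" using R_pos by (simp add: cyl_radius_def axis_def)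
  ultimately show False using scale_pos[OF e] R_pos by (simp add: cyl_radius_deform)
qed

end

text \<open>Subtracting the equation at \<open>swap13 x\<close> from the one at \<open>x\<close> eliminates the enthalpy, which is
  radial, so the linearization involves only the potential and the centrifugal term.\<close>

lemma (in deformation_sequence) linearized_equation:
  assumes w: "\<forall>s\<ge>0. \<omega> s = w"
    and F: "\<And>n x. x \<in> cball 0 R \<Longrightarrow> F_op p \<omega> R \<rho> (Z n) (\<kappa> n) x = 0"
    and nz: "\<And>n. mass_factor R \<rho> (Z n) \<noteq> 0"
    and mass: "(\<lambda>n. 1 / mass_factor R \<rho> (Z n)) \<longlonglongrightarrow> 1"
    and x: "x \<in> cball 0 R"
  shows "gravity x * (\<eta> x - \<eta> (swap13 x)) = newton (\<lambda>y. slope y * \<eta> y) x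
     - newton (\<lambda>y. slope y * \<eta> y) (swap13 x) + w\<^sup>2 / 2 * ((x$1)\<^sup>2 - (x$3)\<^sup>2)"
proof -
  have nT: "norm (swap13 x) = norm x" by (rule orthogonal_transformation_norm[OF orthogonal_swap13])
  then have x': "swap13 x \<in> cball 0 R" using x by simp
  let ?r = "\<lambda>n z. cyl_radius (deform (Z n) z)"
  have rl: "(\<lambda>n. (?r n z)\<^sup>2) \<longlonglongrightarrow> (cyl_radius z)\<^sup>2" if z: "z \<in> cball 0 R" for z
  proof -
    have "(\<lambda>n. Z n z / \<kappa> n * \<kappa> n) \<longlonglongrightarrow> \<eta> z * 0" by (intro tendsto_mult Z_lim z kappa_lim)
    moreover have "Z n z / \<kappa> n * \<kappa> n = Z n z" for n using kappa_pos[of n] by simp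
    ultimately have "(\<lambda>n. Z n z) \<longlonglongrightarrow> 0" by simp
    then have "(\<lambda>n. (\<bar>1 + Z n z * inverse ((norm z)\<^sup>2)\<bar> * cyl_radius z)\<^sup>2) \<longlonglongrightarrow> (\<bar>1 + 0 * inverse ((norm z)\<^sup>2)\<bar> * cyl_radius z)\<^sup>2"
      by (intro tendsto_intros)
    then show ?thesis by (simp add: cyl_radius_deform divide_inverse)
  qed
  let ?V = "\<lambda>n z. newton (S.moved n) (deform (Z n) z)"
  have eq: "(?V n x - newton \<rho> x) / \<kappa> n - (?V n (swap13 x) - newton \<rho> (swap13 x)) / \<kappa> n
     = - (1 / mass_factor R \<rho> (Z n) * (w\<^sup>2 / 2 * ((?r n x)\<^sup>2 - (?r n (swap13 x))\<^sup>2)))" for n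
  proof -
    let ?M = "mass_factor R \<rho> (Z n)"
    define V V' r r' M where "V = ?V n x" and "V' = ?V n (swap13 x)" and "r = w\<^sup>2 / 2 * (?r n x)\<^sup>2"
      and "r' = w\<^sup>2 / 2 * (?r n (swap13 x))\<^sup>2" and "M = ?M"
    have rho: "\<rho> (swap13 x) = \<rho> x" by (rule radial[OF nT])
    have "M * (V - newton (S.moved n) 0) + \<kappa> n * r = M * (V' - newton (S.moved n) 0) + \<kappa> n * r'"
      using F[OF x, of n] F[OF x', of n]
      unfolding S.F_op_eq[OF w] rho V_def V'_def r_def r'_def M_def by linarith
    then have "M * (V - V') = - (r - r') * \<kappa> n" by (simp add: algebra_simps)
    \<comment> \<open>Division by the mass factor leaves it only in front of the centrifugal
      difference, so its limit suffices and no rate of convergence is required.\<close>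
    then have "(V - V') / \<kappa> n = - (1 / M * (r - r'))"
      using nz[of n] kappa_pos[of n] unfolding M_def[symmetric] by (simp add: field_simps)
    then have "(?V n x - ?V n (swap13 x)) / \<kappa> n = - (1 / ?M * (w\<^sup>2 / 2 * ((?r n x)\<^sup>2 - (?r n (swap13 x))\<^sup>2)))"
      unfolding V_def V'_def r_def r'_def M_def right_diff_distrib .
    then show ?thesis using newton_rho_radial[OF nT] by (simp add: diff_divide_distrib)
  qed
  have A: "(\<lambda>n. - (1 / mass_factor R \<rho> (Z n) * (w\<^sup>2 / 2 * ((?r n x)\<^sup>2 - (?r n (swap13 x))\<^sup>2))))
     \<longlonglongrightarrow> - (1 * (w\<^sup>2 / 2 * ((cyl_radius x)\<^sup>2 - (cyl_radius (swap13 x))\<^sup>2)))"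
    by (intro tendsto_intros mass rl x x')
  have B: "(\<lambda>n. (?V n x - newton \<rho> x) / \<kappa> n - (?V n (swap13 x) - newton \<rho> (swap13 x)) / \<kappa> n)
     \<longlonglongrightarrow> (newton (\<lambda>y. slope y * \<eta> y) x - gravity x * \<eta> x)
       - (newton (\<lambda>y. slope y * \<eta> y) (swap13 x) - gravity (swap13 x) * \<eta> (swap13 x))"
    by (intro tendsto_diff deform_quotient_tendsto x x')
  have "(newton (\<lambda>y. slope y * \<eta> y) x - gravity x * \<eta> x)
       - (newton (\<lambda>y. slope y * \<eta> y) (swap13 x) - gravity (swap13 x) * \<eta> (swap13 x))
     = - (w\<^sup>2 / 2 * ((cyl_radius x)\<^sup>2 - (cyl_radius (swap13 x))\<^sup>2))"
    using LIMSEQ_unique[OF B[unfolded eq] A] by simp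
  moreover have "(cyl_radius x)\<^sup>2 - (cyl_radius (swap13 x))\<^sup>2 = (x$1)\<^sup>2 - (x$3)\<^sup>2"
    by (simp add: cyl_radius_def)
  ultimately show ?thesis using gravity_radial[OF nT] by (simp add: algebra_simps)
qed

lemma radial_solution_density:
  assumes R: "R > 0" and p: "admissible_pressure p \<gamma> \<gamma>s" and sol: "radial_solution p \<gamma> R \<rho>0"
  shows "decreasing_radial_density \<rho>0 R"
proof -
  have rad: "radial_density \<rho>0 R"
  proof (rule radial_density.intro[OF R])
    show "C1_on UNIV \<rho>0" using sol unfolding radial_solution_def C1_holder_def by (elim conjE)
  qed (use sol in \<open>unfold radial_solution_def, elim conjE, blast\<close>)+
  interpret radial_density \<rho>0 R by (rule rad)
  let ?f = "\<lambda>x. newton \<rho>0 x - enthalpy p (\<rho>0 x)"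
  have crit: "\<forall>x\<in>ball 0 R. GDERIV ?f x :> 0"
    using sol unfolding radial_solution_def newton_def by (elim conjE)
  have "\<exists>c. \<forall>x\<in>ball 0 R. ?f x = c"
  proof (rule has_derivative_zero_constant)
    fix x :: "real^3" assume "x \<in> ball 0 R"
    with crit have "GDERIV ?f x :> 0" by blast
    then show "(?f has_derivative (\<lambda>h. 0)) (at x within ball 0 R)"
      by (simp add: gderiv_def has_derivative_at_withinI)
  qed simp
  then obtain c where c: "\<And>x. x \<in> ball 0 R \<Longrightarrow> newton \<rho>0 x = enthalpy p (\<rho>0 x) + c"
    by (force simp: algebra_simps)
  show ?thesis
  proof unfold_locales
    show "\<rho>0 y \<le> \<rho>0 x" if "norm x < norm y" for x y
      by (rule antimono_of_hydrostatic_balance[OF enthalpy_strict_mono[OF p] c that])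
  qed
qed

theorem theorem4p2:
  fixes \<omega> p :: "real \<Rightarrow> real" and \<beta> \<gamma> \<gamma>s R \<epsilon> :: real
    and \<rho>0 :: "real^3 \<Rightarrow> real" and \<zeta> :: "real \<Rightarrow> real^3 \<Rightarrow> real"
  assumes "\<beta> \<in> {0<..<1}" and "C1_holder_loc_halfline \<beta> (\<lambda>s. (\<omega> s)\<^sup>2)"
    and "admissible_pressure p \<gamma> \<gamma>s"
    and "R > 0" and "radial_solution p \<gamma> R \<rho>0"
    and mass: "\<exists>D. (total_mass p has_real_derivative D) (at (\<rho>0 0)) \<and> D \<noteq> 0"
    and const: "\<exists>w. w \<noteq> 0 \<and> (\<forall>s\<ge>0. \<omega> s = w)"
    and "\<epsilon> > 0" and curve: "solution_curve p \<omega> R \<rho>0 \<epsilon> \<zeta>"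
  shows "\<exists>\<delta>>0. \<delta> \<le> \<epsilon> \<and> (\<forall>\<kappa>. 0 < \<kappa> \<and> \<kappa> < \<delta> \<longrightarrow>
           frontier (supp (rotating_density R \<rho>0 (\<zeta> \<kappa>))) = deform (\<zeta> \<kappa>) ` sphere 0 R \<and>
           (\<forall>xe\<in>sphere 0 R. \<forall>xp\<in>{vector [0, 0, R], vector [0, 0, - R]}.
              xe $ 3 = 0 \<longrightarrow> norm (deform (\<zeta> \<kappa>) xe) > norm (deform (\<zeta> \<kappa>) xp)))"
proof -
  note R = \<open>R > 0\<close>
  let ?B = "cball (0::real^3) R"
  interpret decreasing_radial_density \<rho>0 R
    by (rule radial_solution_density) fact+
  obtain w where w0: "w \<noteq> 0" and w: "\<forall>s\<ge>0. \<omega> s = w" using const by blast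
  have X: "X_C1_curve R \<epsilon> \<zeta>" and z0: "\<And>x. x \<in> ?B \<Longrightarrow> \<zeta> 0 x = 0"
    and F: "\<And>\<kappa> x. \<kappa> \<in> {-\<epsilon><..<\<epsilon>} \<Longrightarrow> x \<in> ?B \<Longrightarrow> F_op p \<omega> R \<rho>0 (\<zeta> \<kappa>) \<kappa> x = 0"
    using curve unfolding solution_curve_def by blast+
  obtain d C \<eta> where d: "d > 0" "d \<le> \<epsilon>" and C: "C \<ge> 0"
    and lip_zeta: "\<And>\<kappa> x y. 0 < \<kappa> \<Longrightarrow> \<kappa> < d \<Longrightarrow> x \<in> ?B \<Longrightarrow> y \<in> ?B \<Longrightarrow>
      \<bar>\<zeta> \<kappa> x - \<zeta> \<kappa> y\<bar> \<le> C * \<kappa> * max (norm x) (norm y) * norm (x - y)"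
    and lim_zeta: "\<And>x. x \<in> ?B \<Longrightarrow> ((\<lambda>\<kappa>. \<zeta> \<kappa> x / \<kappa>) \<longlongrightarrow> \<eta> x) (at_right 0)"
    using X_C1_curve_expansion[OF R \<open>\<epsilon> > 0\<close> X z0] by blast
  have Xs: "\<zeta> \<kappa> \<in> X_space R" if "\<kappa> \<in> {-\<epsilon><..<\<epsilon>}" for \<kappa>
    using X that by (simp add: X_C1_curve_def)
  have axisym: "cyl_radius x = cyl_radius y \<and> x$3 = y$3 \<longrightarrow> \<zeta> \<kappa> x = \<zeta> \<kappa> y"
    if "\<kappa> \<in> {-\<epsilon><..<\<epsilon>}" "x \<in> ?B" "y \<in> ?B" for \<kappa> x y
    using Xs[OF that(1)] that(2,3) unfolding X_space_def by blast
  have evenness: "\<zeta> \<kappa> (vector [x$1, x$2, - x$3]) = \<zeta> \<kappa> x" if "\<kappa> \<in> {-\<epsilon><..<\<epsilon>}" "x \<in> ?B" for \<kappa> x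
    using Xs[OF that(1)] that(2) unfolding X_space_def by blast
  have zeta0: "\<zeta> \<kappa> 0 = 0" if "\<kappa> \<in> {-\<epsilon><..<\<epsilon>}" for \<kappa>
    using Xs[OF that] unfolding X_space_def by blast
  \<comment> \<open>Chosen so that C \<kappa> <= 1/4, as a small deformation requires; C + 1 instead
    of C covers C = 0.\<close>
  define d1 where "d1 = min d (1 / (4 * (C + 1)))"
  have d1: "d1 > 0" "d1 \<le> d" using d(1) C by (auto simp: d1_def)
  have small: "C * \<kappa> \<le> 1/4" if "0 < \<kappa>" "\<kappa> < d1" for \<kappa>
  proof -
    have "(C + 1) * \<kappa> \<le> (C + 1) * (1 / (4 * (C + 1)))"
      using that C by (intro mult_left_mono) (auto simp: d1_def)
    also have "\<dots> = 1/4" using C by simp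
    finally show ?thesis using that by (simp add: distrib_right)
  qed
  have dd: "deformed_density \<rho>0 R (\<zeta> \<kappa>) (C * \<kappa>)" if k: "0 < \<kappa>" "\<kappa> < d1" for \<kappa>
  proof unfold_locales
    show "0 \<le> C * \<kappa>" using C k by simp
    show "C * \<kappa> \<le> 1/4" by (rule small[OF k])
    show "\<bar>\<zeta> \<kappa> x - \<zeta> \<kappa> y\<bar> \<le> C * \<kappa> * max (norm x) (norm y) * norm (x - y)" if "x \<in> ?B" "y \<in> ?B" for x y
      using k d1 that by (intro lip_zeta) auto
    show "\<zeta> \<kappa> 0 = 0" using k d d1 by (intro zeta0) auto
  qed (rule R)
  have nz: "mass_factor R \<rho>0 (\<zeta> \<kappa>) \<noteq> 0" if k: "0 < \<kappa>" "\<kappa> < d1" for \<kappa>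
    by (rule deformed_density.mass_factor_nonzero[OF dd[OF k] w w0 _ F]) (use k d d1 in auto)

  have "\<eta> (axis 3 R) < \<eta> (axis 1 R)"
  proof -
    \<comment> \<open>The offset 2 keeps \<open>K 0\<close> strictly below
      \<open>d1\<close>.\<close>
    define K where "K n = d1 / real (n + 2)" for n
    have K: "0 < K n" "K n < d1" for n using d1(1) by (auto simp: K_def divide_less_eq)
    have K0: "K \<longlonglongrightarrow> 0"
      unfolding K_def by (rule LIMSEQ_ignore_initial_segment[OF lim_const_over_n])
    have Kr: "filterlim K (at_right 0) sequentially"
      using K0 K by (simp add: filterlim_at less_imp_neq[symmetric])
    interpret deformation_sequence \<rho>0 R "\<lambda>n. \<zeta> (K n)" K C \<eta>
    proof unfold_locales
      show "\<bar>\<zeta> (K n) x - \<zeta> (K n) y\<bar> \<le> C * K n * max (norm x) (norm y) * norm (x - y)"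
        if "x \<in> ?B" "y \<in> ?B" for n x y
        using K[of n] d1 that by (intro lip_zeta) auto
      show "\<zeta> (K n) 0 = 0" for n using K[of n] d d1 by (intro zeta0) auto
      show "(\<lambda>n. \<zeta> (K n) x / K n) \<longlonglongrightarrow> \<eta> x" if "x \<in> ?B" for x
        by (rule filterlim_compose[OF lim_zeta[OF that] Kr])
    qed (use K K0 C small in auto)
    have nzK: "mass_factor R \<rho>0 (\<zeta> (K n)) \<noteq> 0" for n by (rule nz[OF K])
    have KI: "K n \<in> {-\<epsilon><..<\<epsilon>}" for n using K[of n] d d1 by auto
    have diff: "\<zeta> (K n) differentiable (at x)" if "x \<in> ball 0 R" for n x
    proof -
      have "\<zeta> (K n) differentiable (at x within ?B)"
        using Xs[OF KI[of n]] that subsetD[OF ball_subset_cball, of x 0 R]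
        unfolding X_space_def C1_on_def differentiable_on_def by blast
      then show ?thesis using at_within_interior[of x ?B] that by (simp add: interior_cball)
    qed
    have mf: "(\<lambda>n. 1 / mass_factor R \<rho>0 (\<zeta> (K n))) \<longlonglongrightarrow> 1"
      by (rule mass_factor_tendsto[OF nzK diff])
    show ?thesis
    proof (rule equator_exceeds_pole[OF eta_lipschitz eta_zero])
      show "w\<^sup>2 / 2 > 0" using w0 by simp
      show "gravity x * (\<eta> x - \<eta> (swap13 x)) = newton (\<lambda>y. slope y * \<eta> y) x
         - newton (\<lambda>y. slope y * \<eta> y) (swap13 x) + w\<^sup>2 / 2 * ((x$1)\<^sup>2 - (x$3)\<^sup>2)" if "x \<in> ?B" for x
        by (rule linearized_equation[OF w F[OF KI] nzK mf that])
      \<comment> \<open>The half-turn is the reflection x1 -> - x1, covered by axisymmetry, followed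
        by x3 -> - x3, covered by evenness. The invariance holds along the sequence and passes to
        the limit.\<close>
      show "\<eta> (antiswap13 (swap13 x)) = \<eta> x" if x: "x \<in> ?B" for x
      proof (rule LIMSEQ_unique)
        have n: "antiswap13 (swap13 x) \<in> ?B" "vector [- x$1, x$2, x$3] \<in> ?B"
          using x by (simp_all add: norm_vec_def L2_set_def sum_3)
        show "(\<lambda>n. \<zeta> (K n) (antiswap13 (swap13 x)) / K n) \<longlonglongrightarrow> \<eta> (antiswap13 (swap13 x))"
          by (rule Z_lim[OF n(1)])
        have "\<zeta> (K n) (antiswap13 (swap13 x)) = \<zeta> (K n) x" for n
        proof -
          let ?y = "vector [- x$1, x$2, x$3] :: real^3"
          have refl3: "antiswap13 (swap13 x) = vector [?y$1, ?y$2, - ?y$3]" by (simp add: vec_eq_iff forall_3)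
          have "\<zeta> (K n) (antiswap13 (swap13 x)) = \<zeta> (K n) ?y"
            unfolding refl3 by (rule evenness[OF KI n(2)])
          also have "\<dots> = \<zeta> (K n) x"
          proof -
            have "cyl_radius ?y = cyl_radius x \<and> ?y$3 = x$3" by (simp add: cyl_radius_def)
            with axisym[OF KI n(2) x] show ?thesis by blast
          qed
          finally show ?thesis .
        qed
        then show "(\<lambda>n. \<zeta> (K n) (antiswap13 (swap13 x)) / K n) \<longlonglongrightarrow> \<eta> x"
          using Z_lim[OF x] by simp
      qed
    qed
  qed
  moreover have axis_B: "axis i R \<in> ?B" for i :: 3
    using R by (simp add: norm_eq_sqrt_inner inner_axis_axis)
  \<comment> \<open>The strict inequality between the derivatives at \<kappa> = 0 forces the same
    inequality between the quotients for all small positive \<kappa>.\<close>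
  ultimately have "\<forall>\<^sub>F \<kappa> in at_right 0. \<zeta> \<kappa> (axis 1 R) / \<kappa> - \<zeta> \<kappa> (axis 3 R) / \<kappa> > 0"
    by (intro order_tendstoD(1)[OF tendsto_diff[OF lim_zeta lim_zeta]]) auto
  then obtain d2 where d2: "d2 > 0" "\<And>\<kappa>. 0 < \<kappa> \<Longrightarrow> \<kappa> < d2 \<Longrightarrow> \<zeta> \<kappa> (axis 1 R) / \<kappa> - \<zeta> \<kappa> (axis 3 R) / \<kappa> > 0"
    unfolding eventually_at_right_field by auto
  show ?thesis
  proof (intro exI[of _ "min d1 d2"] conjI allI impI)
    show "min d1 d2 > 0" "min d1 d2 \<le> \<epsilon>" using d d1 d2 by auto
    fix \<kappa> assume "0 < \<kappa> \<and> \<kappa> < min d1 d2"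
    then have k: "0 < \<kappa>" "\<kappa> < d1" "\<kappa> < d2" by auto
    interpret S: deformed_density \<rho>0 R "\<zeta> \<kappa>" "C * \<kappa>" by (rule dd[OF k(1,2)])
    show "frontier (supp (rotating_density R \<rho>0 (\<zeta> \<kappa>))) = deform (\<zeta> \<kappa>) ` sphere 0 R"
      by (rule S.frontier_supp_rotating[OF nz[OF k(1,2)]])
    have kI: "\<kappa> \<in> {-\<epsilon><..<\<epsilon>}" using k d d1 by auto
    have lt: "\<zeta> \<kappa> (axis 3 R) < \<zeta> \<kappa> (axis 1 R)"
      using d2(2)[OF k(1,3)] k(1) by (simp add: diff_divide_distrib[symmetric] zero_less_divide_iff)
    show "\<forall>xe\<in>sphere 0 R. \<forall>xp\<in>{vector [0, 0, R], vector [0, 0, - R]}.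
              xe $ 3 = 0 \<longrightarrow> norm (deform (\<zeta> \<kappa>) xe) > norm (deform (\<zeta> \<kappa>) xp)"
    proof (intro ballI impI)
      fix xe xp :: "real^3"
      assume xe: "xe \<in> sphere 0 R" "xe $ 3 = 0" and xp: "xp \<in> {vector [0, 0, R], vector [0, 0, - R]}"
      \<comment> \<open>Axisymmetry reduces every equatorial point to (R, 0, 0); evenness in x3 will
        likewise identify the two poles.\<close>
      have "\<zeta> \<kappa> xe = \<zeta> \<kappa> (axis 1 R)"
      proof -
        have "(xe$1)\<^sup>2 + (xe$2)\<^sup>2 = R\<^sup>2" using xe norm_sq_3[of xe] by simp
        then have "cyl_radius xe = cyl_radius (axis 1 R) \<and> xe $ 3 = (axis 1 R :: real^3) $ 3"
          using R xe by (simp add: cyl_radius_def axis_def)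
        moreover have "xe \<in> ?B" using xe by simp
        ultimately show ?thesis using axisym[OF kI _ axis_B[of 1]] by blast
      qed
      moreover have a3: "vector [0, 0, R] = (axis 3 R :: real^3)" by (simp add: vec_eq_iff forall_3 axis_def)
      have "\<zeta> \<kappa> xp = \<zeta> \<kappa> (axis 3 R)"
      proof (cases "xp = vector [0, 0, R]")
        case False
        then have "xp = vector [(axis 3 R :: real^3) $ 1, (axis 3 R :: real^3) $ 2, - ((axis 3 R :: real^3) $ 3)]"
          using xp by (simp add: axis_def)
        then show ?thesis using evenness[OF kI axis_B[of 3]] by simp
      qed (simp add: a3)
      moreover have np: "norm xp = R" using xp R by (auto simp: norm_vec_def L2_set_def sum_3)
      moreover have ne: "norm xe = R" using xe by simp
      ultimately have "1 + \<zeta> \<kappa> xp / (norm xp)\<^sup>2 < 1 + \<zeta> \<kappa> xe / (norm xe)\<^sup>2"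
        using lt R by (simp add: divide_strict_right_mono)
      \<comment> \<open>Positive scale factors let the comparison survive the absolute values in the
        norms.\<close>
      moreover have "1 + \<zeta> \<kappa> xp / (norm xp)\<^sup>2 \<ge> 3/4" using np by (intro S.scale_pos) simp
      ultimately have "\<bar>1 + \<zeta> \<kappa> xp / (norm xp)\<^sup>2\<bar> < \<bar>1 + \<zeta> \<kappa> xe / (norm xe)\<^sup>2\<bar>" by linarith
      then have "\<bar>1 + \<zeta> \<kappa> xp / (norm xp)\<^sup>2\<bar> * R < \<bar>1 + \<zeta> \<kappa> xe / (norm xe)\<^sup>2\<bar> * R"
        using R by (rule mult_strict_right_mono)
      then show "norm (deform (\<zeta> \<kappa>) xe) > norm (deform (\<zeta> \<kappa>) xp)"
        by (simp add: deform_def np ne)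
    qed
  qed
qed

end
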